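(* Let $R$ be a discrete valuation ring with uniformizer $\pi$ whose residue field is finite of cardinality at least three. Let $\lambda=(\lambda_1^{\rho_1}>\lambda_2^{\rho_2}>\dots>\lambda_k^{\rho_k})$ be a partition, let $R_\lambda$ be the corresponding finite $R$-module and $G_\lambda$ its automorphism group. Then for every orbit $\mathcal{O}\subset R_\lambda$ of $G_\lambda$, the permutation representation $\mathbb{C}[\mathcal{O}]$ of $G_\lambda$ is multiplicity free.
   Context: A partition $\lambda=(\lambda_1^{\rho_1}>\dots>\lambda_k^{\rho_k})$ consists of positive integers $\lambda_1>\dots>\lambda_k$ and positive integers (multiplicities) $\rho_1,\dots,\rho_k$. The corresponding finite $R$-module is $R_\lambda=(R/\pi^{\lambda_1}R)^{\oplus\rho_1}\oplus\dots\oplus(R/\pi^{\lambda_k}R)^{\oplus\rho_k}$, and $G_\lambda=\mathrm{Aut}_R(R_\lambda)$ acts on $R_\lambda$ in the natural way. A complex representation is multiplicity free if every irreducible representation occurs in it with multiplicity at most one. *)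

theory Defs
  imports
    "HOL-Algebra.Algebra"
    "HOL-Algebra.Algebraic_Closure_Type"
    Complex_Main
begin

section \<open>Discrete valuation rings\<close>

text \<open>A discrete valuation ring is a principal ideal domain with exactly one nonzero prime
  ideal. Since the zero ideal is the only prime ideal of a field, fields are excluded.\<close>

definition discrete_valuation_ring :: "('a, 'm) ring_scheme \<Rightarrow> bool" where
  "discrete_valuation_ring R \<longleftrightarrow>
     principal_domain R \<and> (\<exists>!P. primeideal P R \<and> P \<noteq> {\<zero>\<^bsub>R\<^esub>})"

definition uniformizer :: "('a, 'm) ring_scheme \<Rightarrow> 'a \<Rightarrow> bool" where
  "uniformizer R p \<longleftrightarrow> p \<in> carrier R \<and> maximalideal (PIdl\<^bsub>R\<^esub> p) R"


section \<open>Modules and their automorphism groups\<close>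

text \<open>The record type of modules extends that of rings. The fields \<open>mult\<close> and \<open>one\<close> play no role
  in the notion of a module and are left unspecified below.\<close>

definition quotient_module :: "('a, 'm) ring_scheme \<Rightarrow> 'a set \<Rightarrow> ('a, 'a set) module" where
  "quotient_module R I =
     \<lparr>carrier = carrier (R Quot I), monoid.mult = undefined, one = undefined,
      ring.zero = \<zero>\<^bsub>R Quot I\<^esub>, add = (\<oplus>\<^bsub>R Quot I\<^esub>),
      module.smult = (\<lambda>r A. (I +>\<^bsub>R\<^esub> r) \<otimes>\<^bsub>R Quot I\<^esub> A)\<rparr>"

text \<open>The direct product of a family of modules; for a finite index set this is the direct sum.\<close>

definition product_module :: "'i set \<Rightarrow> ('i \<Rightarrow> ('a, 'b) module) \<Rightarrow> ('a, 'i \<Rightarrow> 'b) module" where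
  "product_module I M =
     \<lparr>carrier = (\<Pi>\<^sub>E i\<in>I. carrier (M i)), monoid.mult = undefined, one = undefined,
      ring.zero = (\<lambda>i\<in>I. \<zero>\<^bsub>M i\<^esub>), add = (\<lambda>f g. \<lambda>i\<in>I. f i \<oplus>\<^bsub>M i\<^esub> g i),
      module.smult = (\<lambda>r f. \<lambda>i\<in>I. r \<odot>\<^bsub>M i\<^esub> f i)\<rparr>"

definition linear_maps ::
  "('a, 'm) ring_scheme \<Rightarrow> ('a, 'b) module \<Rightarrow> ('a, 'c) module \<Rightarrow> ('b \<Rightarrow> 'c) set" where
  "linear_maps R M N =
     {f \<in> carrier M \<rightarrow> carrier N.
        (\<forall>x\<in>carrier M. \<forall>y\<in>carrier M. f (x \<oplus>\<^bsub>M\<^esub> y) = f x \<oplus>\<^bsub>N\<^esub> f y) \<and>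
        (\<forall>r\<in>carrier R. \<forall>x\<in>carrier M. f (r \<odot>\<^bsub>M\<^esub> x) = r \<odot>\<^bsub>N\<^esub> f x)}"

definition module_Aut :: "('a, 'm) ring_scheme \<Rightarrow> ('a, 'b) module \<Rightarrow> ('b \<Rightarrow> 'b) monoid" where
  "module_Aut R M = BijGroup (carrier M)\<lparr>carrier := linear_maps R M M \<inter> Bij (carrier M)\<rparr>"


section \<open>The module attached to a partition\<close>

text \<open>The partition with parts \<open>lam 1 > \<dots> > lam k\<close>, where \<open>lam i\<close> has multiplicity \<open>rho i\<close>.\<close>

definition is_partition :: "nat \<Rightarrow> (nat \<Rightarrow> nat) \<Rightarrow> (nat \<Rightarrow> nat) \<Rightarrow> bool" where
  "is_partition k lam rho \<longleftrightarrow>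
     (\<forall>i\<in>{1..k}. 0 < lam i \<and> 0 < rho i) \<and>
     (\<forall>i\<in>{1..k}. \<forall>j\<in>{1..k}. i < j \<longrightarrow> lam j < lam i)"

text \<open>The index \<open>(i, j)\<close> denotes the \<open>j\<close>-th copy of the \<open>i\<close>-th quotient.\<close>

definition partition_module ::
  "('a, 'm) ring_scheme \<Rightarrow> 'a \<Rightarrow> nat \<Rightarrow> (nat \<Rightarrow> nat) \<Rightarrow> (nat \<Rightarrow> nat) \<Rightarrow>
     ('a, nat \<times> nat \<Rightarrow> 'a set) module" where
  "partition_module R p k lam rho =
     product_module (SIGMA i:{1..k}. {1..rho i})
       (\<lambda>(i, j). quotient_module R (PIdl\<^bsub>R\<^esub> (p [^]\<^bsub>R\<^esub> lam i)))"


section \<open>Complex representations\<close>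

abbreviation CC :: "complex ring" where
  "CC \<equiv> ring_of_type_algebra"

definition representation ::
  "('g, 'n) monoid_scheme \<Rightarrow> (complex, 'v) module \<Rightarrow> ('g \<Rightarrow> 'v \<Rightarrow> 'v) \<Rightarrow> bool" where
  "representation G V \<rho> \<longleftrightarrow> group G \<and> module CC V \<and> \<rho> \<in> hom G (module_Aut CC V)"

definition invariant_subspace ::
  "('g, 'n) monoid_scheme \<Rightarrow> (complex, 'v) module \<Rightarrow> ('g \<Rightarrow> 'v \<Rightarrow> 'v) \<Rightarrow> 'v set \<Rightarrow> bool" where
  "invariant_subspace G V \<rho> U \<longleftrightarrow>
     submodule U CC V \<and> (\<forall>g\<in>carrier G. \<forall>u\<in>U. \<rho> g u \<in> U)"

definition irreducible_rep ::
  "('g, 'n) monoid_scheme \<Rightarrow> (complex, 'v) module \<Rightarrow> ('g \<Rightarrow> 'v \<Rightarrow> 'v) \<Rightarrow> bool" where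
  "irreducible_rep G V \<rho> \<longleftrightarrow>
     representation G V \<rho> \<and> carrier V \<noteq> {\<zero>\<^bsub>V\<^esub>} \<and>
     (\<forall>U. invariant_subspace G V \<rho> U \<longrightarrow> U = {\<zero>\<^bsub>V\<^esub>} \<or> U = carrier V)"

definition isomorphic_reps ::
  "('g, 'n) monoid_scheme \<Rightarrow> (complex, 'v) module \<Rightarrow> ('g \<Rightarrow> 'v \<Rightarrow> 'v) \<Rightarrow>
     (complex, 'w) module \<Rightarrow> ('g \<Rightarrow> 'w \<Rightarrow> 'w) \<Rightarrow> bool" where
  "isomorphic_reps G V \<rho> W \<sigma> \<longleftrightarrow>
     (\<exists>T\<in>linear_maps CC V W. bij_betw T (carrier V) (carrier W) \<and>
        (\<forall>g\<in>carrier G. \<forall>v\<in>carrier V. T (\<rho> g v) = \<sigma> g (T v)))"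

abbreviation subspace_module :: "(complex, 'v) module \<Rightarrow> 'v set \<Rightarrow> (complex, 'v) module" where
  "subspace_module V U \<equiv> V\<lparr>carrier := U\<rparr>"

abbreviation subspace_action :: "('g \<Rightarrow> 'v \<Rightarrow> 'v) \<Rightarrow> 'v set \<Rightarrow> 'g \<Rightarrow> 'v \<Rightarrow> 'v" where
  "subspace_action \<rho> U \<equiv> \<lambda>g. restrict (\<rho> g) U"

text \<open>\<open>V\<close> is the internal direct sum of the finitely many irreducible subrepresentations in
  \<open>D\<close>. As the summands are nonzero they are pairwise distinct subspaces, so a set of subspaces
  suffices.\<close>

definition irreducible_decomposition ::
  "('g, 'n) monoid_scheme \<Rightarrow> (complex, 'v) module \<Rightarrow> ('g \<Rightarrow> 'v \<Rightarrow> 'v) \<Rightarrow> 'v set set \<Rightarrow> bool" where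
  "irreducible_decomposition G V \<rho> D \<longleftrightarrow>
     finite D \<and>
     (\<forall>U\<in>D. invariant_subspace G V \<rho> U \<and>
        irreducible_rep G (subspace_module V U) (subspace_action \<rho> U)) \<and>
     (\<forall>v\<in>carrier V. \<exists>!c. c \<in> (\<Pi>\<^sub>E U\<in>D. U) \<and> v = (\<Oplus>\<^bsub>V\<^esub>U\<in>D. c U))"

text \<open>The multiplicity of \<open>(W, \<sigma>)\<close> in \<open>(V, \<rho>)\<close>, read off from a decomposition \<open>D\<close> of \<open>V\<close>.\<close>

definition rep_multiplicity ::
  "('g, 'n) monoid_scheme \<Rightarrow> (complex, 'v) module \<Rightarrow> ('g \<Rightarrow> 'v \<Rightarrow> 'v) \<Rightarrow> 'v set set \<Rightarrow>
     (complex, 'w) module \<Rightarrow> ('g \<Rightarrow> 'w \<Rightarrow> 'w) \<Rightarrow> nat" where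
  "rep_multiplicity G V \<rho> D W \<sigma> =
     card {U\<in>D. isomorphic_reps G W \<sigma> (subspace_module V U) (subspace_action \<rho> U)}"

text \<open>The multiplicities do not depend on the decomposition, so the bound is required for all
  of them; the existence of a decomposition is required as well, so that the bound is not
  vacuous. A definition cannot quantify over types, hence the type \<open>'w\<close> underlying the
  irreducible representations under consideration is a parameter.\<close>

definition multiplicity_free ::
  "'w itself \<Rightarrow> ('g, 'n) monoid_scheme \<Rightarrow> (complex, 'v) module \<Rightarrow> ('g \<Rightarrow> 'v \<Rightarrow> 'v) \<Rightarrow> bool" where
  "multiplicity_free T G V \<rho> \<longleftrightarrow>
     representation G V \<rho> \<and>
     (\<exists>D. irreducible_decomposition G V \<rho> D) \<and>
     (\<forall>D (W :: (complex, 'w) module) \<sigma>.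
        irreducible_decomposition G V \<rho> D \<longrightarrow> irreducible_rep G W \<sigma> \<longrightarrow>
        rep_multiplicity G V \<rho> D W \<sigma> \<le> 1)"


section \<open>Permutation representations\<close>

text \<open>Formal linear combinations of elements of \<open>E\<close> are represented by their coefficient
  functions. A group element \<open>g\<close> sends the basis vector of \<open>x\<close> to that of \<open>\<phi> g x\<close>, so the
  coefficient of \<open>g f\<close> at \<open>x\<close> is the coefficient of \<open>f\<close> at \<open>\<phi> (inv g) x\<close>.\<close>

definition perm_module :: "'x set \<Rightarrow> (complex, 'x \<Rightarrow> complex) module" where
  "perm_module E =
     \<lparr>carrier = {f \<in> extensional E. finite {x\<in>E. f x \<noteq> 0}},
      monoid.mult = undefined, one = undefined,
      ring.zero = (\<lambda>x\<in>E. 0), add = (\<lambda>f g. \<lambda>x\<in>E. f x + g x), module.smult = (\<lambda>a f. \<lambda>x\<in>E. a * f x)\<rparr>"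

definition perm_action ::
  "('g, 'n) monoid_scheme \<Rightarrow> ('g \<Rightarrow> 'x \<Rightarrow> 'x) \<Rightarrow> 'x set \<Rightarrow> 'g \<Rightarrow> ('x \<Rightarrow> complex) \<Rightarrow> 'x \<Rightarrow> complex" where
  "perm_action G \<phi> E g = (\<lambda>f\<in>carrier (perm_module E). \<lambda>x\<in>E. f (\<phi> (inv\<^bsub>G\<^esub> g) x))"


section \<open>The definitions are well-formed\<close>

lemma quotient_module_is_module:
  assumes "cring R" "ideal I R" shows "module R (quotient_module R I)"
proof -
  interpret cring R by fact
  interpret I: ideal I R by fact
  interpret Q: cring "R Quot I" by (rule I.quotient_is_cring) (rule assms)
  interpret h: ring_hom_ring R "R Quot I" "(+>\<^bsub>R\<^esub>) I" by (rule I.rcos_ring_hom_ring)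
  show ?thesis
  proof (rule moduleI)
    show "abelian_group (quotient_module R I)"
      using Q.l_neg by (intro abelian_groupI) (auto simp: quotient_module_def Q.a_ac)
  qed (use assms in \<open>auto simp: quotient_module_def Q.l_distr Q.r_distr Q.m_assoc\<close>)
qed

lemma product_module_is_module:
  assumes R: "cring R" and M: "\<And>i. i \<in> I \<Longrightarrow> module R (M i)"
  shows "module R (product_module I M)"
proof -
  have ab: "abelian_group (M i)" if "i \<in> I" for i using M[OF that] by (simp add: module_def)
  have am: "abelian_monoid (M i)" if "i \<in> I" for i using ab[OF that] by (simp add: abelian_group_def)
  show ?thesis
  proof (rule moduleI[OF R])
    show "abelian_group (product_module I M)"
    proof (rule abelian_groupI)
      fix x assume x: "x \<in> carrier (product_module I M)"
      show "\<exists>y\<in>carrier (product_module I M). y \<oplus>\<^bsub>product_module I M\<^esub> x = \<zero>\<^bsub>product_module I M\<^esub>"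
      proof (rule bexI[where x = "\<lambda>i\<in>I. \<ominus>\<^bsub>M i\<^esub> x i"])
        have xi: "x i \<in> carrier (M i)" if "i \<in> I" for i using x that by (auto simp: product_module_def)
        show "(\<lambda>i\<in>I. \<ominus>\<^bsub>M i\<^esub> x i) \<in> carrier (product_module I M)"
          using abelian_group.a_inv_closed[OF ab xi] by (auto simp: product_module_def)
        show "(\<lambda>i\<in>I. \<ominus>\<^bsub>M i\<^esub> x i) \<oplus>\<^bsub>product_module I M\<^esub> x = \<zero>\<^bsub>product_module I M\<^esub>"
          using abelian_group.l_neg[OF ab xi] by (auto simp: product_module_def intro!: restrict_ext)
      qed
    next
      fix x assume "x \<in> carrier (product_module I M)"
      then show "\<zero>\<^bsub>product_module I M\<^esub> \<oplus>\<^bsub>product_module I M\<^esub> x = x"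
        using am by (auto simp: product_module_def abelian_monoid.l_zero fun_eq_iff PiE_iff extensional_def)
    next
      fix x y assume "x \<in> carrier (product_module I M)" "y \<in> carrier (product_module I M)"
      then show "x \<oplus>\<^bsub>product_module I M\<^esub> y = y \<oplus>\<^bsub>product_module I M\<^esub> x"
        using am by (auto simp: product_module_def PiE_iff intro!: restrict_ext
            intro: abelian_monoid.a_comm)
    qed (use am in \<open>auto simp: product_module_def abelian_monoid.a_closed abelian_monoid.zero_closed
           abelian_monoid.a_assoc PiE_iff intro!: restrict_ext\<close>)
  next
    fix x assume "x \<in> carrier (product_module I M)"
    then show "\<one>\<^bsub>R\<^esub> \<odot>\<^bsub>product_module I M\<^esub> x = x"
      using M by (auto simp: product_module_def module.smult_one fun_eq_iff PiE_iff extensional_def)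
  qed (auto simp: product_module_def PiE_iff module.smult_closed[OF M] module.smult_l_distr[OF M]
         module.smult_r_distr[OF M] module.smult_assoc1[OF M] intro!: restrict_ext)
qed

lemma group_module_Aut:
  assumes "module R M" shows "group (module_Aut R M)"
proof -
  interpret module R M by fact
  have "subgroup (linear_maps R M M \<inter> Bij (carrier M)) (BijGroup (carrier M))"
  proof (rule group.subgroupI[OF group_BijGroup])
    show "linear_maps R M M \<inter> Bij (carrier M) \<subseteq> carrier (BijGroup (carrier M))"
      by (simp add: BijGroup_def)
    have "(\<lambda>x\<in>carrier M. x) \<in> linear_maps R M M \<inter> Bij (carrier M)"
      by (auto simp: linear_maps_def id_Bij)
    then show "linear_maps R M M \<inter> Bij (carrier M) \<noteq> {}" by blast
  next
    fix a assume a: "a \<in> linear_maps R M M \<inter> Bij (carrier M)"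
    then have b: "bij_betw a (carrier M) (carrier M)" by (simp add: Bij_def)
    let ?h = "inv_into (carrier M) a"
    have h1: "?h x \<in> carrier M" "a (?h x) = x" if "x \<in> carrier M" for x
      using b that by (auto simp: bij_betw_def inv_into_into f_inv_into_f)
    have h2: "?h (a x) = x" if "x \<in> carrier M" for x
      using b that by (auto simp: bij_betw_def)
    have "?h (x \<oplus>\<^bsub>M\<^esub> y) = ?h x \<oplus>\<^bsub>M\<^esub> ?h y" if "x \<in> carrier M" "y \<in> carrier M" for x y
    proof -
      have "a (?h x \<oplus>\<^bsub>M\<^esub> ?h y) = x \<oplus>\<^bsub>M\<^esub> y" using a h1 that by (auto simp: linear_maps_def)
      then show ?thesis using h2[of "?h x \<oplus>\<^bsub>M\<^esub> ?h y"] h1 that by auto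
    qed
    moreover have "?h (r \<odot>\<^bsub>M\<^esub> x) = r \<odot>\<^bsub>M\<^esub> ?h x" if "x \<in> carrier M" "r \<in> carrier R" for x r
    proof -
      have "a (r \<odot>\<^bsub>M\<^esub> ?h x) = r \<odot>\<^bsub>M\<^esub> x" using a h1 that by (auto simp: linear_maps_def)
      then show ?thesis using h2[of "r \<odot>\<^bsub>M\<^esub> ?h x"] h1 that by auto
    qed
    ultimately show "inv\<^bsub>BijGroup (carrier M)\<^esub> a \<in> linear_maps R M M \<inter> Bij (carrier M)"
      using a h1 by (auto simp: inv_BijGroup restrict_inv_into_Bij linear_maps_def)
  next
    fix a b assume "a \<in> linear_maps R M M \<inter> Bij (carrier M)" "b \<in> linear_maps R M M \<inter> Bij (carrier M)"
    then show "a \<otimes>\<^bsub>BijGroup (carrier M)\<^esub> b \<in> linear_maps R M M \<inter> Bij (carrier M)"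
      by (auto simp: BijGroup_def compose_Bij) (auto simp: linear_maps_def compose_def Pi_iff)
  qed
  then show ?thesis
    unfolding module_Aut_def by (rule subgroup.subgroup_is_group) (rule group_BijGroup)
qed

lemma module_perm_module: "module CC (perm_module E)"
proof (rule moduleI)
  show "cring CC" by (rule cring_from_type_algebra)
  have sub: "finite {x\<in>E. f x + g x \<noteq> 0}" if "finite {x\<in>E. f x \<noteq> (0::complex)}" "finite {x\<in>E. g x \<noteq> 0}" for f g
    by (rule finite_subset[of _ "{x\<in>E. f x \<noteq> 0} \<union> {x\<in>E. g x \<noteq> 0}"]) (use that in auto)
  have cl: "f \<in> carrier (perm_module E) \<Longrightarrow> g \<in> carrier (perm_module E) \<Longrightarrow> f \<oplus>\<^bsub>perm_module E\<^esub> g \<in> carrier (perm_module E)" for f g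
    using sub[of f g] by (auto simp: perm_module_def cong: conj_cong)
  show "abelian_group (perm_module E)"
  proof (rule abelian_groupI)
    fix x assume "x \<in> carrier (perm_module E)"
    then show "\<exists>y\<in>carrier (perm_module E). y \<oplus>\<^bsub>perm_module E\<^esub> x = \<zero>\<^bsub>perm_module E\<^esub>"
      by (intro bexI[where x = "\<lambda>i\<in>E. - x i"])
        (auto simp: perm_module_def cong: conj_cong intro!: restrict_ext)
  qed (use cl in \<open>auto simp: perm_module_def fun_eq_iff extensional_def cong: conj_cong\<close>)
qed (auto simp: perm_module_def ring_of_type_algebra_def fun_eq_iff extensional_def algebra_simps cong: conj_cong elim!: rev_finite_subset)

lemma representation_perm_action:
  assumes "group_action G S \<phi>" and "E \<subseteq> S"
    and gE: "\<And>g x. g \<in> carrier G \<Longrightarrow> x \<in> E \<Longrightarrow> \<phi> g x \<in> E"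
  shows "representation G (perm_module E) (perm_action G \<phi> E)"
proof -
  interpret group_action G S \<phi> by fact
  interpret h: group_hom G "BijGroup S" \<phi> by (rule group_hom)
  let ?P = "perm_module E" and ?a = "perm_action G \<phi> E"
  have gE': "\<phi> (inv\<^bsub>G\<^esub> g) x \<in> E" if "g \<in> carrier G" "x \<in> E" for g x
    using gE that h.G.inv_closed by blast
  have cl: "?a g f \<in> carrier ?P" if g: "g \<in> carrier G" and f: "f \<in> carrier ?P" for g f
  proof -
    have "finite {x\<in>E. f (\<phi> (inv\<^bsub>G\<^esub> g) x) \<noteq> 0}"
    proof (rule finite_imageD)
      show "finite (\<phi> (inv\<^bsub>G\<^esub> g) ` {x\<in>E. f (\<phi> (inv\<^bsub>G\<^esub> g) x) \<noteq> 0})"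
        by (rule finite_subset[of _ "{x\<in>E. f x \<noteq> 0}"])
          (use f gE'[OF g] in \<open>auto simp: perm_module_def simp del: h.hom_inv\<close>)
      show "inj_on (\<phi> (inv\<^bsub>G\<^esub> g)) {x\<in>E. f (\<phi> (inv\<^bsub>G\<^esub> g) x) \<noteq> 0}"
        by (rule inj_on_subset[OF inj_prop[OF h.G.inv_closed[OF g]]]) (use assms(2) in auto)
    qed
    then show ?thesis
      using f by (auto simp: perm_action_def perm_module_def simp del: h.hom_inv cong: conj_cong)
  qed
  have comp: "?a (g \<otimes>\<^bsub>G\<^esub> h) f = ?a g (?a h f)"
    if g: "g \<in> carrier G" and h: "h \<in> carrier G" and f: "f \<in> carrier ?P" for g h f
  proof -
    have "\<phi> (inv\<^bsub>G\<^esub> (g \<otimes>\<^bsub>G\<^esub> h)) x = \<phi> (inv\<^bsub>G\<^esub> h) (\<phi> (inv\<^bsub>G\<^esub> g) x)" if "x \<in> E" for x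
      using that assms(2) g h composition_rule[of x "inv\<^bsub>G\<^esub> h" "inv\<^bsub>G\<^esub> g"] h.G.inv_mult_group
      by (auto simp del: h.hom_inv)
    then show ?thesis
      using cl[OF h f] f gE'[OF g] by (auto simp: perm_action_def simp del: h.hom_inv intro!: restrict_ext)
  qed
  have one: "?a \<one>\<^bsub>G\<^esub> f = f" if "f \<in> carrier ?P" for f
  proof -
    have "\<phi> \<one>\<^bsub>G\<^esub> x = x" if "x \<in> E" for x
      using that assms(2) by (auto simp: BijGroup_def)
    then show ?thesis
      using that by (auto simp: perm_action_def perm_module_def fun_eq_iff extensional_def simp del: h.hom_one)
  qed
  have lin: "?a g \<in> linear_maps CC ?P ?P" if g: "g \<in> carrier G" for g
  proof -
    interpret P: Module.module CC ?P by (rule module_perm_module)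
    have "?a g (x \<oplus>\<^bsub>?P\<^esub> y) = ?a g x \<oplus>\<^bsub>?P\<^esub> ?a g y" if "x \<in> carrier ?P" "y \<in> carrier ?P" for x y
      using P.a_closed[OF that] that gE'[OF g]
      by (auto simp: perm_action_def simp del: h.hom_inv)
        (auto simp: perm_module_def simp del: h.hom_inv intro!: restrict_ext)
    moreover have "?a g (r \<odot>\<^bsub>?P\<^esub> x) = r \<odot>\<^bsub>?P\<^esub> ?a g x" if "x \<in> carrier ?P" "r \<in> carrier CC" for x r
      using P.smult_closed[OF that(2,1)] that gE'[OF g]
      by (auto simp: perm_action_def simp del: h.hom_inv)
        (auto simp: perm_module_def simp del: h.hom_inv intro!: restrict_ext)
    ultimately show ?thesis using cl g by (auto simp: linear_maps_def)
  qed
  have bij: "?a g \<in> Bij (carrier ?P)" if g: "g \<in> carrier G" for g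
  proof -
    have "bij_betw (?a g) (carrier ?P) (carrier ?P)"
    proof (rule bij_betwI[where g = "?a (inv\<^bsub>G\<^esub> g)"])
      fix f assume f: "f \<in> carrier ?P"
      show "?a (inv\<^bsub>G\<^esub> g) (?a g f) = f" "?a g (?a (inv\<^bsub>G\<^esub> g) f) = f"
        using g f by (simp_all flip: comp add: one)
    qed (use g cl in auto)
    then show ?thesis by (simp add: Bij_def perm_action_def)
  qed
  have "?a \<in> hom G (module_Aut CC ?P)"
  proof (rule homI)
    fix g h assume gh: "g \<in> carrier G" "h \<in> carrier G"
    have "?a (g \<otimes>\<^bsub>G\<^esub> h) = compose (carrier ?P) (?a g) (?a h)"
    proof
      show "?a (g \<otimes>\<^bsub>G\<^esub> h) f = compose (carrier ?P) (?a g) (?a h) f" for f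
        using comp[OF gh, of f]
        by (cases "f \<in> carrier ?P") (simp_all add: compose_def, simp add: perm_action_def)
    qed
    then show "?a (g \<otimes>\<^bsub>G\<^esub> h) = ?a g \<otimes>\<^bsub>module_Aut CC ?P\<^esub> ?a h"
      using bij gh by (simp add: module_Aut_def BijGroup_def)
  qed (use lin bij in \<open>auto simp: module_Aut_def\<close>)
  then show ?thesis
    by (simp add: representation_def module_perm_module h.G.is_group)
qed

lemma partition_module_is_module:
  assumes "cring R" "p \<in> carrier R" shows "module R (partition_module R p k lam rho)"
proof -
  interpret cring R by fact
  show ?thesis unfolding partition_module_def
    by (rule product_module_is_module)
      (auto simp: assms intro!: quotient_module_is_module cgenideal_ideal cring_axioms)
qed

lemma group_action_module_Aut:
  assumes "module R M"
  shows "group_action (module_Aut R M) (carrier M) (\<lambda>g. g)"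
proof -
  have "(\<lambda>g. g) \<in> hom (module_Aut R M) (BijGroup (carrier M))"
    by (rule homI) (auto simp: module_Aut_def BijGroup_def)
  then show ?thesis
    using group_module_Aut[OF assms] group_BijGroup
    by (intro group_action.intro) (simp add: group_hom_def group_hom_axioms_def)
qed

lemma representation_orbit:
  fixes R :: "('a, 'm) ring_scheme" and k :: nat and lam rho :: "nat \<Rightarrow> nat"
  assumes "cring R" "p \<in> carrier R"
  defines "M \<equiv> partition_module R p k lam rho"
  assumes E: "E \<in> orbits (module_Aut R M) (carrier M) (\<lambda>g. g)"
  shows "representation (module_Aut R M) (perm_module E) (perm_action (module_Aut R M) (\<lambda>g. g) E)"
proof -
  have M: "module R M" unfolding M_def by (rule partition_module_is_module) fact+
  interpret group_action "module_Aut R M" "carrier M" "\<lambda>g. g" by (rule group_action_module_Aut[OF M])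
  interpret h: group_hom "module_Aut R M" "BijGroup (carrier M)" "\<lambda>g. g" by (rule group_hom)
  obtain x where x: "x \<in> carrier M" "E = orbit (module_Aut R M) (\<lambda>g. g) x"
    using E by (auto simp: orbits_def)
  show ?thesis
  proof (rule representation_perm_action[OF group_action_axioms])
    show "E \<subseteq> carrier M" using x element_image[OF _ x(1) refl] by (auto simp: orbit_def)
    fix g y assume g: "g \<in> carrier (module_Aut R M)" "y \<in> E"
    then obtain h where h: "h \<in> carrier (module_Aut R M)" "y = h x" using x by (auto simp: orbit_def)
    have "g y = (g \<otimes>\<^bsub>module_Aut R M\<^esub> h) x"
      using composition_rule[OF x(1) g(1) h(1)] h(2) by simp
    then show "g y \<in> E" using h.G.m_closed[OF g(1) h(1)] x(2) by (auto simp: orbit_def)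
  qed
qed

end

theory Submission
  imports Defs
begin

text \<open>A permutation representation is multiplicity free if the convolution algebra of its invariant
  kernels is commutative. Let \<open>M\<close> be the module and \<open>E\<close> the orbit. As the endomorphism ring of \<open>M\<close> is
  finite, two pairs in \<open>E \<times> E\<close> that generate the same \<open>End M\<close>-submodule of \<open>M \<times> M\<close> are conjugate
  (finite rings have stable range one). So invariant kernels are linear combinations of the
  indicators of submodules \<open>W\<close> generated by pairs in \<open>E \<times> E\<close>. The factors \<open>R/p\<^sup>l\<close> being uniserial,
  such a \<open>W\<close> consists of the \<open>(x, y)\<close> with \<open>y \<equiv> u\<^sub>l x\<close> modulo \<open>S\<^sub>l\<close> in the block of the factors \<open>R/p\<^sup>l\<close>,
  for units \<open>u\<^sub>l\<close> and submodules \<open>S\<^sub>l\<close>. Kernels of this form commute block by block: for given \<open>x\<close> and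
  \<open>z\<close> the numbers of middle points \<open>y\<close> agree for the two orders of convolution.\<close>

section \<open>Linear maps\<close>

text \<open>Orbits of pairs are awkward to describe, but the pairs lying below a given pair, in the
  order by generated submodule, are cut out by one congruence per component. The change between the
  two bases of invariant kernels is triangular, so counting in orbits becomes counting solutions of
  congruences. The obstacle is that \<open>E\<close> is not closed under addition: the affine
  substitution that exchanges two congruences may leave \<open>E\<close>. The way out is a
  criterion: a vector lies in \<open>E\<close> as soon as each homogeneous block of it is, modulo
  \<open>p\<close> times the values occurring there, a unit multiple of the block of some point of
  \<open>E\<close>, which may vary with the block. If \<open>S\<close> and \<open>S'\<close> differ
  in a block, the smaller lies in \<open>p\<close> times the larger, so the new block can be
  compared with that of \<open>x\<close> or of \<open>z\<close>. If they agree, scaling by a unit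
  performs the exchange. On the representation side, commutativity is applied to maps between
  isomorphic summands directly, and complete reducibility comes from the Hermitian form on C[E],
  which is invariant without averaging because the group permutes the basis.\<close>

lemma linear_maps_closed: "f \<in> linear_maps R M N \<Longrightarrow> x \<in> carrier M \<Longrightarrow> f x \<in> carrier N"
  and linear_maps_add: "f \<in> linear_maps R M N \<Longrightarrow> x \<in> carrier M \<Longrightarrow> y \<in> carrier M \<Longrightarrow>
    f (x \<oplus>\<^bsub>M\<^esub> y) = f x \<oplus>\<^bsub>N\<^esub> f y"
  and linear_maps_smult: "f \<in> linear_maps R M N \<Longrightarrow> r \<in> carrier R \<Longrightarrow> x \<in> carrier M \<Longrightarrow>
    f (r \<odot>\<^bsub>M\<^esub> x) = r \<odot>\<^bsub>N\<^esub> f x"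
  by (auto simp: linear_maps_def)

lemmas linear_mapsD = linear_maps_closed linear_maps_add linear_maps_smult

lemma linear_mapsI:
  assumes "\<And>x. x \<in> carrier M \<Longrightarrow> f x \<in> carrier N"
    and "\<And>x y. x \<in> carrier M \<Longrightarrow> y \<in> carrier M \<Longrightarrow> f (x \<oplus>\<^bsub>M\<^esub> y) = f x \<oplus>\<^bsub>N\<^esub> f y"
    and "\<And>r x. r \<in> carrier R \<Longrightarrow> x \<in> carrier M \<Longrightarrow> f (r \<odot>\<^bsub>M\<^esub> x) = r \<odot>\<^bsub>N\<^esub> f x"
  shows "f \<in> linear_maps R M N"
  using assms by (auto simp: linear_maps_def)

lemma linear_maps_zero:
  assumes "module R M" "module R N" "f \<in> linear_maps R M N"
  shows "f \<zero>\<^bsub>M\<^esub> = \<zero>\<^bsub>N\<^esub>"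
proof -
  interpret M: Module.module R M by fact
  interpret N: Module.module R N by fact
  have "f (\<zero>\<^bsub>R\<^esub> \<odot>\<^bsub>M\<^esub> \<zero>\<^bsub>M\<^esub>) = \<zero>\<^bsub>R\<^esub> \<odot>\<^bsub>N\<^esub> f \<zero>\<^bsub>M\<^esub>"
    using assms(3) by (intro linear_maps_smult) auto
  then show ?thesis using linear_maps_closed[OF assms(3) M.M.zero_closed] by simp
qed

lemma linear_maps_minus:
  assumes "module R M" "module R N" "f \<in> linear_maps R M N" "x \<in> carrier M"
  shows "f (\<ominus>\<^bsub>M\<^esub> x) = \<ominus>\<^bsub>N\<^esub> f x"
proof -
  interpret M: Module.module R M by fact
  interpret N: Module.module R N by fact
  have "f ((\<ominus>\<^bsub>R\<^esub> \<one>\<^bsub>R\<^esub>) \<odot>\<^bsub>M\<^esub> x) = (\<ominus>\<^bsub>R\<^esub> \<one>\<^bsub>R\<^esub>) \<odot>\<^bsub>N\<^esub> f x"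
    using assms(3,4) by (intro linear_maps_smult) auto
  then show ?thesis using linear_maps_closed[OF assms(3,4)] assms(4)
    by (simp add: M.smult_l_minus N.smult_l_minus)
qed

lemma linear_maps_finsum:
  assumes "module R M" "module R N" "f \<in> linear_maps R M N" "finite A" "g \<in> A \<rightarrow> carrier M"
  shows "f (\<Oplus>\<^bsub>M\<^esub>i\<in>A. g i) = (\<Oplus>\<^bsub>N\<^esub>i\<in>A. f (g i))"
proof -
  interpret M: Module.module R M by fact
  interpret N: Module.module R N by fact
  show ?thesis using assms(4,5)
  proof (induction A rule: finite_induct)
    case empty
    then show ?case using linear_maps_zero[OF assms(1-3)] by simp
  next
    case (insert a A)
    have "(\<lambda>i. f (g i)) \<in> A \<rightarrow> carrier N" "f (g a) \<in> carrier N"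
      using insert.prems linear_maps_closed[OF assms(3)] by auto
    then show ?case using insert linear_maps_add[OF assms(3)] by simp
  qed
qed

lemma linear_maps_compose:
  assumes "f \<in> linear_maps R M N" "g \<in> linear_maps R N L"
  shows "(\<lambda>x. g (f x)) \<in> linear_maps R M L"
  using assms by (auto simp: linear_maps_def Pi_iff)

lemma linear_maps_plus:
  assumes "module R M" "module R N" "f \<in> linear_maps R M N" "g \<in> linear_maps R M N"
  shows "(\<lambda>x. f x \<oplus>\<^bsub>N\<^esub> g x) \<in> linear_maps R M N"
proof -
  interpret M: Module.module R M by fact
  interpret N: Module.module R N by fact
  show ?thesis
    by (rule linear_mapsI)
      (simp_all add: linear_mapsD[OF assms(3)] linear_mapsD[OF assms(4)] N.M.a_ac N.smult_r_distr)
qed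

lemma linear_maps_minus_fun:
  assumes "module R M" "module R N" "f \<in> linear_maps R M N"
  shows "(\<lambda>x. \<ominus>\<^bsub>N\<^esub> f x) \<in> linear_maps R M N"
proof -
  interpret M: Module.module R M by fact
  interpret N: Module.module R N by fact
  show ?thesis
    by (rule linear_mapsI)
      (simp_all add: linear_mapsD[OF assms(3)] N.M.minus_add N.smult_r_minus N.M.a_comm)
qed

lemma linear_maps_smult_fun:
  assumes "module R M" "module R N" "f \<in> linear_maps R M N" "r \<in> carrier R"
  shows "(\<lambda>x. r \<odot>\<^bsub>N\<^esub> f x) \<in> linear_maps R M N"
proof -
  interpret M: Module.module R M by fact
  interpret N: Module.module R N by fact
  show ?thesis
    by (rule linear_mapsI)
      (simp_all add: assms(4) linear_mapsD[OF assms(3)] N.smult_r_distr M.R.m_comm flip: N.smult_assoc1)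
qed

lemma linear_maps_zero_fun:
  assumes "module R M" "module R N"
  shows "(\<lambda>x. \<zero>\<^bsub>N\<^esub>) \<in> linear_maps R M N"
proof -
  interpret N: Module.module R N by fact
  show ?thesis by (rule linear_mapsI) simp_all
qed

lemma linear_maps_id: "(\<lambda>x. x) \<in> linear_maps R M M"
  by (simp add: linear_maps_def)

section \<open>Identities and submodules in modules\<close>

lemma (in abelian_group) minus_eq_zeroD:
  assumes "x \<in> carrier G" "y \<in> carrier G" "x \<ominus> y = \<zero>"
  shows "x = y"
proof -
  have "x = (x \<ominus> y) \<oplus> y" using assms(1,2) by (simp add: a_minus_def a_assoc l_neg)
  then show ?thesis using assms by simp
qed

context module
begin

lemma add_diff_cancel:
  assumes "x \<in> carrier M" "y \<in> carrier M"
  shows "(x \<oplus>\<^bsub>M\<^esub> y) \<ominus>\<^bsub>M\<^esub> x = y"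
  using assms by (simp add: a_minus_def M.a_comm[of x y] M.a_assoc M.r_neg)

lemma smult_diff:
  assumes "r \<in> carrier R" "x \<in> carrier M" "y \<in> carrier M"
  shows "r \<odot>\<^bsub>M\<^esub> (x \<ominus>\<^bsub>M\<^esub> y) = r \<odot>\<^bsub>M\<^esub> x \<ominus>\<^bsub>M\<^esub> r \<odot>\<^bsub>M\<^esub> y"
  using assms by (simp add: a_minus_def smult_r_distr smult_r_minus)

lemma diff_swap:
  assumes "a \<in> carrier M" "b \<in> carrier M" "c \<in> carrier M"
  shows "a \<ominus>\<^bsub>M\<^esub> (b \<oplus>\<^bsub>M\<^esub> (a \<ominus>\<^bsub>M\<^esub> c)) = c \<ominus>\<^bsub>M\<^esub> b"
proof -
  have "a \<ominus>\<^bsub>M\<^esub> (b \<oplus>\<^bsub>M\<^esub> (a \<ominus>\<^bsub>M\<^esub> c)) = a \<oplus>\<^bsub>M\<^esub> (\<ominus>\<^bsub>M\<^esub> a \<oplus>\<^bsub>M\<^esub> (c \<oplus>\<^bsub>M\<^esub> \<ominus>\<^bsub>M\<^esub> b))"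
    using assms by (simp add: a_minus_def M.minus_add M.a_ac)
  also have "\<dots> = c \<ominus>\<^bsub>M\<^esub> b"
    using assms by (simp add: M.r_neg1 M.r_neg2 a_minus_def)
  finally show ?thesis .
qed

lemma diff_diff:
  assumes "a \<in> carrier M" "b \<in> carrier M" "c \<in> carrier M"
  shows "(a \<ominus>\<^bsub>M\<^esub> c) \<ominus>\<^bsub>M\<^esub> (b \<ominus>\<^bsub>M\<^esub> c) = a \<ominus>\<^bsub>M\<^esub> b"
proof -
  have "\<ominus>\<^bsub>M\<^esub> (b \<ominus>\<^bsub>M\<^esub> c) = c \<oplus>\<^bsub>M\<^esub> \<ominus>\<^bsub>M\<^esub> b"
    using assms by (simp add: a_minus_def M.minus_add M.a_comm)
  then have "(a \<ominus>\<^bsub>M\<^esub> c) \<ominus>\<^bsub>M\<^esub> (b \<ominus>\<^bsub>M\<^esub> c) = a \<oplus>\<^bsub>M\<^esub> (\<ominus>\<^bsub>M\<^esub> c \<oplus>\<^bsub>M\<^esub> (c \<oplus>\<^bsub>M\<^esub> \<ominus>\<^bsub>M\<^esub> b))"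
    unfolding a_minus_def using assms by (simp add: M.a_assoc)
  then show ?thesis using assms by (simp add: a_minus_def M.r_neg1)
qed

lemma unit_smult_cancel:
  assumes "u \<in> Units R" "x \<in> carrier M"
  shows "inv u \<odot>\<^bsub>M\<^esub> (u \<odot>\<^bsub>M\<^esub> x) = x" "u \<odot>\<^bsub>M\<^esub> (inv u \<odot>\<^bsub>M\<^esub> x) = x"
  using assms by (simp_all add: R.Units_closed flip: smult_assoc1)

lemma smult_commute:
  assumes "r \<in> carrier R" "s \<in> carrier R" "x \<in> carrier M"
  shows "r \<odot>\<^bsub>M\<^esub> (s \<odot>\<^bsub>M\<^esub> x) = s \<odot>\<^bsub>M\<^esub> (r \<odot>\<^bsub>M\<^esub> x)"
  using assms by (simp add: R.m_comm flip: smult_assoc1)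

lemma submodule_zero: "submodule H R M \<Longrightarrow> \<zero>\<^bsub>M\<^esub> \<in> H"
  using subgroup.one_closed[OF submodule.axioms(1)] by fastforce

lemma submodule_diff: "submodule H R M \<Longrightarrow> x \<in> H \<Longrightarrow> y \<in> H \<Longrightarrow> x \<ominus>\<^bsub>M\<^esub> y \<in> H"
  by (simp add: a_minus_def submoduleE)

lemma submodule_finsum:
  assumes H: "submodule H R M" and "finite A" "\<And>i. i \<in> A \<Longrightarrow> g i \<in> H"
  shows "(\<Oplus>\<^bsub>M\<^esub>i\<in>A. g i) \<in> H"
  using assms(2,3)
proof (induction A rule: finite_induct)
  case empty
  then show ?case using submodule_zero[OF H] by simp
next
  case (insert a A)
  then have "g \<in> A \<rightarrow> carrier M" "g a \<in> carrier M" using submoduleE(1)[OF H] by auto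
  then show ?case using insert submoduleE(5)[OF H] by simp
qed

lemma submodule_of_subspace:
  assumes U: "submodule U R M" and W: "submodule W R (M\<lparr>carrier := U\<rparr>)"
  shows "submodule W R M" "W \<subseteq> U"
proof -
  have m: "module R (M\<lparr>carrier := U\<rparr>)" by (rule submodule.submodule_is_module[OF U module_axioms])
  show WU: "W \<subseteq> U" using module.submoduleE(1)[OF m W] by simp
  have "module R (M\<lparr>carrier := U\<rparr>\<lparr>carrier := W\<rparr>)" by (rule submodule.submodule_is_module[OF W m])
  then show "submodule W R M"
    using WU submoduleE(1)[OF U] by (intro module_incl_imp_submodule) auto
qed

end

section \<open>Multiplicities and commuting intertwiners\<close>

lemma invariant_subspace_representation:
  assumes "representation G V \<rho>" "invariant_subspace G V \<rho> U"
  shows "representation G (subspace_module V U) (subspace_action \<rho> U)"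
proof -
  have G: "group G" and V: "module CC V" and hom: "\<rho> \<in> hom G (module_Aut CC V)"
    using assms by (auto simp: representation_def)
  have U: "submodule U CC V" and inv: "\<And>g u. g \<in> carrier G \<Longrightarrow> u \<in> U \<Longrightarrow> \<rho> g u \<in> U"
    using assms by (auto simp: invariant_subspace_def)
  interpret G: group G by fact
  interpret V: Module.module CC V by fact
  have UV: "U \<subseteq> carrier V" using V.submoduleE(1)[OF U] .
  interpret U: Module.module CC "subspace_module V U" by (rule submodule.submodule_is_module[OF U V])
  have lin: "\<rho> g \<in> linear_maps CC V V" and bij: "\<rho> g \<in> Bij (carrier V)" if "g \<in> carrier G" for g
    using hom that by (auto simp: hom_def module_Aut_def)
  have mult: "\<rho> (g \<otimes>\<^bsub>G\<^esub> h) = compose (carrier V) (\<rho> g) (\<rho> h)"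
    if "g \<in> carrier G" "h \<in> carrier G" for g h
    using hom bij that by (auto simp: hom_def module_Aut_def BijGroup_def)
  have multx: "\<rho> (g \<otimes>\<^bsub>G\<^esub> h) x = \<rho> g (\<rho> h x)"
    if "g \<in> carrier G" "h \<in> carrier G" "x \<in> carrier V" for g h x
    using mult that by (auto simp: compose_def)
  \<comment> \<open>Multiplicativity makes the operator of the group unit idempotent; being
    injective, it is the identity.\<close>
  have one: "\<rho> \<one>\<^bsub>G\<^esub> x = x" if x: "x \<in> carrier V" for x
  proof -
    have "\<rho> \<one>\<^bsub>G\<^esub> (\<rho> \<one>\<^bsub>G\<^esub> x) = \<rho> \<one>\<^bsub>G\<^esub> x" using multx[of "\<one>\<^bsub>G\<^esub>" "\<one>\<^bsub>G\<^esub>" x] x by simp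
    moreover have "inj_on (\<rho> \<one>\<^bsub>G\<^esub>) (carrier V)" "\<rho> \<one>\<^bsub>G\<^esub> x \<in> carrier V"
      using bij[of "\<one>\<^bsub>G\<^esub>"] x by (auto simp: Bij_def bij_betw_def)
    ultimately show ?thesis using x by (auto dest: inj_onD)
  qed
  have B: "subspace_action \<rho> U g \<in> Bij U" if g: "g \<in> carrier G" for g
  proof -
    have "bij_betw (subspace_action \<rho> U g) U U"
    proof (rule bij_betwI[where g = "\<rho> (inv\<^bsub>G\<^esub> g)"])
      fix x assume x: "x \<in> U"
      show "\<rho> (inv\<^bsub>G\<^esub> g) (subspace_action \<rho> U g x) = x"
        using x UV g multx[of "inv\<^bsub>G\<^esub> g" g x] one[of x] by auto
      show "subspace_action \<rho> U g (\<rho> (inv\<^bsub>G\<^esub> g) x) = x"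
        using x UV g multx[of g "inv\<^bsub>G\<^esub> g" x] one[of x] inv by auto
    qed (use inv g in auto)
    then show ?thesis by (simp add: Bij_def)
  qed
  have L: "subspace_action \<rho> U g \<in> linear_maps CC (subspace_module V U) (subspace_module V U)"
    if g: "g \<in> carrier G" for g
  proof (rule linear_mapsI)
    fix x y assume "x \<in> carrier (subspace_module V U)" "y \<in> carrier (subspace_module V U)"
    then show "subspace_action \<rho> U g (x \<oplus>\<^bsub>subspace_module V U\<^esub> y) =
      subspace_action \<rho> U g x \<oplus>\<^bsub>subspace_module V U\<^esub> subspace_action \<rho> U g y"
      using linear_maps_add[OF lin[OF g], of x y] UV U.M.a_closed[of x y] by auto
  next
    fix r x assume "r \<in> carrier CC" "x \<in> carrier (subspace_module V U)"
    then show "subspace_action \<rho> U g (r \<odot>\<^bsub>subspace_module V U\<^esub> x) =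
      r \<odot>\<^bsub>subspace_module V U\<^esub> subspace_action \<rho> U g x"
      using linear_maps_smult[OF lin[OF g], of r x] UV U.smult_closed[of r x] by auto
  qed (use inv g in auto)
  have "subspace_action \<rho> U \<in> hom G (module_Aut CC (subspace_module V U))"
  proof (rule homI)
    fix g h assume g: "g \<in> carrier G" "h \<in> carrier G"
    have "restrict (\<rho> (g \<otimes>\<^bsub>G\<^esub> h)) U = compose U (restrict (\<rho> g) U) (restrict (\<rho> h) U)"
      using UV g inv by (auto simp: fun_eq_iff compose_def multx subset_iff)
    then show "subspace_action \<rho> U (g \<otimes>\<^bsub>G\<^esub> h) =
      subspace_action \<rho> U g \<otimes>\<^bsub>module_Aut CC (subspace_module V U)\<^esub> subspace_action \<rho> U h"
      using B g by (simp add: module_Aut_def BijGroup_def)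
  qed (use B L in \<open>auto simp: module_Aut_def\<close>)
  then show ?thesis
    by (simp add: representation_def G U.module_axioms)
qed

definition intertwiners ::
  "('g, 'n) monoid_scheme \<Rightarrow> (complex, 'v) module \<Rightarrow> ('g \<Rightarrow> 'v \<Rightarrow> 'v) \<Rightarrow> ('v \<Rightarrow> 'v) set" where
  "intertwiners G V \<rho> =
     {A \<in> linear_maps CC V V. \<forall>g\<in>carrier G. \<forall>v\<in>carrier V. A (\<rho> g v) = \<rho> g (A v)}"

text \<open>If two summands \<open>U\<^sub>1 \<noteq> U\<^sub>2\<close> were isomorphic, the isomorphisms \<open>U\<^sub>1 \<rightarrow> U\<^sub>2\<close> and \<open>U\<^sub>2 \<rightarrow> U\<^sub>1\<close>,
  extended by zero to the other summands, would not commute.\<close>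

lemma multiplicity_le_one_if_intertwiners_commute:
  assumes rep: "representation G V \<rho>"
    and comm: "\<And>A B v. A \<in> intertwiners G V \<rho> \<Longrightarrow> B \<in> intertwiners G V \<rho> \<Longrightarrow>
      v \<in> carrier V \<Longrightarrow> A (B v) = B (A v)"
    and dec: "irreducible_decomposition G V \<rho> D"
    and irr: "irreducible_rep G W \<sigma>"
  shows "rep_multiplicity G V \<rho> D W \<sigma> \<le> 1"
proof (rule ccontr)
  have V: "module CC V" and hom: "\<rho> \<in> hom G (module_Aut CC V)" and G: "group G"
    using rep by (auto simp: representation_def)
  interpret V: Module.module CC V by fact
  interpret G: group G by fact
  have W: "module CC W" and homW: "\<sigma> \<in> hom G (module_Aut CC W)"
    using irr by (auto simp: irreducible_rep_def representation_def)
  interpret W: Module.module CC W by fact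
  have lin: "\<rho> g \<in> linear_maps CC V V" if "g \<in> carrier G" for g
    using hom that by (auto simp: hom_def module_Aut_def)
  have linW: "\<sigma> g \<in> linear_maps CC W W" if "g \<in> carrier G" for g
    using homW that by (auto simp: hom_def module_Aut_def)
  have finD: "finite D" using dec by (auto simp: irreducible_decomposition_def)
  have invD: "invariant_subspace G V \<rho> U" and irrD: "irreducible_rep G (subspace_module V U) (subspace_action \<rho> U)"
    if "U \<in> D" for U using that dec by (auto simp: irreducible_decomposition_def)
  have subD: "submodule U CC V" and \<rho>U: "\<And>g u. g \<in> carrier G \<Longrightarrow> u \<in> U \<Longrightarrow> \<rho> g u \<in> U" if "U \<in> D" for U
    using invD[OF that] by (auto simp: invariant_subspace_def)
  have UV: "U \<subseteq> carrier V" if "U \<in> D" for U using V.submoduleE(1)[OF subD[OF that]] .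
  have z: "\<zero>\<^bsub>V\<^esub> \<in> U" if "U \<in> D" for U
    using subgroup.one_closed[OF submodule.axioms(1)[OF subD[OF that]]] by simp
  define comp where "comp v = (THE c. c \<in> (\<Pi>\<^sub>E U\<in>D. U) \<and> v = (\<Oplus>\<^bsub>V\<^esub>U\<in>D. c U))" for v
  have ex1: "\<exists>!c. c \<in> (\<Pi>\<^sub>E U\<in>D. U) \<and> v = (\<Oplus>\<^bsub>V\<^esub>U\<in>D. c U)" if "v \<in> carrier V" for v
    using that dec by (auto simp: irreducible_decomposition_def)
  have comp: "comp v \<in> (\<Pi>\<^sub>E U\<in>D. U)" "v = (\<Oplus>\<^bsub>V\<^esub>U\<in>D. comp v U)" if "v \<in> carrier V" for v
    using theI'[OF ex1[OF that]] by (auto simp: comp_def)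
  \<comment> \<open>Uniqueness of the decomposition in usable form: any choice of components with
    sum \<open>v\<close> gives \<open>comp v\<close> on \<open>D\<close>, without a condition on its
    values outside \<open>D\<close>.\<close>
  have compI: "comp v U = c U"
    if "\<And>U. U \<in> D \<Longrightarrow> c U \<in> U" "v = (\<Oplus>\<^bsub>V\<^esub>U\<in>D. c U)" "U \<in> D" for v c U
  proof -
    have cV: "c \<in> D \<rightarrow> carrier V" using that(1) UV by auto
    have "v \<in> carrier V" unfolding that(2) using cV by (rule V.finsum_closed)
    moreover have "v = (\<Oplus>\<^bsub>V\<^esub>U\<in>D. restrict c D U)"
      unfolding that(2) using cV by (intro V.finsum_cong') auto
    ultimately have "comp v = restrict c D"
      unfolding comp_def using that(1) by (intro the1_equality[OF ex1]) auto
    then show ?thesis using that(3) by simp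
  qed
  have compU: "comp v U \<in> U" if "v \<in> carrier V" "U \<in> D" for v U
    using comp(1)[OF that(1)] that(2) by auto
  have compV: "comp v \<in> D \<rightarrow> carrier V" if "v \<in> carrier V" for v using compU[OF that] UV by auto
  have comp_add: "comp (v \<oplus>\<^bsub>V\<^esub> w) U = comp v U \<oplus>\<^bsub>V\<^esub> comp w U"
    if "v \<in> carrier V" "w \<in> carrier V" "U \<in> D" for v w U
  proof (rule compI)
    show "v \<oplus>\<^bsub>V\<^esub> w = (\<Oplus>\<^bsub>V\<^esub>U\<in>D. comp v U \<oplus>\<^bsub>V\<^esub> comp w U)"
      by (subst V.finsum_addf) (use compV that comp(2) in auto)
    show "comp v U \<oplus>\<^bsub>V\<^esub> comp w U \<in> U" if "U \<in> D" for U
      using V.submoduleE(5)[OF subD[OF that]] compU \<open>v \<in> _\<close> \<open>w \<in> _\<close> that by auto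
  qed fact
  have comp_smult: "comp (r \<odot>\<^bsub>V\<^esub> v) U = r \<odot>\<^bsub>V\<^esub> comp v U"
    if "r \<in> carrier CC" "v \<in> carrier V" "U \<in> D" for r v U
  proof (rule compI)
    show "r \<odot>\<^bsub>V\<^esub> v = (\<Oplus>\<^bsub>V\<^esub>U\<in>D. r \<odot>\<^bsub>V\<^esub> comp v U)"
      by (subst V.finsum_smult_ldistr[symmetric]) (use compV that comp(2) finD in auto)
    show "r \<odot>\<^bsub>V\<^esub> comp v U \<in> U" if "U \<in> D" for U
      using V.submoduleE(4)[OF subD[OF that]] compU \<open>r \<in> _\<close> \<open>v \<in> _\<close> that by auto
  qed fact
  have comp_\<rho>: "comp (\<rho> g v) U = \<rho> g (comp v U)"
    if "g \<in> carrier G" "v \<in> carrier V" "U \<in> D" for g v U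
  proof (rule compI)
    show "\<rho> g v = (\<Oplus>\<^bsub>V\<^esub>U\<in>D. \<rho> g (comp v U))"
      by (subst linear_maps_finsum[OF V V lin, symmetric]) (use compV that comp(2) finD in auto)
    show "\<rho> g (comp v U) \<in> U" if "U \<in> D" for U
      using \<rho>U that compU \<open>g \<in> _\<close> \<open>v \<in> _\<close> by auto
  qed fact
  have comp_id: "comp u U' = (if U' = U then u else \<zero>\<^bsub>V\<^esub>)" if "U \<in> D" "u \<in> U" "U' \<in> D" for u U U'
  proof (rule compI[of "\<lambda>U'. if U' = U then u else \<zero>\<^bsub>V\<^esub>"])
    have uV: "u \<in> carrier V" using UV that by auto
    show "u = (\<Oplus>\<^bsub>V\<^esub>U'\<in>D. if U' = U then u else \<zero>\<^bsub>V\<^esub>)"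
      using V.finsum_singleton[of U D "\<lambda>_. u"] that finD uV by (auto simp: eq_commute)
    show "(if U' = U then u else \<zero>\<^bsub>V\<^esub>) \<in> U'" if "U' \<in> D" for U' using that z \<open>u \<in> U\<close> by auto
  qed fact
  have ext: "(\<lambda>v. S (comp v U)) \<in> intertwiners G V \<rho>"
    if "U \<in> D" "U' \<in> D" and S: "S \<in> linear_maps CC (subspace_module V U) (subspace_module V U')"
      and Sg: "\<And>g u. g \<in> carrier G \<Longrightarrow> u \<in> U \<Longrightarrow> S (\<rho> g u) = \<rho> g (S u)" for U U' S
    unfolding intertwiners_def
    using that(1,2) comp_add comp_smult comp_\<rho> compU Sg UV
      linear_maps_closed[OF S] linear_maps_add[OF S] linear_maps_smult[OF S]
    by (auto intro!: linear_mapsI simp: subset_iff)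
  assume "\<not> rep_multiplicity G V \<rho> D W \<sigma> \<le> 1"
  then obtain U1 U2 where U12: "U1 \<noteq> U2" "U1 \<in> D" "U2 \<in> D"
    "isomorphic_reps G W \<sigma> (subspace_module V U1) (subspace_action \<rho> U1)"
    "isomorphic_reps G W \<sigma> (subspace_module V U2) (subspace_action \<rho> U2)"
    using finD unfolding rep_multiplicity_def by (auto simp: card_le_Suc0_iff_eq)
  have iso: "\<exists>S\<in>linear_maps CC (subspace_module V U) (subspace_module V U').
      (\<forall>g\<in>carrier G. \<forall>u\<in>U. S (\<rho> g u) = \<rho> g (S u)) \<and>
      (\<forall>u\<in>U. S u = T' (inv_into (carrier W) T u))"
    if "U \<in> D" "U' \<in> D" and T: "T \<in> linear_maps CC W (subspace_module V U)" "bij_betw T (carrier W) U"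
      "\<forall>g\<in>carrier G. \<forall>v\<in>carrier W. T (\<sigma> g v) = subspace_action \<rho> U g (T v)"
      and T': "T' \<in> linear_maps CC W (subspace_module V U')" "bij_betw T' (carrier W) U'"
      "\<forall>g\<in>carrier G. \<forall>v\<in>carrier W. T' (\<sigma> g v) = subspace_action \<rho> U' g (T' v)" for U U' T T'
  proof -
    let ?h = "inv_into (carrier W) T"
    have h: "?h u \<in> carrier W" "T (?h u) = u" if "u \<in> U" for u
      using T(2) that by (auto simp: bij_betw_def inv_into_into f_inv_into_f)
    have hT: "?h (T w) = w" if "w \<in> carrier W" for w
      using T(2) that by (auto simp: bij_betw_def)
    have TU: "T w \<in> U" "T' w \<in> U'" if "w \<in> carrier W" for w
      using T(2) T'(2) that by (auto simp: bij_betw_def)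
    have h_add: "?h (u \<oplus>\<^bsub>V\<^esub> v) = ?h u \<oplus>\<^bsub>W\<^esub> ?h v" if "u \<in> U" "v \<in> U" for u v
      using linear_maps_add[OF T(1), of "?h u" "?h v"] h that hT[of "?h u \<oplus>\<^bsub>W\<^esub> ?h v"] by simp
    have h_smult: "?h (r \<odot>\<^bsub>V\<^esub> u) = r \<odot>\<^bsub>W\<^esub> ?h u" if "u \<in> U" "r \<in> carrier CC" for u r
      using linear_maps_smult[OF T(1), of r "?h u"] h that hT[of "r \<odot>\<^bsub>W\<^esub> ?h u"] by simp
    have h_g: "?h (\<rho> g u) = \<sigma> g (?h u)" if "u \<in> U" "g \<in> carrier G" for u g
      using h that hT[of "\<sigma> g (?h u)"] T(3) linear_maps_closed[OF linW] by simp
    show ?thesis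
    proof (intro bexI[where x = "\<lambda>u. T' (?h u)"] conjI ballI)
      show "(\<lambda>u. T' (?h u)) \<in> linear_maps CC (subspace_module V U) (subspace_module V U')"
        using h h_add h_smult linear_mapsD[OF T'(1)] by (intro linear_mapsI) auto
      show "T' (?h (\<rho> g u)) = \<rho> g (T' (?h u))" if "g \<in> carrier G" "u \<in> U" for g u
        using that h_g h T'(3) TU by auto
    qed auto
  qed
  obtain T1 where T1: "T1 \<in> linear_maps CC W (subspace_module V U1)" "bij_betw T1 (carrier W) U1"
      "\<forall>g\<in>carrier G. \<forall>v\<in>carrier W. T1 (\<sigma> g v) = subspace_action \<rho> U1 g (T1 v)"
    using U12(4) by (auto simp: isomorphic_reps_def)
  obtain T2 where T2: "T2 \<in> linear_maps CC W (subspace_module V U2)" "bij_betw T2 (carrier W) U2"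
      "\<forall>g\<in>carrier G. \<forall>v\<in>carrier W. T2 (\<sigma> g v) = subspace_action \<rho> U2 g (T2 v)"
    using U12(5) by (auto simp: isomorphic_reps_def)
  obtain S where S: "S \<in> linear_maps CC (subspace_module V U1) (subspace_module V U2)"
      "\<forall>g\<in>carrier G. \<forall>u\<in>U1. S (\<rho> g u) = \<rho> g (S u)"
      "\<forall>u\<in>U1. S u = T2 (inv_into (carrier W) T1 u)"
    using iso[OF U12(2,3) T1 T2] by auto
  obtain S' where S': "S' \<in> linear_maps CC (subspace_module V U2) (subspace_module V U1)"
      "\<forall>g\<in>carrier G. \<forall>u\<in>U2. S' (\<rho> g u) = \<rho> g (S' u)"
      "\<forall>u\<in>U2. S' u = T1 (inv_into (carrier W) T2 u)"
    using iso[OF U12(3,2) T2 T1] by auto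
  have "\<exists>u\<in>U1. u \<noteq> \<zero>\<^bsub>V\<^esub>"
    using irrD[OF U12(2)] z[OF U12(2)] by (auto simp: irreducible_rep_def)
  then obtain u where u: "u \<in> U1" "u \<noteq> \<zero>\<^bsub>V\<^esub>" by auto
  have uV: "u \<in> carrier V" using u UV U12 by auto
  have Su: "S u \<in> U2" using linear_maps_closed[OF S(1), of u] u by simp
  have S'S: "S' (S u) = u"
  proof -
    have w: "inv_into (carrier W) T1 u \<in> carrier W" "T1 (inv_into (carrier W) T1 u) = u"
      using T1(2) u by (auto simp: bij_betw_def inv_into_into f_inv_into_f)
    then show ?thesis using S(3) S'(3) u Su T2(2) by (auto simp: bij_betw_def)
  qed
  have mods: "module CC (subspace_module V U)" if "U \<in> D" for U
    using submodule.submodule_is_module[OF subD[OF that] V] .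
  have S0: "S \<zero>\<^bsub>V\<^esub> = \<zero>\<^bsub>V\<^esub>" using linear_maps_zero[OF mods[OF U12(2)] mods[OF U12(3)] S(1)] by simp
  have S'0: "S' \<zero>\<^bsub>V\<^esub> = \<zero>\<^bsub>V\<^esub>" using linear_maps_zero[OF mods[OF U12(3)] mods[OF U12(2)] S'(1)] by simp
  have A: "(\<lambda>v. S (comp v U1)) \<in> intertwiners G V \<rho>" using ext[OF U12(2,3) S(1)] S(2) by auto
  have B: "(\<lambda>v. S' (comp v U2)) \<in> intertwiners G V \<rho>" using ext[OF U12(3,2) S'(1)] S'(2) by auto
  \<comment> \<open>The left side vanishes because \<open>u\<close> has no component in
    \<open>U2\<close>; the right side is \<open>S' (S u) = u\<close>, which is nonzero.\<close>
  have "S (comp (S' (comp u U2)) U1) = S' (comp (S (comp u U1)) U2)"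
    using comm[OF A B uV] .
  then show False
    using comp_id[OF U12(2) u(1)] comp_id[OF U12(3) Su] comp_id[OF U12(2) z[OF U12(2)]]
      U12 S'S S0 S'0 u by auto
qed

section \<open>Permutation modules\<close>

lemma carrier_perm_module: "finite E \<Longrightarrow> carrier (perm_module E) = extensional E"
  by (auto simp: perm_module_def)

lemma perm_module_simps:
  "f \<oplus>\<^bsub>perm_module E\<^esub> g = (\<lambda>x\<in>E. f x + g x)"
  "a \<odot>\<^bsub>perm_module E\<^esub> f = (\<lambda>x\<in>E. a * f x)"
  "\<zero>\<^bsub>perm_module E\<^esub> = (\<lambda>x\<in>E. 0)"
  by (simp_all add: perm_module_def)

lemma carrier_CC [simp]: "carrier CC = UNIV"
  by (simp add: ring_of_type_algebra_def)

lemma perm_module_finsum: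
  assumes "finite E" "finite A" "g \<in> A \<rightarrow> extensional E"
  shows "(\<Oplus>\<^bsub>perm_module E\<^esub>i\<in>A. g i) = (\<lambda>x\<in>E. \<Sum>i\<in>A. g i x)"
proof -
  interpret P: Module.module CC "perm_module E" by (rule module_perm_module)
  show ?thesis using assms(2,3)
  proof (induction A rule: finite_induct)
    case empty
    then show ?case by (simp add: perm_module_simps)
  next
    case (insert a A)
    have *: "g \<in> A \<rightarrow> carrier (perm_module E)" "g a \<in> carrier (perm_module E)"
      using insert.prems assms(1) by (auto simp: carrier_perm_module)
    have "(\<Oplus>\<^bsub>perm_module E\<^esub>i\<in>insert a A. g i) = g a \<oplus>\<^bsub>perm_module E\<^esub> (\<Oplus>\<^bsub>perm_module E\<^esub>i\<in>A. g i)"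
      using insert.hyps * by (rule P.finsum_insert)
    also have "\<dots> = (\<lambda>x\<in>E. \<Sum>i\<in>insert a A. g i x)"
      using insert by (auto simp: perm_module_simps fun_eq_iff)
    finally show ?case .
  qed
qed

text \<open>In the basis of points, an intertwiner has a matrix that is constant on orbits of pairs,
  and composition is matrix multiplication. The assumption \<open>comm\<close> says that such
  matrices commute.\<close>

lemma perm_intertwiners_commute:
  fixes E :: "'x set"
  assumes act: "group_action G S \<phi>" and ES: "E \<subseteq> S" and fin: "finite E"
    and gE: "\<And>g x. g \<in> carrier G \<Longrightarrow> x \<in> E \<Longrightarrow> \<phi> g x \<in> E"
    and comm: "\<And>K L x z. \<lbrakk>\<And>g x y. \<lbrakk>g \<in> carrier G; x \<in> E; y \<in> E\<rbrakk> \<Longrightarrow> K (\<phi> g x) (\<phi> g y) = K x y;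
      \<And>g x y. \<lbrakk>g \<in> carrier G; x \<in> E; y \<in> E\<rbrakk> \<Longrightarrow> L (\<phi> g x) (\<phi> g y) = L x y; x \<in> E; z \<in> E\<rbrakk> \<Longrightarrow>
      (\<Sum>y\<in>E. K x y * L y z) = (\<Sum>y\<in>E. L x y * K y z :: complex)"
    and A: "A \<in> intertwiners G (perm_module E) (perm_action G \<phi> E)"
    and B: "B \<in> intertwiners G (perm_module E) (perm_action G \<phi> E)"
    and v: "v \<in> carrier (perm_module E)"
  shows "A (B v) = B (A v)"
proof -
  let ?P = "perm_module E" and ?a = "perm_action G \<phi> E"
  interpret group_action G S \<phi> by fact
  interpret h: group_hom G "BijGroup S" \<phi> by (rule group_hom)
  define \<delta> :: "'x \<Rightarrow> 'x \<Rightarrow> complex" where "\<delta> y = (\<lambda>x\<in>E. if x = y then 1 else 0)" for y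
  have \<delta>: "\<delta> y \<in> extensional E" for y by (simp add: \<delta>_def)
  have carr: "carrier ?P = extensional E" using fin by (rule carrier_perm_module)
  have kernel: "A f = (\<lambda>x\<in>E. \<Sum>y\<in>E. A (\<delta> y) x * f y)" and
    ext: "A f \<in> extensional E"
    if A: "A \<in> intertwiners G ?P ?a" and f: "f \<in> extensional E" for A f
  proof -
    have lin: "A \<in> linear_maps CC ?P ?P" using A by (auto simp: intertwiners_def)
    show "A f \<in> extensional E" using linear_maps_closed[OF lin] f by (simp add: carr)
    have "f = (\<lambda>x\<in>E. \<Sum>y\<in>E. f y * \<delta> y x)"
    proof
      fix x
      have "(\<Sum>y\<in>E. f y * \<delta> y x) = (\<Sum>y\<in>E. if y = x then f x else 0)" if "x \<in> E"
        by (rule sum.cong) (use that in \<open>auto simp: \<delta>_def\<close>)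
      then show "f x = (\<lambda>x\<in>E. \<Sum>y\<in>E. f y * \<delta> y x) x"
        using fin f by (cases "x \<in> E") (auto simp: extensional_def)
    qed
    also have "\<dots> = (\<Oplus>\<^bsub>?P\<^esub>y\<in>E. f y \<odot>\<^bsub>?P\<^esub> \<delta> y)"
      by (subst perm_module_finsum) (auto simp: fin perm_module_simps)
    finally have "A f = A (\<Oplus>\<^bsub>?P\<^esub>y\<in>E. f y \<odot>\<^bsub>?P\<^esub> \<delta> y)" by simp
    also have "\<dots> = (\<Oplus>\<^bsub>?P\<^esub>y\<in>E. A (f y \<odot>\<^bsub>?P\<^esub> \<delta> y))"
      by (rule linear_maps_finsum[OF module_perm_module module_perm_module lin fin])
        (auto simp: carr perm_module_simps)
    also have "\<dots> = (\<Oplus>\<^bsub>?P\<^esub>y\<in>E. f y \<odot>\<^bsub>?P\<^esub> A (\<delta> y))"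
      using linear_maps_smult[OF lin] \<delta> by (simp add: carr)
    also have "\<dots> = (\<lambda>x\<in>E. \<Sum>y\<in>E. A (\<delta> y) x * f y)"
      by (subst perm_module_finsum) (auto simp: fin perm_module_simps mult.commute intro!: restrict_ext)
    finally show "A f = (\<lambda>x\<in>E. \<Sum>y\<in>E. A (\<delta> y) x * f y)" .
  qed
  have inv: "A (\<delta> (\<phi> g y)) (\<phi> g x) = A (\<delta> y) x"
    if A: "A \<in> intertwiners G ?P ?a" and g: "g \<in> carrier G" and x: "x \<in> E" and y: "y \<in> E" for A g x y
  proof -
    have one: "\<phi> \<one>\<^bsub>G\<^esub> x = x" if "x \<in> E" for x
      using that ES by (auto simp: BijGroup_def)
    have inj: "\<phi> (inv\<^bsub>G\<^esub> g) (\<phi> g x) = x" if "x \<in> E" for x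
      using composition_rule[of x "inv\<^bsub>G\<^esub> g" g] that ES g one[OF that]
      by (auto simp del: h.hom_inv h.hom_one)
    have inj': "\<phi> g (\<phi> (inv\<^bsub>G\<^esub> g) x) = x" if "x \<in> E" for x
      using composition_rule[of x g "inv\<^bsub>G\<^esub> g"] that ES g one[OF that]
      by (auto simp del: h.hom_inv h.hom_one)
    have "?a g (\<delta> y) = \<delta> (\<phi> g y)"
      using inj[OF y] inj' gE[OF h.G.inv_closed[OF g]]
      by (auto simp: perm_action_def carr \<delta> simp del: h.hom_inv) (auto simp: \<delta>_def fun_eq_iff simp del: h.hom_inv)
    moreover have "A (?a g (\<delta> y)) = ?a g (A (\<delta> y))"
      using A g \<delta> by (auto simp: intertwiners_def carr)
    moreover have "A (\<delta> y) \<in> extensional E" using ext[OF A \<delta>] .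
    ultimately show ?thesis
      using inj[OF x] gE[OF g x] by (auto simp: perm_action_def carr simp del: h.hom_inv)
  qed
  have comp: "A (B v) = (\<lambda>x\<in>E. \<Sum>z\<in>E. (\<Sum>y\<in>E. A (\<delta> y) x * B (\<delta> z) y) * v z)"
    if A: "A \<in> intertwiners G ?P ?a" and B: "B \<in> intertwiners G ?P ?a" for A B
  proof -
    have v': "v \<in> extensional E" using v by (simp add: carr)
    have "A (B v) = (\<lambda>x\<in>E. \<Sum>y\<in>E. \<Sum>z\<in>E. A (\<delta> y) x * B (\<delta> z) y * v z)"
      by (subst kernel[OF A ext[OF B v']], subst kernel[OF B v'])
        (auto intro!: restrict_ext sum.cong simp: sum_distrib_left mult.assoc)
    also have "\<dots> = (\<lambda>x\<in>E. \<Sum>z\<in>E. (\<Sum>y\<in>E. A (\<delta> y) x * B (\<delta> z) y) * v z)"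
      by (intro restrict_ext, subst sum.swap) (simp add: sum_distrib_right)
    finally show ?thesis .
  qed
  have "(\<Sum>y\<in>E. A (\<delta> y) x * B (\<delta> z) y) = (\<Sum>y\<in>E. B (\<delta> y) x * A (\<delta> z) y)" if "x \<in> E" "z \<in> E" for x z
    using comm[of "\<lambda>x y. A (\<delta> y) x" "\<lambda>x y. B (\<delta> y) x" x z] inv[OF A] inv[OF B] that by simp
  then show ?thesis unfolding comp[OF A B] comp[OF B A] by (auto intro!: restrict_ext sum.cong)
qed

subsection \<open>Complete reducibility\<close>

lemma perm_submoduleD:
  assumes "submodule U CC (perm_module E)" "finite E"
  shows "U \<subseteq> extensional E" "(\<lambda>x\<in>E. 0) \<in> U"
    "\<And>f g a. f \<in> U \<Longrightarrow> g \<in> U \<Longrightarrow> (\<lambda>x\<in>E. f x + a * g x) \<in> U"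
proof -
  interpret P: Module.module CC "perm_module E" by (rule module_perm_module)
  show "U \<subseteq> extensional E" using P.submoduleE(1)[OF assms(1)] assms(2) by (simp add: carrier_perm_module)
  show "(\<lambda>x\<in>E. 0) \<in> U"
    using subgroup.one_closed[OF submodule.axioms(1)[OF assms(1)]] by (simp add: perm_module_simps)
  fix f g :: "'a \<Rightarrow> complex" and a assume "f \<in> U" "g \<in> U"
  then have "f \<oplus>\<^bsub>perm_module E\<^esub> (a \<odot>\<^bsub>perm_module E\<^esub> g) \<in> U"
    using P.submoduleE(4,5)[OF assms(1)] by simp
  moreover have "f \<oplus>\<^bsub>perm_module E\<^esub> (a \<odot>\<^bsub>perm_module E\<^esub> g) = (\<lambda>x\<in>E. f x + a * g x)"
    by (auto simp: perm_module_simps)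
  ultimately show "(\<lambda>x\<in>E. f x + a * g x) \<in> U" by simp
qed

lemma perm_submoduleI:
  assumes "finite E" "U \<subseteq> extensional E" "(\<lambda>x\<in>E. 0) \<in> U"
    "\<And>f g a. f \<in> U \<Longrightarrow> g \<in> U \<Longrightarrow> (\<lambda>x\<in>E. f x + a * g x) \<in> U"
  shows "submodule U CC (perm_module E)"
proof -
  interpret P: Module.module CC "perm_module E" by (rule module_perm_module)
  have s: "a \<odot>\<^bsub>perm_module E\<^esub> f \<in> U" if "f \<in> U" for a f
    using assms(4)[OF assms(3) that, of a] by (simp add: perm_module_simps restrict_def if_distrib cong: if_cong)
  show ?thesis
  proof (rule P.submoduleI)
    fix f assume f: "f \<in> U"
    then have "\<ominus>\<^bsub>perm_module E\<^esub> f = (\<ominus>\<^bsub>CC\<^esub> \<one>\<^bsub>CC\<^esub>) \<odot>\<^bsub>perm_module E\<^esub> f"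
      using assms(1,2) by (subst P.smult_l_minus) (auto simp: carrier_perm_module)
    then show "\<ominus>\<^bsub>perm_module E\<^esub> f \<in> U" using s[OF f] by simp
  next
    fix f g assume "f \<in> U" "g \<in> U"
    then show "f \<oplus>\<^bsub>perm_module E\<^esub> g \<in> U" using assms(4)[of f g 1] by (simp add: perm_module_simps)
  qed (use assms s in \<open>auto simp: carrier_perm_module perm_module_simps\<close>)
qed

text \<open>A substitute for the dimension: number the points of \<open>E\<close> and count the leading positions of
  the members of a subspace.\<close>

lemma perm_submodule_measure:
  assumes fin: "finite E"
  obtains d :: "('x \<Rightarrow> complex) set \<Rightarrow> nat" where
    "\<And>U U'. \<lbrakk>submodule U CC (perm_module E); submodule U' CC (perm_module E); U' \<subset> U\<rbrakk> \<Longrightarrow> d U' < d U"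
proof -
  obtain ord :: "'x \<Rightarrow> nat" and n where ord: "ord ` E = {i. i < n}" "inj_on ord E"
    using finite_imp_inj_to_nat_seg[OF fin] by auto
  define piv where "piv U = {x\<in>E. \<exists>f\<in>U. f x \<noteq> (0::complex) \<and> (\<forall>y\<in>E. ord y < ord x \<longrightarrow> f y = 0)}" for U
  show thesis
  proof (rule that[of "\<lambda>U. card (piv U)"])
    fix U U' assume U: "submodule U CC (perm_module E)" and U': "submodule U' CC (perm_module E)"
      and sub: "U' \<subset> U"
    note UD = perm_submoduleD[OF U fin] and UD' = perm_submoduleD[OF U' fin]
    have "piv U' \<subseteq> piv U" using sub unfolding piv_def by blast
    moreover have "piv U' \<noteq> piv U"
    proof
      assume eq: "piv U' = piv U"
      obtain f where f: "f \<in> U" "f \<notin> U'" using sub by auto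
      \<comment> \<open>With equal sets of leading positions, \<open>f\<close> can be matched by
        members of \<open>U'\<close> on the first \<open>m\<close> points. A first disagreement at
        \<open>x\<close> makes \<open>x\<close> a leading position of \<open>U\<close>, hence of
        \<open>U'\<close>, and a multiple of a member of \<open>U'\<close> that leads at
        \<open>x\<close> repairs it without disturbing earlier points.\<close>
      have "\<exists>g\<in>U'. \<forall>x\<in>E. ord x < m \<longrightarrow> f x = g x" for m
      proof (induction m)
        case 0
        then show ?case using UD'(2) by auto
      next
        case (Suc m)
        then obtain g where g: "g \<in> U'" "\<forall>x\<in>E. ord x < m \<longrightarrow> f x = g x" by auto
        show ?case
        proof (cases "\<exists>x\<in>E. ord x = m \<and> f x \<noteq> g x")
          case False
          then show ?thesis using g by (auto simp: less_Suc_eq)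
        next
          case True
          then obtain x where x: "x \<in> E" "ord x = m" "f x \<noteq> g x" by auto
          have "(\<lambda>x\<in>E. f x + (-1) * g x) \<in> U" using UD(3) f(1) g(1) sub by blast
          then have "x \<in> piv U" using g(2) x unfolding piv_def
            by (auto intro!: bexI[where x = "\<lambda>x\<in>E. f x + (-1) * g x"])
          then have "x \<in> piv U'" by (simp add: eq)
          then obtain h where h: "h \<in> U'" "h x \<noteq> 0" "\<forall>y\<in>E. ord y < m \<longrightarrow> h y = 0"
            using x(2) unfolding piv_def by auto
          define a where "a = (f x - g x) / h x"
          have "(\<lambda>x\<in>E. g x + a * h x) \<in> U'" using UD'(3) g(1) h(1) by blast
          moreover have "\<forall>y\<in>E. ord y < Suc m \<longrightarrow> f y = (\<lambda>x\<in>E. g x + a * h x) y"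
          proof (intro ballI impI)
            fix y assume y: "y \<in> E" "ord y < Suc m"
            show "f y = (\<lambda>x\<in>E. g x + a * h x) y"
            proof (cases "ord y < m")
              case True
              then show ?thesis using y g h by auto
            next
              case False
              then have "ord y = ord x" using y x by simp
              then have "y = x" using y x ord(2) by (meson inj_onD)
              then show ?thesis using h(2) x by (simp add: a_def)
            qed
          qed
          ultimately show ?thesis by blast
        qed
      qed
      from this[of n] obtain g where g: "g \<in> U'" "\<forall>x\<in>E. f x = g x" using ord(1) by blast
      have "f \<in> extensional E" "g \<in> extensional E" using UD(1) UD'(1) f g by auto
      then have "f = g" using g(2) by (auto intro: extensionalityI)
      then show False using f g by simp
    qed
    moreover have "finite (piv U)" using fin by (simp add: piv_def)
    ultimately show "card (piv U') < card (piv U)" by (auto intro: psubset_card_mono)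
  qed
qed

section \<open>The Hermitian form on C[E], orthogonal projections and Maschke's theorem\<close>

definition perm_ip :: "'x set \<Rightarrow> ('x \<Rightarrow> complex) \<Rightarrow> ('x \<Rightarrow> complex) \<Rightarrow> complex" where
  "perm_ip E f g = (\<Sum>x\<in>E. f x * cnj (g x))"

lemma perm_ip_self_eq_0:
  assumes "finite E" "perm_ip E f f = 0" "x \<in> E"
  shows "f x = 0"
proof -
  have "complex_of_real (\<Sum>x\<in>E. (cmod (f x))\<^sup>2) = 0"
    using assms(2) by (simp add: perm_ip_def complex_norm_square del: of_real_power)
  then have "(\<Sum>x\<in>E. (cmod (f x))\<^sup>2) = 0" using of_real_eq_0_iff by blast
  then show ?thesis using assms(1,3) by (subst (asm) sum_nonneg_eq_0_iff) auto
qed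

lemma perm_ip_add_left: "perm_ip E (\<lambda>x\<in>E. f x + a * g x) h = perm_ip E f h + a * perm_ip E g h"
proof -
  have "perm_ip E (\<lambda>x\<in>E. f x + a * g x) h = (\<Sum>x\<in>E. f x * cnj (h x) + a * (g x * cnj (h x)))"
    unfolding perm_ip_def by (rule sum.cong) (auto simp: algebra_simps)
  then show ?thesis by (simp add: perm_ip_def sum.distrib sum_distrib_left)
qed

lemma perm_ip_commute: "perm_ip E f g = cnj (perm_ip E g f)"
  by (simp add: perm_ip_def mult.commute)

text \<open>Gram-Schmidt by induction on the measure \<open>d\<close>: choose \<open>u\<close> in
  \<open>U\<close> of nonzero norm, project to the orthogonal complement \<open>U'\<close> of
  \<open>u\<close> in \<open>U\<close>, and correct by a multiple of \<open>u\<close>. If there is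
  no such \<open>u\<close>, every member of \<open>U\<close> vanishes on \<open>E\<close>.\<close>

lemma perm_orthogonal_projection:
  assumes fin: "finite E" and U: "submodule U CC (perm_module E)" and f: "f \<in> extensional E"
  shows "\<exists>g\<in>U. \<forall>u\<in>U. perm_ip E f u = perm_ip E g u"
proof -
  obtain d where d: "\<And>U U'. \<lbrakk>submodule U CC (perm_module E); submodule U' CC (perm_module E); U' \<subset> U\<rbrakk>
      \<Longrightarrow> d U' < (d U :: nat)"
    by (rule perm_submodule_measure[OF fin]) blast
  show ?thesis using U
  proof (induction U rule: measure_induct_rule[of d])
    case (less U)
    note UD = perm_submoduleD[OF less.prems fin]
    show ?case
    proof (cases "\<exists>u\<in>U. perm_ip E u u \<noteq> 0")
      case False
      have "perm_ip E f u = perm_ip E (\<lambda>x\<in>E. 0) u" if "u \<in> U" for u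
        using perm_ip_self_eq_0[OF fin, of u] False that by (simp add: perm_ip_def)
      then show ?thesis using UD(2) by blast
    next
      case True
      then obtain u where u: "u \<in> U" "perm_ip E u u \<noteq> 0" by auto
      define U' where "U' = {v\<in>U. perm_ip E v u = 0}"
      have U': "submodule U' CC (perm_module E)"
        using UD by (intro perm_submoduleI fin) (auto simp: U'_def perm_ip_add_left, simp add: perm_ip_def)
      have "U' \<subset> U" using u by (auto simp: U'_def)
      then obtain g where g: "g \<in> U'" "\<forall>v\<in>U'. perm_ip E f v = perm_ip E g v"
        using less.IH[OF d[OF less.prems U'] U'] by auto
      \<comment> \<open>The coefficient is chosen so that \<open>f\<close> and the corrected
        \<open>g\<close> agree against \<open>u\<close>. They agree against \<open>U'\<close> by
        induction, and each \<open>v\<close> in \<open>U\<close> is a member \<open>w\<close> of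
        \<open>U'\<close> plus a multiple of \<open>u\<close>.\<close>
      define a where "a = (perm_ip E f u - perm_ip E g u) / perm_ip E u u"
      let ?g = "\<lambda>x\<in>E. g x + a * u x"
      have "?g \<in> U" using UD(3) g(1) u(1) by (auto simp: U'_def)
      moreover have "perm_ip E f v = perm_ip E ?g v" if v: "v \<in> U" for v
      proof -
        define b where "b = perm_ip E v u / perm_ip E u u"
        define w where "w = (\<lambda>x\<in>E. v x + (- b) * u x)"
        have "perm_ip E w u = 0" using u(2) unfolding w_def perm_ip_add_left b_def by simp
        then have w: "w \<in> U'" using UD(3)[OF v u(1), of "- b"] by (simp add: U'_def w_def)
        have vw: "perm_ip E h v = perm_ip E h w + cnj b * perm_ip E h u" for h
        proof -
          have "perm_ip E w h = perm_ip E v h - b * perm_ip E u h"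
            unfolding w_def perm_ip_add_left by simp
          then have "cnj (perm_ip E w h) = cnj (perm_ip E v h) - cnj b * cnj (perm_ip E u h)" by simp
          then show ?thesis by (simp flip: perm_ip_commute)
        qed
        have "perm_ip E u w = 0" using w perm_ip_commute[of E u w] by (simp add: U'_def)
        moreover have "perm_ip E f u = perm_ip E ?g u" using u(2) unfolding perm_ip_add_left by (simp add: a_def)
        ultimately show ?thesis
          using g(2) w by (simp add: vw[of f] vw[of ?g]) (simp add: perm_ip_add_left)
      qed
      ultimately show ?thesis by blast
    qed
  qed
qed

lemma perm_ip_action:
  assumes act: "group_action G S \<phi>" and ES: "E \<subseteq> S" and fin: "finite E"
    and gE: "\<And>g x. g \<in> carrier G \<Longrightarrow> x \<in> E \<Longrightarrow> \<phi> g x \<in> E"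
    and g: "g \<in> carrier G" and f: "f \<in> extensional E" "h \<in> extensional E"
  shows "perm_ip E (perm_action G \<phi> E g f) (perm_action G \<phi> E g h) = perm_ip E f h"
proof -
  interpret group_action G S \<phi> by fact
  interpret h: group_hom G "BijGroup S" \<phi> by (rule group_hom)
  have g': "inv\<^bsub>G\<^esub> g \<in> carrier G" using g by simp
  have inj: "inj_on (\<phi> (inv\<^bsub>G\<^esub> g)) E" using inj_on_subset[OF inj_prop[OF g'] ES] .
  have "\<phi> (inv\<^bsub>G\<^esub> g) ` E = E" using gE[OF g'] inj fin
    by (intro card_subset_eq) (auto simp: card_image simp del: h.hom_inv)
  then have bij: "bij_betw (\<phi> (inv\<^bsub>G\<^esub> g)) E E" using inj by (simp add: bij_betw_def)
  have "perm_ip E (perm_action G \<phi> E g f) (perm_action G \<phi> E g h)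
      = (\<Sum>x\<in>E. f (\<phi> (inv\<^bsub>G\<^esub> g) x) * cnj (h (\<phi> (inv\<^bsub>G\<^esub> g) x)))"
    using f fin by (simp add: perm_ip_def perm_action_def carrier_perm_module del: h.hom_inv)
  also have "\<dots> = perm_ip E f h" unfolding perm_ip_def by (rule sum.reindex_bij_betw[OF bij])
  finally show ?thesis .
qed

lemma irreducible_subspaceI:
  assumes rep: "representation G V \<rho>" and U: "invariant_subspace G V \<rho> U" and nz: "U \<noteq> {\<zero>\<^bsub>V\<^esub>}"
    and min: "\<And>W. invariant_subspace G V \<rho> W \<Longrightarrow> W \<subseteq> U \<Longrightarrow> W \<noteq> {\<zero>\<^bsub>V\<^esub>} \<Longrightarrow> W = U"
  shows "irreducible_rep G (subspace_module V U) (subspace_action \<rho> U)"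
proof -
  interpret V: Module.module CC V using rep by (simp add: representation_def)
  have sub: "submodule U CC V" using U by (simp add: invariant_subspace_def)
  have "W = {\<zero>\<^bsub>V\<^esub>} \<or> W = U"
    if W: "invariant_subspace G (subspace_module V U) (subspace_action \<rho> U) W" for W
  proof -
    have "submodule W CC V" "W \<subseteq> U"
      using W V.submodule_of_subspace[OF sub] by (auto simp: invariant_subspace_def)
    then have "invariant_subspace G V \<rho> W"
      using W by (auto simp: invariant_subspace_def subset_iff)
    then show ?thesis using min \<open>W \<subseteq> U\<close> by blast
  qed
  then show ?thesis
    using invariant_subspace_representation[OF rep U] nz by (simp add: irreducible_rep_def)
qed

text \<open>Split off an invariant subspace \<open>U1\<close> that is minimal for the measure, and
  recurse into its orthogonal complement, which is again invariant because permutations preserve the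
  form.\<close>

lemma perm_irreducible_decomposition:
  fixes E :: "'x set"
  assumes act: "group_action G S \<phi>" and ES: "E \<subseteq> S" and fin: "finite E"
    and gE: "\<And>g x. g \<in> carrier G \<Longrightarrow> x \<in> E \<Longrightarrow> \<phi> g x \<in> E"
  shows "\<exists>D. irreducible_decomposition G (perm_module E) (perm_action G \<phi> E) D"
proof -
  let ?P = "perm_module E" and ?a = "perm_action G \<phi> E"
  interpret P: Module.module CC ?P by (rule module_perm_module)
  have rep: "representation G ?P ?a" using representation_perm_action[OF act ES gE] by blast
  interpret G: group G using rep by (simp add: representation_def)
  have lin: "?a g \<in> linear_maps CC ?P ?P" if "g \<in> carrier G" for g
    using rep that by (auto simp: representation_def hom_def module_Aut_def)
  have carr: "carrier ?P = extensional E" using fin by (rule carrier_perm_module)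
  obtain d where d: "\<And>U U'. \<lbrakk>submodule U CC ?P; submodule U' CC ?P; U' \<subset> U\<rbrakk>
      \<Longrightarrow> d U' < (d U :: nat)"
    by (rule perm_submodule_measure[OF fin]) blast
  have "\<exists>D. finite D \<and> (\<forall>W\<in>D. W \<subseteq> U \<and> invariant_subspace G ?P ?a W \<and>
         irreducible_rep G (subspace_module ?P W) (subspace_action ?a W)) \<and>
        (\<forall>v\<in>U. \<exists>!c. c \<in> (\<Pi>\<^sub>E W\<in>D. W) \<and> v = (\<Oplus>\<^bsub>?P\<^esub>W\<in>D. c W))"
    if "invariant_subspace G ?P ?a U" for U
    using that
  proof (induction U rule: measure_induct_rule[of d])
    case (less U)
    have U: "submodule U CC ?P" using less.prems by (simp add: invariant_subspace_def)
    note UD = perm_submoduleD[OF U fin]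
    show ?case
    proof (cases "U = {\<zero>\<^bsub>?P\<^esub>}")
      case True
      then show ?thesis by (intro exI[where x = "{}"]) auto
    next
      case False
      then obtain U1 where U1: "invariant_subspace G ?P ?a U1" "U1 \<subseteq> U" "U1 \<noteq> {\<zero>\<^bsub>?P\<^esub>}"
        and min: "\<And>W. invariant_subspace G ?P ?a W \<Longrightarrow> W \<subseteq> U \<Longrightarrow> W \<noteq> {\<zero>\<^bsub>?P\<^esub>} \<Longrightarrow> d U1 \<le> d W"
        using less.prems
          ex_has_least_nat[of "\<lambda>W. invariant_subspace G ?P ?a W \<and> W \<subseteq> U \<and> W \<noteq> {\<zero>\<^bsub>?P\<^esub>}" U d]
        by blast
      have sU1: "submodule U1 CC ?P" using U1 by (simp add: invariant_subspace_def)
      note U1D = perm_submoduleD[OF sU1 fin]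
      have irr: "irreducible_rep G (subspace_module ?P U1) (subspace_action ?a U1)"
      proof (rule irreducible_subspaceI[OF rep U1(1,3)])
        fix W assume W: "invariant_subspace G ?P ?a W" "W \<subseteq> U1" "W \<noteq> {\<zero>\<^bsub>?P\<^esub>}"
        then have "d U1 \<le> d W" using min U1(2) by blast
        then show "W = U1" using d[OF sU1, of W] W by (auto simp: invariant_subspace_def psubset_eq)
      qed
      define U' where "U' = {f\<in>U. \<forall>u\<in>U1. perm_ip E f u = 0}"
      have sU': "submodule U' CC ?P"
        using UD by (intro perm_submoduleI fin) (auto simp: U'_def perm_ip_add_left, simp add: perm_ip_def)
      have zero: "f = \<zero>\<^bsub>?P\<^esub>" if "f \<in> U1" "f \<in> U'" for f
        using that UD(1) perm_ip_self_eq_0[OF fin, of f]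
        by (auto simp: U'_def perm_module_simps fun_eq_iff extensional_def subset_iff)
      \<comment> \<open>Pairing \<open>g f\<close> with \<open>u\<close> is the same as pairing
        \<open>f\<close> with the translate of \<open>u\<close> by the inverse of \<open>g\<close>,
        which stays in \<open>U1\<close>.\<close>
      have "?a g f \<in> U'" if g: "g \<in> carrier G" and f: "f \<in> U'" for g f
      proof -
        have "perm_ip E (?a g f) u = 0" if u: "u \<in> U1" for u
        proof -
          let ?u = "?a (inv\<^bsub>G\<^esub> g) u"
          have u': "?u \<in> U1" using U1(1) g u by (simp add: invariant_subspace_def)
          have hom: "?a \<in> hom G (module_Aut CC ?P)" using rep by (simp add: representation_def)
          then have "?a h \<in> Bij (carrier ?P)" if "h \<in> carrier G" for h
            using that by (auto simp: hom_def module_Aut_def)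
          then have "?a (g \<otimes>\<^bsub>G\<^esub> h) = compose (carrier ?P) (?a g) (?a h)" if "h \<in> carrier G" for h
            using that g hom by (auto simp: hom_def module_Aut_def BijGroup_def)
          from this[of "inv\<^bsub>G\<^esub> g"] have "?a g ?u = ?a \<one>\<^bsub>G\<^esub> u" using g u U1D(1) by (auto simp: compose_def carr)
          also have "\<dots> = u"
          proof -
            interpret group_action G S \<phi> by fact
            interpret h: group_hom G "BijGroup S" \<phi> by (rule group_hom)
            show ?thesis using u U1D(1) ES
              by (auto simp: perm_action_def carr BijGroup_def fun_eq_iff extensional_def subset_iff)
          qed
          finally have "perm_ip E (?a g f) u = perm_ip E (?a g f) (?a g ?u)" by simp
          also have "\<dots> = perm_ip E f ?u"
            using f u' U1D(1) UD(1) by (intro perm_ip_action[OF act ES fin gE g]) (auto simp: U'_def)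
          also have "\<dots> = 0" using f u' by (simp add: U'_def)
          finally show ?thesis .
        qed
        then show ?thesis using less.prems f g by (auto simp: U'_def invariant_subspace_def)
      qed
      then have iU': "invariant_subspace G ?P ?a U'" using sU' by (simp add: invariant_subspace_def)
      have zU: "\<zero>\<^bsub>?P\<^esub> \<in> U1" "\<zero>\<^bsub>?P\<^esub> \<in> U'"
        using U1D(2) perm_submoduleD(2)[OF sU' fin] by (simp_all add: perm_module_simps)
      have U'U: "U' \<subset> U"
      proof -
        obtain u where "u \<in> U1" "u \<noteq> \<zero>\<^bsub>?P\<^esub>" using U1(3) zU(1) by auto
        then have "u \<in> U" "u \<notin> U'" using zero U1(2) by auto
        then show ?thesis by (auto simp: U'_def)
      qed
      from less.IH[OF d[OF U sU' U'U] iU'] obtain D where D0: "finite D" "\<forall>W\<in>D. W \<subseteq> U' \<and> invariant_subspace G ?P ?a W \<and>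
         irreducible_rep G (subspace_module ?P W) (subspace_action ?a W)"
        "\<forall>v\<in>U'. \<exists>!c. c \<in> (\<Pi>\<^sub>E W\<in>D. W) \<and> v = (\<Oplus>\<^bsub>?P\<^esub>W\<in>D. c W)"
        by (elim exE conjE) (rule that)
      note D = D0(1) D0(2)[rule_format] D0(3)[rule_format]
      \<comment> \<open>As \<open>D\<close> is a set of subspaces, the new summand has to be
        distinct from the old ones: it is nonzero and meets \<open>U'\<close> only in zero.\<close>
      have U1D': "U1 \<notin> D" using D(2)[of U1] zero zU U1(3) by blast
      \<comment> \<open>The sum is formed in \<open>U'\<close> as a module of its own and carried
        over by the inclusion.\<close>
      have sumU': "(\<Oplus>\<^bsub>?P\<^esub>W\<in>D. c W) \<in> U'" if "c \<in> (\<Pi> W\<in>D. W)" for c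
      proof -
        interpret S: Module.module CC "subspace_module ?P U'"
          by (rule submodule.submodule_is_module[OF sU' P.module_axioms])
        have "(\<lambda>f. f) \<in> linear_maps CC (subspace_module ?P U') ?P"
          using P.submoduleE(1)[OF sU'] by (auto simp: linear_maps_def)
        moreover have c: "c \<in> D \<rightarrow> carrier (subspace_module ?P U')" using that D(2) by (fastforce simp: Pi_iff)
        ultimately have "(\<Oplus>\<^bsub>?P\<^esub>W\<in>D. c W) = (\<Oplus>\<^bsub>subspace_module ?P U'\<^esub>W\<in>D. c W)"
          using linear_maps_finsum[OF S.module_axioms P.module_axioms _ D(1), of "\<lambda>f. f" c] by simp
        then show ?thesis using S.M.finsum_closed[OF c] by simp
      qed
      have cP: "c \<in> D \<rightarrow> carrier ?P" "c U1 \<in> carrier ?P" if "c \<in> (\<Pi> W\<in>insert U1 D. W)" for c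
      proof -
        have "c W \<in> carrier ?P" if "W \<in> D" for W
          using that D(2)[OF that] P.submoduleE(1)[OF sU'] \<open>c \<in> _\<close> by (auto simp: Pi_iff)
        then show "c \<in> D \<rightarrow> carrier ?P" by simp
        show "c U1 \<in> carrier ?P" using that P.submoduleE(1)[OF sU1] by auto
      qed
      have ins: "(\<Oplus>\<^bsub>?P\<^esub>W\<in>insert U1 D. c W) = c U1 \<oplus>\<^bsub>?P\<^esub> (\<Oplus>\<^bsub>?P\<^esub>W\<in>D. c W)"
        if "c \<in> (\<Pi> W\<in>insert U1 D. W)" for c
        using P.finsum_insert[OF D(1) U1D' cP[OF that]] .
      have ex1: "\<exists>!c. c \<in> (\<Pi>\<^sub>E W\<in>insert U1 D. W) \<and> v = (\<Oplus>\<^bsub>?P\<^esub>W\<in>insert U1 D. c W)" if v: "v \<in> U" for v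
      proof -
        have vE: "v \<in> extensional E" using v UD(1) by auto
        obtain a where a: "a \<in> U1" "\<And>u. u \<in> U1 \<Longrightarrow> perm_ip E v u = perm_ip E a u"
          using perm_orthogonal_projection[OF fin sU1 vE] by auto
        define b where "b = (\<lambda>x\<in>E. v x + (-1) * a x)"
        have "perm_ip E b u = 0" if "u \<in> U1" for u
          unfolding b_def perm_ip_add_left using a(2)[OF that] by simp
        moreover have "b \<in> U" unfolding b_def using UD(3) v a(1) U1(2) by blast
        ultimately have b: "b \<in> U'" by (simp add: U'_def)
        have aE: "a \<in> extensional E" using a U1D(1) by auto
        have vab: "v = a \<oplus>\<^bsub>?P\<^esub> b"
          using vE by (auto simp: perm_module_simps b_def fun_eq_iff extensional_def)
        have uniq: "a' = a \<and> b' = b" if ab: "a' \<in> U1" "b' \<in> U'" "v = a' \<oplus>\<^bsub>?P\<^esub> b'" for a' b'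
        proof -
          have ext: "a' \<in> extensional E" "b' \<in> extensional E" "b \<in> extensional E"
            using ab U1D(1) b UD(1) by (auto simp: U'_def)
          have eq: "a' x + b' x = a x + b x" if "x \<in> E" for x
            using fun_cong[OF trans[OF ab(3)[symmetric] vab], of x] that by (simp add: perm_module_simps)
          have "a' x + (-1) * a x = b x + (-1) * b' x" if "x \<in> E" for x
            using eq[OF that] by (simp add: algebra_simps)
          then have diff: "(\<lambda>x\<in>E. a' x + (-1) * a x) = (\<lambda>x\<in>E. b x + (-1) * b' x)"
            by (rule restrict_ext)
          have "(\<lambda>x\<in>E. a' x + (-1) * a x) \<in> U1" using U1D(3) ab(1) a(1) by blast
          moreover have "(\<lambda>x\<in>E. b x + (-1) * b' x) \<in> U'"
            using perm_submoduleD(3)[OF sU' fin] ab(2) b by blast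
          ultimately have 0: "(\<lambda>x\<in>E. a' x + (-1) * a x) = \<zero>\<^bsub>?P\<^esub>" "(\<lambda>x\<in>E. b x + (-1) * b' x) = \<zero>\<^bsub>?P\<^esub>"
            unfolding diff by (rule zero)+
          have "a' x = a x" "b' x = b x" if "x \<in> E" for x
            using fun_cong[OF 0(1), of x] fun_cong[OF 0(2), of x] that by (simp_all add: perm_module_simps)
          then show ?thesis using ext aE by (auto intro: extensionalityI)
        qed
        obtain c where c: "c \<in> (\<Pi>\<^sub>E W\<in>D. W)" "b = (\<Oplus>\<^bsub>?P\<^esub>W\<in>D. c W)"
          and cu: "\<And>c'. c' \<in> (\<Pi>\<^sub>E W\<in>D. W) \<Longrightarrow> b = (\<Oplus>\<^bsub>?P\<^esub>W\<in>D. c' W) \<Longrightarrow> c' = c"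
          using D(3)[OF b] by blast
        have sum_cong: "(\<Oplus>\<^bsub>?P\<^esub>W\<in>D. c1 W) = (\<Oplus>\<^bsub>?P\<^esub>W\<in>D. c2 W)"
          if "\<And>W. W \<in> D \<Longrightarrow> c1 W = c2 W" "c2 \<in> D \<rightarrow> carrier ?P" for c1 c2
          using that by (intro P.finsum_cong') auto
        show ?thesis
        proof (rule ex1I[of _ "c(U1 := a)"], intro conjI)
          show e: "c(U1 := a) \<in> (\<Pi>\<^sub>E W\<in>insert U1 D. W)" using c(1) a(1) by (auto simp: PiE_iff extensional_def)
          then have e': "c(U1 := a) \<in> (\<Pi> W\<in>insert U1 D. W)" by (simp add: PiE_iff Pi_iff)
          have "c W = (c(U1 := a)) W" if "W \<in> D" for W using that U1D' by auto
          then have "(\<Oplus>\<^bsub>?P\<^esub>W\<in>D. (c(U1 := a)) W) = b"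
            unfolding c(2) using cP(1)[OF e'] by (intro sum_cong[symmetric])
          then show "v = (\<Oplus>\<^bsub>?P\<^esub>W\<in>insert U1 D. (c(U1 := a)) W)"
            unfolding ins[OF e'] using vab by (simp del: fun_upd_apply add: fun_upd_same)
        next
          fix c' assume c': "c' \<in> (\<Pi>\<^sub>E W\<in>insert U1 D. W) \<and> v = (\<Oplus>\<^bsub>?P\<^esub>W\<in>insert U1 D. c' W)"
          then have e': "c' \<in> (\<Pi> W\<in>insert U1 D. W)" by (auto simp: PiE_iff Pi_iff)
          then have "v = c' U1 \<oplus>\<^bsub>?P\<^esub> (\<Oplus>\<^bsub>?P\<^esub>W\<in>D. c' W)" using c' ins[OF e'] by simp
          then have ab: "c' U1 = a" "(\<Oplus>\<^bsub>?P\<^esub>W\<in>D. c' W) = b"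
            using uniq sumU'[of c'] e' by (auto simp: Pi_iff)
          have "(\<Oplus>\<^bsub>?P\<^esub>W\<in>D. restrict c' D W) = b"
            unfolding ab(2)[symmetric] using cP(1)[OF e'] by (intro sum_cong) auto
          then have c'c: "restrict c' D = c" using e' by (intro cu) auto
          show "c' = c(U1 := a)"
          proof
            fix W
            have "c' W = undefined" if "W \<notin> insert U1 D" using c' that by (auto simp: PiE_iff extensional_def)
            then show "c' W = (c(U1 := a)) W" unfolding c'c[symmetric] using ab(1) by simp
          qed
        qed
      qed
      have fin': "finite (insert U1 D)" using D(1) by simp
      have irr': "\<forall>W\<in>insert U1 D. W \<subseteq> U \<and> invariant_subspace G ?P ?a W \<and>
         irreducible_rep G (subspace_module ?P W) (subspace_action ?a W)"
      proof
        fix W assume "W \<in> insert U1 D"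
        then consider "W = U1" | "W \<in> D" by auto
        then show "W \<subseteq> U \<and> invariant_subspace G ?P ?a W \<and>
          irreducible_rep G (subspace_module ?P W) (subspace_action ?a W)"
        proof cases
          case 1
          then show ?thesis using U1 irr by simp
        next
          case 2
          then show ?thesis using D(2)[OF 2] U'U by blast
        qed
      qed
      show ?thesis using fin' irr' ballI[of U, OF ex1] by (intro exI[of _ "insert U1 D"] conjI)
    qed
  qed
  note dec = this
  have "invariant_subspace G ?P ?a (carrier ?P)"
    using linear_maps_closed[OF lin] P.carrier_is_submodule by (auto simp: invariant_subspace_def)
  from dec[OF this] obtain D where "finite D" "\<forall>W\<in>D. W \<subseteq> carrier ?P \<and> invariant_subspace G ?P ?a W \<and>
         irreducible_rep G (subspace_module ?P W) (subspace_action ?a W)"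
      "\<forall>v\<in>carrier ?P. \<exists>!c. c \<in> (\<Pi>\<^sub>E W\<in>D. W) \<and> v = (\<Oplus>\<^bsub>?P\<^esub>W\<in>D. c W)"
    by (elim exE conjE) (rule that)
  then have "irreducible_decomposition G ?P ?a D" unfolding irreducible_decomposition_def by simp
  then show ?thesis ..
qed

section \<open>Kernels adapted to a preorder\<close>

text \<open>Moebius inversion for a finite preorder, with no choice of class representatives: induct
  on a down set \<open>D\<close> outside which \<open>f\<close> vanishes, and peel off a maximal
  equivalence class each time.\<close>

lemma sum_of_down_sets:
  fixes f :: "'q \<Rightarrow> complex"
  assumes fin: "finite Q"
    and refl: "\<And>a. a \<in> Q \<Longrightarrow> leq a a"
    and trans: "\<And>a b c. \<lbrakk>a \<in> Q; b \<in> Q; c \<in> Q; leq a b; leq b c\<rbrakk> \<Longrightarrow> leq a c"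
    and const: "\<And>a b. \<lbrakk>a \<in> Q; b \<in> Q; leq a b; leq b a\<rbrakk> \<Longrightarrow> f a = f b"
  shows "\<exists>c. \<forall>a\<in>Q. f a = (\<Sum>b\<in>Q. if leq a b then c b else 0)"
proof -
  have "\<exists>c. \<forall>a\<in>Q. f a = (\<Sum>b\<in>Q. if leq a b then c b else 0)"
    if "D \<subseteq> Q" "\<And>a b. \<lbrakk>a \<in> D; b \<in> Q; leq b a\<rbrakk> \<Longrightarrow> b \<in> D" "\<And>a. a \<in> Q \<Longrightarrow> a \<notin> D \<Longrightarrow> f a = 0"
      "\<And>a b. \<lbrakk>a \<in> Q; b \<in> Q; leq a b; leq b a\<rbrakk> \<Longrightarrow> f a = f b"
    for D and f :: "'q \<Rightarrow> complex"
    using that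
  proof (induction "card D" arbitrary: D f rule: less_induct)
    case less
    have finD: "finite D" using less.prems(1) fin finite_subset by auto
    show ?case
    proof (cases "D = {}")
      case True
      then have "f a = 0" if "a \<in> Q" for a
        using less.prems(3)[OF that] by simp
      then show ?thesis by (intro exI[of _ "\<lambda>_. 0"]) simp
    next
      case False
      \<comment> \<open>An element of \<open>D\<close> with the most elements below it is maximal up
        to equivalence: anything above it has a larger down set, and equal size forces equal down
        sets.\<close>
      define N where "N a = card {b\<in>Q. leq b a}" for a
      have "Max (N ` D) \<in> N ` D" using finD False by simp
      then obtain m where m: "m \<in> D" "N m = Max (N ` D)" by force
      have mX: "m \<in> Q" using m less.prems(1) by auto
      have max: "leq a m" if a: "a \<in> D" "leq m a" for a
      proof -
        have aX: "a \<in> Q" using a less.prems(1) by auto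
        have "{b\<in>Q. leq b m} \<subseteq> {b\<in>Q. leq b a}" using trans[OF _ mX aX _ a(2)] by blast
        moreover have "N a \<le> N m" unfolding m(2) using finD a by simp
        ultimately have "{b\<in>Q. leq b m} = {b\<in>Q. leq b a}"
          using fin unfolding N_def by (intro card_seteq) auto
        then show ?thesis using refl[OF aX] aX by blast
      qed
      define D' where "D' = {a\<in>D. \<not> (leq a m \<and> leq m a)}"
      \<comment> \<open>Subtracting \<open>f m\<close> on everything below \<open>m\<close> clears
        the whole class of \<open>m\<close>. It changes \<open>f\<close> only inside
        \<open>D\<close>, since \<open>D\<close> is a down set; so \<open>f'\<close> vanishes
        outside \<open>D'\<close>.\<close>
      define f' where "f' a = f a - (if leq a m then f m else 0)" for a
      have "D' \<subset> D" using m refl[OF mX] by (auto simp: D'_def)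
      then have card: "card D' < card D" using finD by (rule psubset_card_mono[rotated])
      have 1: "D' \<subseteq> Q" using less.prems(1) by (auto simp: D'_def)
      have 2: "b \<in> D'" if "a \<in> D'" "b \<in> Q" "leq b a" for a b
      proof -
        have aX: "a \<in> Q" using that 1 by auto
        have "b \<in> D" using less.prems(2)[of a b] that by (auto simp: D'_def)
        moreover have "\<not> (leq b m \<and> leq m b)"
          using trans[OF mX that(2) aX _ that(3)] max[of a] that(1) by (auto simp: D'_def)
        ultimately show ?thesis by (simp add: D'_def)
      qed
      have 3: "f' a = 0" if "a \<in> Q" "a \<notin> D'" for a
      proof (cases "a \<in> D")
        case True
        then show ?thesis using that less.prems(4)[OF that(1) mX] by (auto simp: D'_def f'_def)
      next
        case False
        then show ?thesis using that less.prems(2)[OF m(1) that(1)] less.prems(3) by (auto simp: f'_def)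
      qed
      have 4: "f' a = f' b" if "a \<in> Q" "b \<in> Q" "leq a b" "leq b a" for a b
        using that less.prems(4)[OF that] trans[OF that(1,2) mX that(3)] trans[OF that(2,1) mX that(4)]
        by (auto simp: f'_def)
      have "\<exists>c. \<forall>a\<in>Q. f' a = (\<Sum>b\<in>Q. if leq a b then c b else 0)"
        by (rule less.hyps[OF card 1]) (fact 2 3 4)+
      then obtain c where c: "\<forall>a\<in>Q. f' a = (\<Sum>b\<in>Q. if leq a b then c b else 0)" ..
      have "f a = (\<Sum>b\<in>Q. if leq a b then (c b + (if b = m then f m else 0)) else 0)" if a: "a \<in> Q" for a
      proof -
        have "(\<Sum>b\<in>Q. if leq a b then (c b + (if b = m then f m else 0)) else 0)
          = (\<Sum>b\<in>Q. (if leq a b then c b else 0) + (if b = m then (if leq a m then f m else 0) else 0))"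
          by (intro sum.cong) auto
        also have "\<dots> = f' a + (if leq a m then f m else 0)"
          using a c mX fin by (simp add: sum.distrib)
        finally show ?thesis by (simp add: f'_def)
      qed
      then show ?thesis by (intro exI ballI)
    qed
  qed
  note gen = this
  show ?thesis
  proof (rule gen[of Q f])
    show "f a = f b" if "a \<in> Q" "b \<in> Q" "leq a b" "leq b a" for a b using const that .
  qed auto
qed

text \<open>Both kernels expand into indicators of principal down sets. By bilinearity the claim
  reduces to two such indicators, whose convolution at \<open>(x, z)\<close> is the number of middle
  points in \<open>count\<close>.\<close>

lemma kernels_commute:
  fixes K L :: "'x \<Rightarrow> 'x \<Rightarrow> complex" and leq :: "'x \<times> 'x \<Rightarrow> 'x \<times> 'x \<Rightarrow> bool"
  assumes fin: "finite E"
    and refl: "\<And>a. a \<in> E \<times> E \<Longrightarrow> leq a a"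
    and trans: "\<And>a b c. \<lbrakk>a \<in> E \<times> E; b \<in> E \<times> E; c \<in> E \<times> E; leq a b; leq b c\<rbrakk> \<Longrightarrow> leq a c"
    and count: "\<And>a b x z. \<lbrakk>a \<in> E \<times> E; b \<in> E \<times> E; x \<in> E; z \<in> E\<rbrakk> \<Longrightarrow>
      card {y\<in>E. leq (x, y) a \<and> leq (y, z) b} = card {y\<in>E. leq (x, y) b \<and> leq (y, z) a}"
    and K: "\<And>x y x' y'. \<lbrakk>x \<in> E; y \<in> E; x' \<in> E; y' \<in> E; leq (x, y) (x', y'); leq (x', y') (x, y)\<rbrakk> \<Longrightarrow> K x y = K x' y'"
    and L: "\<And>x y x' y'. \<lbrakk>x \<in> E; y \<in> E; x' \<in> E; y' \<in> E; leq (x, y) (x', y'); leq (x', y') (x, y)\<rbrakk> \<Longrightarrow> L x y = L x' y'"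
    and xz: "x \<in> E" "z \<in> E"
  shows "(\<Sum>y\<in>E. K x y * L y z) = (\<Sum>y\<in>E. L x y * K y z)"
proof -
  let ?Q = "E \<times> E"
  have finX: "finite ?Q" using fin by simp
  have "\<exists>c. \<forall>a\<in>?Q. case_prod K a = (\<Sum>b\<in>?Q. if leq a b then c b else 0)"
    by (rule sum_of_down_sets[OF finX refl trans]) (use K in auto)
  then obtain c where c: "\<And>a. a \<in> ?Q \<Longrightarrow> case_prod K a = (\<Sum>b\<in>?Q. if leq a b then c b else 0)"
    by blast
  have "\<exists>c. \<forall>a\<in>?Q. case_prod L a = (\<Sum>b\<in>?Q. if leq a b then c b else 0)"
    by (rule sum_of_down_sets[OF finX refl trans]) (use L in auto)
  then obtain d where d: "\<And>a. a \<in> ?Q \<Longrightarrow> case_prod L a = (\<Sum>b\<in>?Q. if leq a b then d b else 0)"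
    by blast
  have expand: "(\<Sum>y\<in>E. K x y * L y z) =
      (\<Sum>a\<in>?Q. \<Sum>b\<in>?Q. c a * d b * of_nat (card {y\<in>E. leq (x, y) a \<and> leq (y, z) b}))"
    if c: "\<And>a. a \<in> ?Q \<Longrightarrow> case_prod K a = (\<Sum>b\<in>?Q. if leq a b then c b else 0)"
      and d: "\<And>a. a \<in> ?Q \<Longrightarrow> case_prod L a = (\<Sum>b\<in>?Q. if leq a b then d b else 0)"
    for K L :: "'x \<Rightarrow> 'x \<Rightarrow> complex" and c d
  proof -
    have "(\<Sum>y\<in>E. K x y * L y z) =
        (\<Sum>y\<in>E. \<Sum>a\<in>?Q. \<Sum>b\<in>?Q. c a * d b * (if leq (x, y) a \<and> leq (y, z) b then 1 else 0))"
    proof (rule sum.cong[OF HOL.refl])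
      fix y assume "y \<in> E"
      then have "K x y * L y z = (\<Sum>a\<in>?Q. if leq (x, y) a then c a else 0) * (\<Sum>b\<in>?Q. if leq (y, z) b then d b else 0)"
        using c[of "(x, y)"] d[of "(y, z)"] xz by simp
      also have "\<dots> = (\<Sum>a\<in>?Q. \<Sum>b\<in>?Q. c a * d b * (if leq (x, y) a \<and> leq (y, z) b then 1 else 0))"
        unfolding sum_product by (intro sum.cong) auto
      finally show "K x y * L y z = \<dots>" .
    qed
    also have "\<dots> = (\<Sum>a\<in>?Q. \<Sum>b\<in>?Q. \<Sum>y\<in>E. c a * d b * (if leq (x, y) a \<and> leq (y, z) b then 1 else 0))"
      by (subst sum.swap, intro sum.cong[OF HOL.refl], rule sum.swap)
    also have "\<dots> = (\<Sum>a\<in>?Q. \<Sum>b\<in>?Q. c a * d b * of_nat (card {y\<in>E. leq (x, y) a \<and> leq (y, z) b}))"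
    proof (intro sum.cong[OF HOL.refl])
      fix a b
      have "(\<Sum>y\<in>E. c a * d b * (if leq (x, y) a \<and> leq (y, z) b then 1 else 0))
        = c a * d b * (\<Sum>y\<in>E. if leq (x, y) a \<and> leq (y, z) b then 1 else 0)"
        by (simp only: sum_distrib_left)
      also have "(\<Sum>y\<in>E. if leq (x, y) a \<and> leq (y, z) b then 1 else 0) =
          (of_nat (card {y\<in>E. leq (x, y) a \<and> leq (y, z) b}) :: complex)"
        by (simp add: fin flip: sum.inter_filter)
      finally show "(\<Sum>y\<in>E. c a * d b * (if leq (x, y) a \<and> leq (y, z) b then 1 else 0)) =
        c a * d b * of_nat (card {y\<in>E. leq (x, y) a \<and> leq (y, z) b})" .
    qed
    finally show ?thesis .
  qed
  have "(\<Sum>y\<in>E. K x y * L y z) =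
      (\<Sum>a\<in>?Q. \<Sum>b\<in>?Q. c a * d b * of_nat (card {y\<in>E. leq (x, y) a \<and> leq (y, z) b}))"
    by (rule expand[OF c d])
  also have "\<dots> = (\<Sum>a\<in>?Q. \<Sum>b\<in>?Q. c a * d b * of_nat (card {y\<in>E. leq (x, y) b \<and> leq (y, z) a}))"
    using count[OF _ _ xz] by (intro sum.cong[OF HOL.refl]) simp
  also have "\<dots> = (\<Sum>b\<in>?Q. \<Sum>a\<in>?Q. d b * c a * of_nat (card {y\<in>E. leq (x, y) b \<and> leq (y, z) a}))"
    by (subst sum.swap) (simp only: mult.commute[of "c _" "d _"])
  also have "\<dots> = (\<Sum>y\<in>E. L x y * K y z)"
    by (rule expand[OF d c, symmetric])
  finally show ?thesis .
qed

section \<open>Cyclic modules over a discrete valuation ring\<close>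

text \<open>The valuation ring enters the rest of the proof through elementwise divisibility by
  \<open>p\<close>. Finiteness of the residue field makes all quotients by powers of
  \<open>p\<close> finite.\<close>

locale local_uniformizer = domain R for R (structure) +
  fixes p
  assumes p_closed [simp]: "p \<in> carrier R"
    and p_not_zero: "p \<noteq> \<zero>"
    and p_not_unit: "p \<notin> Units R"
    and unit_or_multiple: "r \<in> carrier R \<Longrightarrow> r \<in> Units R \<or> (\<exists>s\<in>carrier R. r = p \<otimes> s)"
    and finite_residue_field: "finite (carrier (R Quot (PIdl p)))"

text \<open>A nonzero nonunit has an irreducible divisor \<open>b\<close>. The ideal of
  \<open>b\<close> is maximal, so it is the unique nonzero prime ideal, which is also the ideal of
  \<open>p\<close>.\<close>

lemma local_uniformizerI:
  fixes R (structure)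
  assumes dvr: "discrete_valuation_ring R" and p: "uniformizer R p"
    and fin: "finite (carrier (R Quot (PIdl\<^bsub>R\<^esub> p)))"
  shows "local_uniformizer R p"
proof -
  interpret principal_domain R using dvr by (simp add: discrete_valuation_ring_def)
  have pc: "p \<in> carrier R" and max: "maximalideal (PIdl p) R" using p by (auto simp: uniformizer_def)
  obtain P where P: "primeideal P R" "P \<noteq> {\<zero>}" and uniq: "\<And>Q. primeideal Q R \<Longrightarrow> Q \<noteq> {\<zero>} \<Longrightarrow> Q = P"
    using dvr by (auto simp: discrete_valuation_ring_def)
  have prime: "primeideal (PIdl p) R" by (rule maximalideal_prime[OF max])
  have PI0: "PIdl p = {\<zero>} \<longleftrightarrow> p = \<zero>" using pc cgenideal_self[OF pc] by (auto simp: cgenideal_def)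
  have p0: "p \<noteq> \<zero>"
  \<comment> \<open>If \<open>p\<close> were zero, the zero ideal would be maximal, which leaves no
    room for the nonzero prime ideal \<open>P\<close>.\<close>
  proof
    assume "p = \<zero>"
    then have "maximalideal {\<zero>} R" using max PI0 by simp
    moreover have "ideal P R" "{\<zero>} \<subseteq> P" "P \<subseteq> carrier R" "P \<noteq> carrier R"
      using P(1) by (auto simp: primeideal_def primeideal_axioms_def ideal.axioms additive_subgroup.zero_closed
          dest: ideal.Icarr)
    ultimately show False using P(2) maximalideal.I_maximal[of "{\<zero>}" R P] by auto
  qed
  have pP: "PIdl p = P" using uniq[OF prime] PI0 p0 by simp
  have pu: "p \<notin> Units R"
  proof
    assume "p \<in> Units R"
    then have "\<one> \<in> PIdl p" using pc unfolding cgenideal_def by (auto intro!: exI[of _ "inv p"])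
    then have "PIdl p = carrier R" by (rule ideal.one_imp_carrier[OF cgenideal_ideal[OF pc]])
    then show False using maximalideal.I_notcarr[OF max] by simp
  qed
  have "r \<in> Units R \<or> (\<exists>s\<in>carrier R. r = p \<otimes> s)" if r: "r \<in> carrier R" for r
  proof (cases "r = \<zero> \<or> r \<in> Units R")
    case True
    then show ?thesis using pc by (auto intro!: bexI[of _ \<zero>])
  next
    case False
    then have "r \<in> carrier R - {\<zero>}" "r \<notin> Units R" using r by auto
    then obtain b where b: "b \<in> carrier R" "ring_irreducible b" "b divides r"
      by (rule exists_irreducible_divisor)
    then have "primeideal (PIdl b) R" using maximalideal_prime[OF irreducible_imp_maximalideal] by blast
    moreover have "PIdl b \<noteq> {\<zero>}" using cgenideal_self[OF b(1)] b(2) by (auto simp: ring_irreducible_def)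
    ultimately have "PIdl b = PIdl p" using uniq pP by simp
    then obtain s where s: "s \<in> carrier R" "b = s \<otimes> p" using cgenideal_self[OF b(1)] by (auto simp: cgenideal_def)
    obtain t where t: "t \<in> carrier R" "r = b \<otimes> t" using b(3) by (auto simp: factor_def)
    have "r = p \<otimes> (s \<otimes> t)" using s t pc by algebra
    then show ?thesis using s t by auto
  qed
  then show ?thesis
    using pc p0 pu fin by unfold_locales auto
qed

context local_uniformizer
begin

abbreviation cyc :: "nat \<Rightarrow> ('a, 'a set) module" where
  "cyc l \<equiv> quotient_module R (PIdl (p [^] l))"

definition gen :: "nat \<Rightarrow> 'a set" where
  "gen l = PIdl (p [^] l) +> \<one>"

lemma p_pow_closed [simp]: "p [^] (l::nat) \<in> carrier R"
  by simp

lemma ideal_pow: "ideal (PIdl (p [^] (l::nat))) R"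
  by (rule cgenideal_ideal) simp

lemma cyc_module: "module R (cyc l)"
  by (rule quotient_module_is_module[OF is_cring ideal_pow])

lemma gen_closed [simp]: "gen l \<in> carrier (cyc l)"
  by (auto simp: gen_def quotient_module_def FactRing_def A_RCOSETS_def' a_r_coset_def' simp del: One_nat_def)

lemma smult_gen:
  assumes "r \<in> carrier R"
  shows "r \<odot>\<^bsub>cyc l\<^esub> gen l = PIdl (p [^] l) +> r"
  using assms ideal.rcoset_mult_add[OF ideal_pow, of r "\<one>" l]
  by (simp add: gen_def quotient_module_def FactRing_def)

lemma cyc_generated:
  assumes "x \<in> carrier (cyc l)"
  obtains r where "r \<in> carrier R" "x = r \<odot>\<^bsub>cyc l\<^esub> gen l"
proof -
  obtain r where "r \<in> carrier R" "x = PIdl (p [^] l) +> r"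
    using assms unfolding quotient_module_def FactRing_def A_RCOSETS_def' by auto
  then show thesis using that[of r] smult_gen[of r l] by simp
qed

lemma smult_gen_eq_0_iff:
  assumes "r \<in> carrier R"
  shows "r \<odot>\<^bsub>cyc l\<^esub> gen l = \<zero>\<^bsub>cyc l\<^esub> \<longleftrightarrow> (\<exists>s\<in>carrier R. r = p [^] l \<otimes> s)"
proof -
  interpret I: ideal "PIdl (p [^] l)" R by (rule ideal_pow)
  have "r \<odot>\<^bsub>cyc l\<^esub> gen l = \<zero>\<^bsub>cyc l\<^esub> \<longleftrightarrow> PIdl (p [^] l) +> r = PIdl (p [^] l)"
    unfolding smult_gen[OF assms] by (simp add: quotient_module_def FactRing_def)
  also have "\<dots> \<longleftrightarrow> r \<in> PIdl (p [^] l)"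
    using assms I.a_rcos_const I.a_rcos_self by metis
  also have "\<dots> \<longleftrightarrow> (\<exists>s\<in>carrier R. r = p [^] l \<otimes> s)"
    unfolding cgenideal_def using m_comm[OF p_pow_closed[of l]] by auto
  finally show ?thesis .
qed

text \<open>The valuation of \<open>r\<close>, truncated at \<open>l\<close>. This is enough inside
  the quotient by \<open>p^l\<close> and avoids elements divisible by all powers of
  \<open>p\<close>.\<close>

lemma power_unit_decomposition:
  assumes "r \<in> carrier R"
  shows "(\<exists>s\<in>carrier R. r = p [^] (l::nat) \<otimes> s) \<or> (\<exists>u\<in>Units R. \<exists>k<l. r = p [^] k \<otimes> u)"
proof (induction l)
  case 0
  then show ?case using assms by auto
next
  case (Suc l)
  show ?case
  proof (cases "\<exists>u\<in>Units R. \<exists>k<l. r = p [^] k \<otimes> u")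
    case True
    then show ?thesis using less_SucI by blast
  next
    case False
    then obtain s where s: "s \<in> carrier R" "r = p [^] l \<otimes> s" using Suc by auto
    from unit_or_multiple[OF s(1)] show ?thesis
    proof
      assume "s \<in> Units R"
      then show ?thesis using s by blast
    next
      assume "\<exists>t\<in>carrier R. s = p \<otimes> t"
      then obtain t where t: "t \<in> carrier R" "s = p \<otimes> t" by auto
      then have "r = p [^] Suc l \<otimes> t" using s by (simp add: m_assoc)
      then show ?thesis using t by blast
    qed
  qed
qed

lemma unit_not_multiple:
  assumes "s \<in> carrier R" shows "p \<otimes> s \<notin> Units R"
  using unit_factor[of p s] assms p_not_unit by auto

lemma one_minus_multiple_unit:
  assumes "r \<in> carrier R" shows "\<one> \<ominus> p \<otimes> r \<in> Units R"
proof (rule ccontr)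
  assume "\<one> \<ominus> p \<otimes> r \<notin> Units R"
  then obtain s where s: "s \<in> carrier R" "\<one> \<ominus> p \<otimes> r = p \<otimes> s"
    using unit_or_multiple[of "\<one> \<ominus> p \<otimes> r"] assms by auto
  have "\<one> = p \<otimes> r \<oplus> (\<one> \<ominus> p \<otimes> r)" using assms p_closed by algebra
  also have "\<dots> = p \<otimes> (r \<oplus> s)" unfolding s(2) using assms s p_closed by algebra
  finally have eq: "\<one> = p \<otimes> (r \<oplus> s)" .
  have "p \<otimes> (r \<oplus> s) \<in> Units R" by (simp flip: eq)
  then show False using unit_not_multiple[of "r \<oplus> s"] assms s by auto
qed

lemma p_pow_nonzero: "p [^] (k::nat) \<noteq> \<zero>"
  by (induction k) (auto simp: integral_iff p_not_zero)

lemma p_pow_add: "p [^] (k + l :: nat) = p [^] k \<otimes> p [^] l"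
  by (simp add: nat_pow_mult)

lemma power_unit_eq_power_multiple:
  assumes "u \<in> Units R" "s \<in> carrier R" "p [^] k \<otimes> u = p [^] l \<otimes> s"
  shows "l \<le> (k::nat)"
proof (rule ccontr)
  assume "\<not> l \<le> k"
  then obtain m where m: "l = k + Suc m" by (metis less_imp_Suc_add not_le add_Suc_right)
  have "p [^] k \<otimes> u = p [^] k \<otimes> (p \<otimes> (p [^] m \<otimes> s))"
    using assms unfolding m p_pow_add by (simp add: m_assoc m_lcomm m_comm)
  then have "u = p \<otimes> (p [^] m \<otimes> s)"
    using assms p_pow_nonzero[of k] by (subst (asm) m_lcancel) auto
  then show False using unit_not_multiple[of "p [^] m \<otimes> s"] assms by auto
qed

section \<open>Chain structure, homomorphisms, socle and finiteness of the modules R/p^l\<close>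

lemma cyc_cases:
  assumes x: "x \<in> carrier (cyc l)"
  obtains "x = \<zero>\<^bsub>cyc l\<^esub>"
  | u k where "u \<in> Units R" "k < l" "x = (p [^] k \<otimes> u) \<odot>\<^bsub>cyc l\<^esub> gen l"
proof -
  obtain r where r: "r \<in> carrier R" "x = r \<odot>\<^bsub>cyc l\<^esub> gen l" using x by (rule cyc_generated)
  from power_unit_decomposition[OF r(1), of l] show thesis
  proof
    assume "\<exists>s\<in>carrier R. r = p [^] l \<otimes> s"
    then show thesis using that(1) r smult_gen_eq_0_iff by auto
  next
    assume "\<exists>u\<in>Units R. \<exists>k<l. r = p [^] k \<otimes> u"
    then show thesis using that(2) r by auto
  qed
qed

text \<open>Compare the exponents of \<open>p\<close> in \<open>x\<close> and \<open>y\<close>. The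
  factor \<open>p\<close> in the second alternative records strictness; the later arguments modulo
  \<open>p\<close> live on it.\<close>

lemma cyc_comparable:
  assumes x: "x \<in> carrier (cyc l)" and y: "y \<in> carrier (cyc l)"
  shows "(\<exists>r\<in>carrier R. x = r \<odot>\<^bsub>cyc l\<^esub> y) \<or> (\<exists>r\<in>carrier R. y = (p \<otimes> r) \<odot>\<^bsub>cyc l\<^esub> x)"
proof -
  interpret N: Module.module R "cyc l" by (rule cyc_module)
  show ?thesis using x
  proof (cases rule: cyc_cases)
    case 1
    then show ?thesis using y by (auto intro!: bexI[of _ \<zero>])
  next
    case (2 u k)
    note x' = 2
    show ?thesis using y
    proof (cases rule: cyc_cases)
      case 1
      then show ?thesis using x by (intro disjI2 bexI[of _ \<zero>]) auto
    next
      case (2 v j)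
      have *: "(p [^] a \<otimes> (u' \<otimes> inv v')) \<odot>\<^bsub>cyc l\<^esub> ((p [^] b \<otimes> v') \<odot>\<^bsub>cyc l\<^esub> gen l)
        = (p [^] (a + b) \<otimes> u') \<odot>\<^bsub>cyc l\<^esub> gen l" if "u' \<in> Units R" "v' \<in> Units R" for a b :: nat and u' v'
      proof -
        have "p [^] a \<otimes> (u' \<otimes> inv v') \<otimes> (p [^] b \<otimes> v') = p [^] a \<otimes> p [^] b \<otimes> u' \<otimes> (inv v' \<otimes> v')"
          using that p_pow_closed[of a] p_pow_closed[of b] Units_closed[OF that(1)] Units_closed[OF that(2)]
            Units_inv_closed[OF that(2)] by algebra
        also have "\<dots> = p [^] (a + b) \<otimes> u'" using that Units_closed[OF that(1)] by (simp add: p_pow_add)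
        finally show ?thesis using Units_closed[OF that(1)] Units_closed[OF that(2)] Units_inv_closed[OF that(2)]
          by (simp flip: N.smult_assoc1)
      qed
      show ?thesis
      proof (cases "j \<le> k")
        case True
        then have "x = (p [^] (k - j) \<otimes> (u \<otimes> inv v)) \<odot>\<^bsub>cyc l\<^esub> y"
          unfolding x'(3) 2(3) using x'(1) 2(1) by (subst *) simp_all
        then show ?thesis using x' 2 by (intro disjI1 bexI) auto
      next
        case False
        then obtain m where m: "j = Suc m + k" by (metis less_imp_Suc_add not_le add.commute add_Suc_right)
        have "y = (p [^] Suc m \<otimes> (v \<otimes> inv u)) \<odot>\<^bsub>cyc l\<^esub> x"
          unfolding x'(3) 2(3) using x'(1) 2(1) m by (subst *) simp_all
        moreover have "p [^] Suc m \<otimes> (v \<otimes> inv u) = p \<otimes> (p [^] m \<otimes> (v \<otimes> inv u))"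
          using x'(1) 2(1)
          by (simp only: nat_pow_Suc2 p_closed m_assoc p_pow_closed m_closed Units_closed Units_inv_closed)
        ultimately show ?thesis using x' 2 by (intro disjI2 bexI[of _ "p [^] m \<otimes> (v \<otimes> inv u)"]) auto
      qed
    qed
  qed
qed

text \<open>The universal property of a cyclic module. The choice of a coefficient \<open>r\<close>
  in \<open>f\<close> is harmless: two choices differ by a multiple of \<open>p^l\<close>, which
  kills \<open>y\<close>.\<close>

lemma cyc_hom:
  assumes M: "module R M" and y: "y \<in> carrier M" "p [^] l \<odot>\<^bsub>M\<^esub> y = \<zero>\<^bsub>M\<^esub>"
  obtains f where "f \<in> linear_maps R (cyc l) M"
    "\<And>r. r \<in> carrier R \<Longrightarrow> f (r \<odot>\<^bsub>cyc l\<^esub> gen l) = r \<odot>\<^bsub>M\<^esub> y"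
proof -
  interpret N: Module.module R "cyc l" by (rule cyc_module)
  interpret M: Module.module R M by (rule M)
  define f where "f x = (SOME r. r \<in> carrier R \<and> x = r \<odot>\<^bsub>cyc l\<^esub> gen l) \<odot>\<^bsub>M\<^esub> y" for x
  have f: "f (r \<odot>\<^bsub>cyc l\<^esub> gen l) = r \<odot>\<^bsub>M\<^esub> y" if r: "r \<in> carrier R" for r
  proof -
    define s where "s = (SOME s. s \<in> carrier R \<and> r \<odot>\<^bsub>cyc l\<^esub> gen l = s \<odot>\<^bsub>cyc l\<^esub> gen l)"
    have s: "s \<in> carrier R" "r \<odot>\<^bsub>cyc l\<^esub> gen l = s \<odot>\<^bsub>cyc l\<^esub> gen l"
      using someI[of "\<lambda>s. s \<in> carrier R \<and> r \<odot>\<^bsub>cyc l\<^esub> gen l = s \<odot>\<^bsub>cyc l\<^esub> gen l" r] r by (auto simp: s_def)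
    have "(r \<ominus> s) \<odot>\<^bsub>cyc l\<^esub> gen l = \<zero>\<^bsub>cyc l\<^esub>"
      using r s by (simp add: a_minus_def N.smult_l_distr N.smult_l_minus N.M.r_neg)
    then obtain t where t: "t \<in> carrier R" "r \<ominus> s = p [^] l \<otimes> t"
      using smult_gen_eq_0_iff[of "r \<ominus> s" l] r s by auto
    have "r = s \<oplus> t \<otimes> p [^] l"
    proof -
      have "r = s \<oplus> (r \<ominus> s)" using r s by algebra
      then show ?thesis using t by (simp add: m_comm)
    qed
    then have "r \<odot>\<^bsub>M\<^esub> y = s \<odot>\<^bsub>M\<^esub> y" using s t y by (simp add: M.smult_l_distr M.smult_assoc1)
    then show ?thesis by (simp add: f_def s_def)
  qed
  have "f \<in> linear_maps R (cyc l) M"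
  proof (rule linear_mapsI)
    fix x assume "x \<in> carrier (cyc l)"
    then obtain r where "r \<in> carrier R" "x = r \<odot>\<^bsub>cyc l\<^esub> gen l" by (rule cyc_generated)
    then show "f x \<in> carrier M" using f y by simp
  next
    fix x x' assume "x \<in> carrier (cyc l)" "x' \<in> carrier (cyc l)"
    then obtain r r' where r: "r \<in> carrier R" "x = r \<odot>\<^bsub>cyc l\<^esub> gen l" "r' \<in> carrier R" "x' = r' \<odot>\<^bsub>cyc l\<^esub> gen l"
      by (meson cyc_generated)
    then have "x \<oplus>\<^bsub>cyc l\<^esub> x' = (r \<oplus> r') \<odot>\<^bsub>cyc l\<^esub> gen l" by (simp add: N.smult_l_distr)
    then have "f (x \<oplus>\<^bsub>cyc l\<^esub> x') = (r \<oplus> r') \<odot>\<^bsub>M\<^esub> y" using f[of "r \<oplus> r'"] r by simp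
    then show "f (x \<oplus>\<^bsub>cyc l\<^esub> x') = f x \<oplus>\<^bsub>M\<^esub> f x'"
      using f[of r] f[of r'] r y by (simp add: M.smult_l_distr)
  next
    fix s x assume s: "s \<in> carrier R" "x \<in> carrier (cyc l)"
    then obtain r where r: "r \<in> carrier R" "x = r \<odot>\<^bsub>cyc l\<^esub> gen l" by (meson cyc_generated)
    then have "s \<odot>\<^bsub>cyc l\<^esub> x = (s \<otimes> r) \<odot>\<^bsub>cyc l\<^esub> gen l" using s by (simp add: N.smult_assoc1)
    then have "f (s \<odot>\<^bsub>cyc l\<^esub> x) = (s \<otimes> r) \<odot>\<^bsub>M\<^esub> y" using f[of "s \<otimes> r"] r s by simp
    then show "f (s \<odot>\<^bsub>cyc l\<^esub> x) = s \<odot>\<^bsub>M\<^esub> f x"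
      using f[of r] r s y by (simp add: M.smult_assoc1)
  qed
  then show thesis using that f by blast
qed

lemma cyc_power_zero: 
  assumes "x \<in> carrier (cyc l)" "l \<le> m" shows "p [^] m \<odot>\<^bsub>cyc l\<^esub> x = \<zero>\<^bsub>cyc l\<^esub>"
proof -
  interpret N: Module.module R "cyc l" by (rule cyc_module)
  obtain r where r: "r \<in> carrier R" "x = r \<odot>\<^bsub>cyc l\<^esub> gen l" using assms(1) by (rule cyc_generated)
  have "p [^] m \<otimes> r = p [^] l \<otimes> (p [^] (m - l) \<otimes> r)"
    using p_pow_add[of l "m - l"] assms(2) r by (simp add: m_assoc)
  then have "(p [^] m \<otimes> r) \<odot>\<^bsub>cyc l\<^esub> gen l = \<zero>\<^bsub>cyc l\<^esub>"
    using smult_gen_eq_0_iff[of "p [^] m \<otimes> r" l] r by auto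
  then show ?thesis using r by (simp add: N.smult_assoc1)
qed

text \<open>If \<open>x\<close> has exact exponent \<open>k < l\<close> and \<open>p x = 0\<close>,
  then \<open>l \<le> k + 1\<close>. A nonzero \<open>x\<close> forces \<open>0 < l\<close>, so
  \<open>l - 1\<close> is not truncated.\<close>

lemma cyc_socle:
  assumes x: "x \<in> carrier (cyc l)" "x \<noteq> \<zero>\<^bsub>cyc l\<^esub>" "p \<odot>\<^bsub>cyc l\<^esub> x = \<zero>\<^bsub>cyc l\<^esub>"
  obtains u where "u \<in> Units R" "0 < l" "x = (p [^] (l - 1) \<otimes> u) \<odot>\<^bsub>cyc l\<^esub> gen l"
proof -
  interpret N: Module.module R "cyc l" by (rule cyc_module)
  show thesis using x(1)
  proof (cases rule: cyc_cases)
    case (2 u k)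
    have "p [^] Suc k \<otimes> u = p \<otimes> (p [^] k \<otimes> u)"
      using 2 by (simp only: nat_pow_Suc2 p_closed m_assoc p_pow_closed Units_closed)
    then have "(p [^] Suc k \<otimes> u) \<odot>\<^bsub>cyc l\<^esub> gen l = p \<odot>\<^bsub>cyc l\<^esub> x"
      using 2 N.smult_assoc1[of p "p [^] k \<otimes> u" "gen l"] by (simp add: Units_closed)
    then obtain s where "s \<in> carrier R" "p [^] Suc k \<otimes> u = p [^] l \<otimes> s"
      using x(3) smult_gen_eq_0_iff[of "p [^] Suc k \<otimes> u" l] Units_closed[OF 2(1)] by auto
    then have "l \<le> Suc k" using power_unit_eq_power_multiple[OF 2(1)] by blast
    then have "k = l - 1" using 2 by simp
    then show thesis using that[of u] 2 by auto
  qed (use x in auto)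
qed

text \<open>Expansion in powers of \<open>p\<close> with digits in a finite set \<open>A\<close> of
  representatives of the residue field: finitely many sums of \<open>l\<close> terms represent
  everything modulo \<open>p^l\<close>.\<close>

lemma finite_cyc: "finite (carrier (cyc l))"
proof -
  interpret I: ideal "PIdl p" R by (rule cgenideal_ideal) simp
  define rep where "rep A = (SOME a. a \<in> carrier R \<and> A = PIdl p +> a)" for A
  have rep: "rep (PIdl p +> r) \<in> carrier R" "PIdl p +> r = PIdl p +> rep (PIdl p +> r)" if "r \<in> carrier R" for r
    using someI[of "\<lambda>a. a \<in> carrier R \<and> PIdl p +> r = PIdl p +> a" r] that by (auto simp: rep_def)
  define A where "A = rep ` carrier (R Quot (PIdl p))"
  have A: "finite A" "A \<subseteq> carrier R"
    using finite_residue_field rep by (auto simp: A_def FactRing_def A_RCOSETS_def')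
  have A_rep: "\<exists>a\<in>A. \<exists>s\<in>carrier R. r = a \<oplus> p \<otimes> s" if r: "r \<in> carrier R" for r
  proof -
    obtain a where a_def: "a = rep (PIdl p +> r)" by blast
    have a: "a \<in> carrier R" "r \<in> PIdl p +> a" using rep[OF r] I.a_rcos_self[OF r] by (auto simp: a_def)
    from a(2) obtain i where i: "i \<in> PIdl p" "r = i \<oplus> a" unfolding a_r_coset_def' by blast
    from i(1) obtain s where "s \<in> carrier R" "i = s \<otimes> p" unfolding cgenideal_def by blast
    then have s: "s \<in> carrier R" "r = s \<otimes> p \<oplus> a" using i(2) by auto
    then have "r = a \<oplus> p \<otimes> s" using a by (simp add: a_comm m_comm)
    moreover have "a \<in> A" unfolding a_def using r by (auto simp: A_def FactRing_def A_RCOSETS_def')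
    ultimately show ?thesis using s by blast
  qed
  have "\<exists>B. finite B \<and> B \<subseteq> carrier R \<and> (\<forall>r\<in>carrier R. \<exists>b\<in>B. \<exists>s\<in>carrier R. r = b \<oplus> p [^] l \<otimes> s)"
  proof (induction l)
    case 0
    show ?case by (rule exI[of _ "{\<zero>}"]) auto
  next
    case (Suc l)
    then obtain B where B: "finite B" "B \<subseteq> carrier R"
      "\<And>r. r \<in> carrier R \<Longrightarrow> \<exists>b\<in>B. \<exists>s\<in>carrier R. r = b \<oplus> p [^] l \<otimes> s" by auto
    let ?B = "(\<lambda>(b, a). b \<oplus> p [^] l \<otimes> a) ` (B \<times> A)"
    have "\<exists>b\<in>?B. \<exists>s\<in>carrier R. r = b \<oplus> p [^] Suc l \<otimes> s" if r: "r \<in> carrier R" for r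
    proof -
      obtain b s where b: "b \<in> B" "s \<in> carrier R" "r = b \<oplus> p [^] l \<otimes> s" using B(3)[OF r] by auto
      obtain a t where a: "a \<in> A" "t \<in> carrier R" "s = a \<oplus> p \<otimes> t" using A_rep[OF b(2)] by auto
      have "b \<in> carrier R" "a \<in> carrier R" using a b A B by auto
      then have "r = (b \<oplus> p [^] l \<otimes> a) \<oplus> p [^] Suc l \<otimes> t"
        unfolding b(3) a(3) using a(2) by (simp add: a_assoc m_assoc r_distr)
      then show ?thesis using a b by (intro bexI[of _ "b \<oplus> p [^] l \<otimes> a"] bexI[of _ t]) auto
    qed
    moreover have "finite ?B" using A B by auto
    moreover have "?B \<subseteq> carrier R" using subsetD[OF A(2)] subsetD[OF B(2)] by auto
    ultimately show ?case by blast
  qed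
  then obtain B where B: "finite B" "B \<subseteq> carrier R"
      "\<And>r. r \<in> carrier R \<Longrightarrow> \<exists>b\<in>B. \<exists>s\<in>carrier R. r = b \<oplus> p [^] l \<otimes> s" by auto
  interpret N: Module.module R "cyc l" by (rule cyc_module)
  have "carrier (cyc l) \<subseteq> (\<lambda>b. b \<odot>\<^bsub>cyc l\<^esub> gen l) ` B"
  proof
    fix x assume "x \<in> carrier (cyc l)"
    then obtain r where r: "r \<in> carrier R" "x = r \<odot>\<^bsub>cyc l\<^esub> gen l" by (rule cyc_generated)
    obtain b s where b: "b \<in> B" "s \<in> carrier R" "r = b \<oplus> p [^] l \<otimes> s" using B(3)[OF r(1)] by auto
    have "(p [^] l \<otimes> s) \<odot>\<^bsub>cyc l\<^esub> gen l = \<zero>\<^bsub>cyc l\<^esub>"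
      using b smult_gen_eq_0_iff[of "p [^] l \<otimes> s" l] by auto
    then have "x = b \<odot>\<^bsub>cyc l\<^esub> gen l" using r b B(2) by (auto simp: N.smult_l_distr)
    then show "x \<in> (\<lambda>b. b \<odot>\<^bsub>cyc l\<^esub> gen l) ` B" using b by blast
  qed
  then show ?thesis using B(1) finite_surj by blast
qed

end

section \<open>Finite products of cyclic modules\<close>

locale cyclic_product = local_uniformizer R p for R (structure) and p +
  fixes I :: "'i set" and len :: "'i \<Rightarrow> nat"
  assumes finite_I [simp]: "finite I"
begin

abbreviation M :: "('a, 'i \<Rightarrow> 'a set) module" where
  "M \<equiv> product_module I (\<lambda>c. cyc (len c))"

lemma M_module: "module R M"
  by (rule product_module_is_module[OF is_cring cyc_module])

interpretation N: Module.module R "cyc l" for l by (rule cyc_module)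
interpretation M: Module.module R M by (rule M_module)

lemma M_carrier: "x \<in> carrier M \<longleftrightarrow> x \<in> extensional I \<and> (\<forall>c\<in>I. x c \<in> carrier (cyc (len c)))"
  by (auto simp: product_module_def PiE_iff)

lemma M_comp:
  assumes "c \<in> I"
  shows "x \<in> carrier M \<Longrightarrow> x c \<in> carrier (cyc (len c))"
    and "\<zero>\<^bsub>M\<^esub> c = \<zero>\<^bsub>cyc (len c)\<^esub>"
    and "(x \<oplus>\<^bsub>M\<^esub> y) c = x c \<oplus>\<^bsub>cyc (len c)\<^esub> y c"
    and "(r \<odot>\<^bsub>M\<^esub> x) c = r \<odot>\<^bsub>cyc (len c)\<^esub> x c"
  using assms by (auto simp: product_module_def)

lemma M_eqI: "\<lbrakk>x \<in> carrier M; y \<in> carrier M; \<And>c. c \<in> I \<Longrightarrow> x c = y c\<rbrakk> \<Longrightarrow> x = y"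
  by (rule extensionalityI[of _ I]) (auto simp: M_carrier)

lemma finite_M: "finite (carrier M)"
  by (simp add: product_module_def finite_PiE finite_cyc)

lemma proj_linear: "c \<in> I \<Longrightarrow> (\<lambda>x. x c) \<in> linear_maps R M (cyc (len c))"
  by (rule linear_mapsI) (simp_all add: M_comp)

lemma M_minus: "c \<in> I \<Longrightarrow> x \<in> carrier M \<Longrightarrow> (\<ominus>\<^bsub>M\<^esub> x) c = \<ominus>\<^bsub>cyc (len c)\<^esub> x c"
  using linear_maps_minus[OF M_module cyc_module proj_linear] .

lemma tuple_linear:
  assumes "module R L" and f: "\<And>c. c \<in> I \<Longrightarrow> f c \<in> linear_maps R L (cyc (len c))"
  shows "(\<lambda>x. \<lambda>c\<in>I. f c x) \<in> linear_maps R L M"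
proof -
  interpret L: Module.module R L by fact
  have m: "(\<lambda>c\<in>I. f c x) \<in> carrier M" if "x \<in> carrier L" for x
    using linear_maps_closed[OF f that] by (simp add: M_carrier)
  show ?thesis
    by (rule linear_mapsI) (auto intro!: M_eqI m simp: m M_comp linear_mapsD[OF f])
qed

definition layer_proj :: "nat \<Rightarrow> ('i \<Rightarrow> 'a set) \<Rightarrow> 'i \<Rightarrow> 'a set" where
  "layer_proj l x = (\<lambda>c\<in>I. if len c = l then x c else \<zero>\<^bsub>cyc (len c)\<^esub>)"

lemma layer_proj_linear: "layer_proj l \<in> linear_maps R M M"
proof -
  have "(\<lambda>x. if len c = l then x c else \<zero>\<^bsub>cyc (len c)\<^esub>) \<in> linear_maps R M (cyc (len c))" if "c \<in> I" for c
    using proj_linear[OF that] linear_maps_zero_fun[OF M_module cyc_module] by (cases "len c = l") auto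
  then have "(\<lambda>x. \<lambda>c\<in>I. if len c = l then x c else \<zero>\<^bsub>cyc (len c)\<^esub>) \<in> linear_maps R M M"
    by (rule tuple_linear[OF M_module])
  then show ?thesis by (simp add: layer_proj_def[abs_def])
qed

definition inj_at :: "'i \<Rightarrow> 'a set \<Rightarrow> 'i \<Rightarrow> 'a set" where
  "inj_at c n = (\<lambda>c'\<in>I. if c' = c then n else \<zero>\<^bsub>cyc (len c')\<^esub>)"

lemma inj_at_linear: "inj_at c \<in> linear_maps R (cyc (len c)) M"
proof -
  have "(\<lambda>n. if c' = c then n else \<zero>\<^bsub>cyc (len c')\<^esub>) \<in> linear_maps R (cyc (len c)) (cyc (len c'))" for c'
    using linear_maps_id linear_maps_zero_fun[OF cyc_module cyc_module] by (cases "c' = c") auto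
  from tuple_linear[OF cyc_module this]
  have "(\<lambda>n. \<lambda>c'\<in>I. if c' = c then n else \<zero>\<^bsub>cyc (len c')\<^esub>) \<in> linear_maps R (cyc (len c)) M" .
  then show ?thesis by (simp add: inj_at_def[abs_def])
qed

lemma sum_of_components:
  assumes x: "x \<in> carrier M"
  shows "x = (\<Oplus>\<^bsub>M\<^esub>c\<in>I. inj_at c (x c))"
proof -
  have m: "(\<lambda>c. inj_at c (x c)) \<in> I \<rightarrow> carrier M"
    using linear_maps_closed[OF inj_at_linear] M_comp(1)[OF _ x] by auto
  have "x d = (\<Oplus>\<^bsub>M\<^esub>c\<in>I. inj_at c (x c)) d" if d: "d \<in> I" for d
  proof -
    have "(\<Oplus>\<^bsub>M\<^esub>c\<in>I. inj_at c (x c)) d = (\<Oplus>\<^bsub>cyc (len d)\<^esub>c\<in>I. inj_at c (x c) d)"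
      by (rule linear_maps_finsum[OF M_module cyc_module proj_linear[OF d] finite_I m])
    also have "\<dots> = (\<Oplus>\<^bsub>cyc (len d)\<^esub>c\<in>I. if d = c then x c else \<zero>\<^bsub>cyc (len d)\<^esub>)"
      using d M_comp(1)[OF d x] by (intro N.M.finsum_cong') (auto simp: inj_at_def)
    also have "\<dots> = (\<Oplus>\<^bsub>cyc (len d)\<^esub>c\<in>I. if d = c then x d else \<zero>\<^bsub>cyc (len d)\<^esub>)"
      using M_comp(1)[OF d x] by (intro N.M.finsum_cong') auto
    also have "\<dots> = x d" using d M_comp(1)[OF d x] by (intro N.M.finsum_singleton) auto
    finally show ?thesis by simp
  qed
  then show ?thesis using x m M.M.finsum_closed[OF m] by (intro M_eqI) auto
qed

subsection \<open>Tuples generating the same submodule are conjugate\<close>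

text \<open>This is the intersection of the socle with \<open>p^(l-1) M\<close>, hence stable under
  all endomorphisms although its definition refers to coordinates. The set \<open>socle_at l\<close>
  below is a complement of \<open>socle_from (Suc l)\<close> in it and is not stable in
  general.\<close>

definition socle_from :: "nat \<Rightarrow> ('i \<Rightarrow> 'a set) set" where
  "socle_from l = {k\<in>carrier M. p \<odot>\<^bsub>M\<^esub> k = \<zero>\<^bsub>M\<^esub> \<and> (\<forall>c\<in>I. len c < l \<longrightarrow> k c = \<zero>\<^bsub>cyc (len c)\<^esub>)}"

definition socle_at :: "nat \<Rightarrow> ('i \<Rightarrow> 'a set) set" where
  "socle_at l = {k\<in>carrier M. p \<odot>\<^bsub>M\<^esub> k = \<zero>\<^bsub>M\<^esub> \<and> (\<forall>c\<in>I. len c \<noteq> l \<longrightarrow> k c = \<zero>\<^bsub>cyc (len c)\<^esub>)}"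

lemma socle_comp:
  assumes "k \<in> carrier M" "p \<odot>\<^bsub>M\<^esub> k = \<zero>\<^bsub>M\<^esub>" "c \<in> I"
  shows "p \<odot>\<^bsub>cyc (len c)\<^esub> k c = \<zero>\<^bsub>cyc (len c)\<^esub>"
  using M_comp(4)[OF assms(3), of p k] assms M_comp(2) by simp

lemma socle_from_divisible:
  assumes k: "k \<in> socle_from l"
  obtains m where "m \<in> carrier M" "k = p [^] (l - 1) \<odot>\<^bsub>M\<^esub> m"
proof -
  have km: "k \<in> carrier M" "p \<odot>\<^bsub>M\<^esub> k = \<zero>\<^bsub>M\<^esub>" using k by (auto simp: socle_from_def)
  have "\<exists>n\<in>carrier (cyc (len c)). k c = p [^] (l - 1) \<odot>\<^bsub>cyc (len c)\<^esub> n" if c: "c \<in> I" for c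
  proof (cases "k c = \<zero>\<^bsub>cyc (len c)\<^esub>")
    case True
    then show ?thesis by (intro bexI[of _ "\<zero>\<^bsub>cyc (len c)\<^esub>"]) simp_all
  next
    case False
    then obtain u where u: "u \<in> Units R" "0 < len c" "k c = (p [^] (len c - 1) \<otimes> u) \<odot>\<^bsub>cyc (len c)\<^esub> gen (len c)"
      using cyc_socle[OF M_comp(1)[OF c km(1)] _ socle_comp[OF km c]] by blast
    have "l \<le> len c" using False k c by (force simp: socle_from_def)
    then have "p [^] (len c - 1) \<otimes> u = p [^] (l - 1) \<otimes> (p [^] (len c - 1 - (l - 1)) \<otimes> u)"
      using u p_pow_add[of "l - 1" "len c - 1 - (l - 1)"] Units_closed[OF u(1)] by (simp add: m_assoc)
    then show ?thesis unfolding u(3)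
      using Units_closed[OF u(1)] N.smult_assoc1[of "p [^] (l - 1)" "p [^] (len c - 1 - (l - 1)) \<otimes> u" "gen (len c)" "len c"]
      by (intro bexI[of _ "(p [^] (len c - 1 - (l - 1)) \<otimes> u) \<odot>\<^bsub>cyc (len c)\<^esub> gen (len c)"]) simp_all
  qed
  then obtain n where n: "\<And>c. c \<in> I \<Longrightarrow> n c \<in> carrier (cyc (len c)) \<and> k c = p [^] (l - 1) \<odot>\<^bsub>cyc (len c)\<^esub> n c"
    by metis
  have m: "restrict n I \<in> carrier M" using n by (simp add: M_carrier)
  moreover have "k = p [^] (l - 1) \<odot>\<^bsub>M\<^esub> restrict n I"
  proof (rule M_eqI[OF km(1)])
    show "p [^] (l - 1) \<odot>\<^bsub>M\<^esub> restrict n I \<in> carrier M" using m by simp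
    show "k c = (p [^] (l - 1) \<odot>\<^bsub>M\<^esub> restrict n I) c" if "c \<in> I" for c
      unfolding M_comp(4)[OF that] using n[OF that] that by simp
  qed
  ultimately show thesis by (rule that)
qed

lemma socle_from_stable:
  assumes a: "a \<in> linear_maps R M M" and k: "k \<in> socle_from l"
  shows "a k \<in> socle_from l"
proof -
  have km: "k \<in> carrier M" "p \<odot>\<^bsub>M\<^esub> k = \<zero>\<^bsub>M\<^esub>" using k by (auto simp: socle_from_def)
  obtain m where m: "m \<in> carrier M" "k = p [^] (l - 1) \<odot>\<^bsub>M\<^esub> m" using k by (rule socle_from_divisible)
  have am: "a m \<in> carrier M" using linear_maps_closed[OF a m(1)] .
  have "p \<odot>\<^bsub>M\<^esub> a k = \<zero>\<^bsub>M\<^esub>"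
    using linear_maps_smult[OF a p_closed km(1)] km(2) linear_maps_zero[OF M_module M_module a] by simp
  moreover have "a k = p [^] (l - 1) \<odot>\<^bsub>M\<^esub> a m"
    using linear_maps_smult[OF a _ m(1)] m(2) by simp
  then have "a k c = \<zero>\<^bsub>cyc (len c)\<^esub>" if "c \<in> I" "len c < l" for c
    using that cyc_power_zero[OF M_comp(1)[OF that(1) am], of "l - 1"] M_comp(4)[OF that(1)] by simp
  ultimately show ?thesis using linear_maps_closed[OF a km(1)] by (simp add: socle_from_def)
qed

text \<open>If \<open>a\<close> is not injective, some layer \<open>l\<close> of the socle contains a vector killed by \<open>a\<close> modulo
  higher layers, so that by finiteness \<open>a\<close> also misses some \<open>m'\<close> in this layer. Adding to \<open>a\<close> a map
  \<open>t \<circ> (1 - b a)\<close>, where \<open>t\<close> has values \<open>R m'\<close> on the socle, repairs this without changing \<open>a\<close> on \<open>V\<close>.\<close>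

lemma conjugate_if_mutually_generated:
  assumes a0: "a0 \<in> linear_maps R M M" and b: "b \<in> linear_maps R M M"
    and V: "V \<subseteq> carrier M" and ba: "\<And>v. v \<in> V \<Longrightarrow> b (a0 v) = v"
  obtains g where "g \<in> carrier (module_Aut R M)" "\<And>v. v \<in> V \<Longrightarrow> g v = a0 v"
proof -
  \<comment> \<open>The \<open>defect\<close> collects the kernels of the maps induced by
    \<open>a\<close> on the individual layers of the socle. A map with smallest
    \<open>defect\<close> among those agreeing with \<open>a0\<close> on \<open>V\<close> will turn
    out injective.\<close>
  define defect where "defect a = {(l, k). l \<in> len ` I \<and> k \<in> socle_at l \<and> layer_proj l (a k) = \<zero>\<^bsub>M\<^esub>}" for a
  have fin: "finite (defect a)" for a
    by (rule finite_subset[of _ "len ` I \<times> carrier M"]) (auto simp: defect_def socle_at_def finite_M)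
  have "a0 \<in> linear_maps R M M \<and> (\<forall>v\<in>V. a0 v = a0 v)" using a0 by simp
  from ex_has_least_nat[of "\<lambda>a. a \<in> linear_maps R M M \<and> (\<forall>v\<in>V. a v = a0 v)", OF this,
      of "\<lambda>a. card (defect a)"]
  obtain a where a: "a \<in> linear_maps R M M" "\<And>v. v \<in> V \<Longrightarrow> a v = a0 v"
    and min: "\<And>a'. a' \<in> linear_maps R M M \<Longrightarrow> (\<And>v. v \<in> V \<Longrightarrow> a' v = a0 v) \<Longrightarrow> card (defect a) \<le> card (defect a')"
    by blast
  note zero = linear_maps_zero[OF M_module M_module]
  note \<rho> = layer_proj_linear
  have \<rho>_at: "layer_proj l k = k" if "k \<in> socle_at l" for l k
    using that by (intro M_eqI linear_maps_closed[OF \<rho>]) (auto simp: socle_at_def layer_proj_def)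
  have \<rho>_other: "layer_proj l' k = \<zero>\<^bsub>M\<^esub>" if "k \<in> socle_at l" "l' \<noteq> l" for l l' k
    using that by (intro M_eqI linear_maps_closed[OF \<rho>]) (auto simp: socle_at_def layer_proj_def M_comp)
  have \<rho>_socle: "layer_proj l k \<in> socle_at l" if "k \<in> carrier M" "p \<odot>\<^bsub>M\<^esub> k = \<zero>\<^bsub>M\<^esub>" for l k
    using that linear_maps_closed[OF \<rho>] linear_maps_smult[OF \<rho> p_closed that(1), of l] zero[OF \<rho>]
    by (auto simp: socle_at_def layer_proj_def)
  have "inj_on a (carrier M)"
  proof (rule ccontr)
    assume "\<not> inj_on a (carrier M)"
    then obtain x' x'' where x': "x' \<in> carrier M" "x'' \<in> carrier M" "x' \<noteq> x''" "a x' = a x''"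
      by (auto simp: inj_on_def)
    define x where "x = x' \<ominus>\<^bsub>M\<^esub> x''"
    have x: "x \<in> carrier M" "x \<noteq> \<zero>\<^bsub>M\<^esub>" "a x = \<zero>\<^bsub>M\<^esub>"
    proof -
      show "x \<in> carrier M" using x' by (simp add: x_def)
      show "x \<noteq> \<zero>\<^bsub>M\<^esub>" unfolding x_def using x' M.M.minus_eq_zeroD[of x' x''] by blast
      show "a x = \<zero>\<^bsub>M\<^esub>"
        using x' linear_maps_closed[OF a(1)]
        by (simp add: x_def a_minus_def linear_maps_add[OF a(1)] linear_maps_minus[OF M_module M_module a(1)]
          M.M.r_neg)
    qed
    define L where "L = Max (insert 0 (len ` I))"
    have "p [^] L \<odot>\<^bsub>M\<^esub> x = \<zero>\<^bsub>M\<^esub>"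
      using x cyc_power_zero[OF M_comp(1)[OF _ x(1)], of _ L] by (intro M_eqI) (auto simp: M_comp L_def)
    \<comment> \<open>The last nonzero multiple of \<open>x\<close> by a power of \<open>p\<close>
      lies in the socle and is still killed by \<open>a\<close>. Below, \<open>l\<close> is the
      lowest length in which it has a component.\<close>
    define n where "n = (LEAST n. p [^] (n::nat) \<odot>\<^bsub>M\<^esub> x = \<zero>\<^bsub>M\<^esub>)"
    have n: "p [^] n \<odot>\<^bsub>M\<^esub> x = \<zero>\<^bsub>M\<^esub>" unfolding n_def by (rule LeastI[of _ L]) fact
    have "n \<noteq> 0" using n x by (intro notI) simp
    then obtain n' where n': "n = Suc n'" by (cases n) auto
    define k0 where "k0 = p [^] n' \<odot>\<^bsub>M\<^esub> x"
    have "k0 \<noteq> \<zero>\<^bsub>M\<^esub>" unfolding k0_def using not_less_Least[of n' "\<lambda>n. p [^] (n::nat) \<odot>\<^bsub>M\<^esub> x = \<zero>\<^bsub>M\<^esub>"]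
      by (simp add: n' flip: n_def)
    moreover have k0: "k0 \<in> carrier M" "a k0 = \<zero>\<^bsub>M\<^esub>"
      using x linear_maps_smult[OF a(1) _ x(1)] by (simp_all add: k0_def)
    moreover have k0p: "p \<odot>\<^bsub>M\<^esub> k0 = \<zero>\<^bsub>M\<^esub>"
    proof -
      have "p [^] n = p \<otimes> p [^] n'" unfolding n' by (rule nat_pow_Suc2) simp
      then show ?thesis using n x by (simp add: k0_def M.smult_assoc1)
    qed
    ultimately have ex: "\<exists>l. \<exists>c\<in>I. len c = l \<and> k0 c \<noteq> \<zero>\<^bsub>cyc (len c)\<^esub>"
      using M_eqI[OF k0(1) M.M.zero_closed] M_comp(2) by auto
    define l where "l = (LEAST l. \<exists>c\<in>I. len c = l \<and> k0 c \<noteq> \<zero>\<^bsub>cyc (len c)\<^esub>)"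
    obtain c where c: "c \<in> I" "len c = l" "k0 c \<noteq> \<zero>\<^bsub>cyc (len c)\<^esub>"
      using LeastI_ex[OF ex] by (auto simp flip: l_def)
    have low: "k0 d = \<zero>\<^bsub>cyc (len d)\<^esub>" if "d \<in> I" "len d < l" for d
      using not_less_Least[of "len d" "\<lambda>l. \<exists>c\<in>I. len c = l \<and> k0 c \<noteq> \<zero>\<^bsub>cyc (len c)\<^esub>"] that by (auto simp flip: l_def)
    define k where "k = layer_proj l k0"
    have k: "k \<in> socle_at l" unfolding k_def by (rule \<rho>_socle[OF k0(1) k0p])
    have km: "k \<in> carrier M" "p \<odot>\<^bsub>M\<^esub> k = \<zero>\<^bsub>M\<^esub>" using k by (auto simp: socle_at_def)
    have kc: "k c = k0 c" using c by (simp add: k_def layer_proj_def)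
    have k_nz: "k \<noteq> \<zero>\<^bsub>M\<^esub>" using c kc M_comp(2)[OF c(1)] by auto
    \<comment> \<open>As \<open>a k0 = 0\<close>, the image of \<open>k\<close> is that of
      \<open>k - k0\<close>, and this difference has components only in lengths above
      \<open>l\<close>.\<close>
    have ak: "a k \<in> socle_from (Suc l)"
    proof -
      have d: "k \<ominus>\<^bsub>M\<^esub> k0 \<in> carrier M" using km k0 by simp
      have "k \<ominus>\<^bsub>M\<^esub> k0 \<in> socle_from (Suc l)"
        unfolding socle_from_def
      proof (intro CollectI conjI d ballI impI)
        show "p \<odot>\<^bsub>M\<^esub> (k \<ominus>\<^bsub>M\<^esub> k0) = \<zero>\<^bsub>M\<^esub>"
          using km k0 k0p by (simp add: a_minus_def M.smult_r_distr M.smult_r_minus)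
        fix d assume d: "d \<in> I" "len d < Suc l"
        then show "(k \<ominus>\<^bsub>M\<^esub> k0) d = \<zero>\<^bsub>cyc (len d)\<^esub>"
          using low[of d] M_comp(1)[OF d(1) k0(1)]
          by (auto simp: a_minus_def M_comp M_minus k0(1) k_def layer_proj_def N.M.r_neg less_Suc_eq)
      qed
      then have "a (k \<ominus>\<^bsub>M\<^esub> k0) \<in> socle_from (Suc l)" by (rule socle_from_stable[OF a(1)])
      moreover have "a (k \<ominus>\<^bsub>M\<^esub> k0) = a k"
        using km k0 linear_maps_closed[OF a(1) km(1)]
        by (simp add: a_minus_def linear_maps_add[OF a(1)] linear_maps_minus[OF M_module M_module a(1)])
      ultimately show ?thesis by simp
    qed
    have akl: "layer_proj l (a k) = \<zero>\<^bsub>M\<^esub>"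
      using ak by (intro M_eqI linear_maps_closed[OF \<rho>]) (auto simp: socle_from_def layer_proj_def M_comp)
    define f where "f y = layer_proj l (a y)" for y
    have f_lin: "f \<in> linear_maps R M M" using linear_maps_compose[OF a(1) \<rho>] by (simp add: f_def[abs_def])
    have f_at: "f y \<in> socle_at l" if "y \<in> socle_at l" for y
    proof -
      have y: "y \<in> carrier M" "p \<odot>\<^bsub>M\<^esub> y = \<zero>\<^bsub>M\<^esub>" using that by (auto simp: socle_at_def)
      then have "p \<odot>\<^bsub>M\<^esub> a y = \<zero>\<^bsub>M\<^esub>" using linear_maps_smult[OF a(1) p_closed y(1)] zero[OF a(1)] by simp
      then show ?thesis unfolding f_def using linear_maps_closed[OF a(1) y(1)] by (intro \<rho>_socle)
    qed
    have zero_at: "\<zero>\<^bsub>M\<^esub> \<in> socle_at l" by (simp add: socle_at_def M_comp)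
    have fin_at: "finite (socle_at l)" using finite_M by (auto simp: socle_at_def intro: finite_subset)
    have "f k = f \<zero>\<^bsub>M\<^esub>" using akl zero[OF f_lin] by (simp add: f_def)
    then have "\<not> inj_on f (socle_at l)" using k zero_at k_nz by (auto dest: inj_onD)
    then have "f ` socle_at l \<noteq> socle_at l" using eq_card_imp_inj_on[OF fin_at] by metis
    then obtain m' where m': "m' \<in> socle_at l" "m' \<notin> f ` socle_at l" using f_at by blast
    have m'm: "m' \<in> carrier M" "p \<odot>\<^bsub>M\<^esub> m' = \<zero>\<^bsub>M\<^esub>" using m' by (auto simp: socle_at_def)
    have m'_nz: "m' \<noteq> \<zero>\<^bsub>M\<^esub>" using m'(2) zero[OF f_lin] zero_at by force
    have "m' \<in> socle_from l" using m'(1) by (auto simp: socle_at_def socle_from_def)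
    then obtain m0 where m0: "m0 \<in> carrier M" "m' = p [^] (l - 1) \<odot>\<^bsub>M\<^esub> m0" by (rule socle_from_divisible)
    define m where "m = layer_proj l m0"
    have m: "m \<in> carrier M" unfolding m_def by (rule linear_maps_closed[OF \<rho> m0(1)])
    have m'_eq: "m' = p [^] (l - 1) \<odot>\<^bsub>M\<^esub> m"
      using \<rho>_at[OF m'(1)] linear_maps_smult[OF \<rho> _ m0(1), of "p [^] (l - 1)" l] m0(2) by (simp add: m_def)
    have "p [^] l \<odot>\<^bsub>M\<^esub> m = \<zero>\<^bsub>M\<^esub>"
    proof (rule M_eqI)
      fix d assume d: "d \<in> I"
      have "p [^] l \<odot>\<^bsub>cyc (len d)\<^esub> m d = \<zero>\<^bsub>cyc (len d)\<^esub>"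
        using cyc_power_zero[OF M_comp(1)[OF d m0(1)], of l] d by (auto simp: m_def layer_proj_def)
      then show "(p [^] l \<odot>\<^bsub>M\<^esub> m) d = \<zero>\<^bsub>M\<^esub> d" using d by (simp add: M_comp)
    qed (use m in auto)
    then obtain \<tau> where \<tau>: "\<tau> \<in> linear_maps R (cyc l) M"
      "\<And>r. r \<in> carrier R \<Longrightarrow> \<tau> (r \<odot>\<^bsub>cyc l\<^esub> gen l) = r \<odot>\<^bsub>M\<^esub> m"
      using cyc_hom[OF M_module m] by metis
    \<comment> \<open>Since \<open>m' = p^(l-1) m\<close>, and a socle vector with nonzero component
      at \<open>c\<close> has there a unit multiple of \<open>p^(l-1) gen l\<close>, the map
      \<open>t\<close> sends such a vector to a unit multiple of \<open>m'\<close>.\<close>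
    define t where "t y = \<tau> (y c)" for y
    have t_lin: "t \<in> linear_maps R M M"
      using linear_maps_compose[OF proj_linear[OF c(1)], of \<tau> M] \<tau>(1) c(2) by (simp add: t_def[abs_def])
    have t_unit: "\<exists>u\<in>Units R. t y = u \<odot>\<^bsub>M\<^esub> m'"
      if y: "y \<in> carrier M" "p \<odot>\<^bsub>M\<^esub> y = \<zero>\<^bsub>M\<^esub>" "y c \<noteq> \<zero>\<^bsub>cyc l\<^esub>" for y
    proof -
      obtain u where u: "u \<in> Units R" "y c = (p [^] (l - 1) \<otimes> u) \<odot>\<^bsub>cyc l\<^esub> gen l"
        using cyc_socle[OF M_comp(1)[OF c(1) y(1)] _ socle_comp[OF y(1,2) c(1)]] y(3) c(2) by metis
      have "t y = (p [^] (l - 1) \<otimes> u) \<odot>\<^bsub>M\<^esub> m" using \<tau>(2) u Units_closed[OF u(1)] by (simp add: t_def)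
      also have "\<dots> = u \<odot>\<^bsub>M\<^esub> m'"
        unfolding m_comm[OF p_pow_closed Units_closed[OF u(1)]]
        using Units_closed[OF u(1)] m by (simp add: m'_eq M.smult_assoc1)
      finally show ?thesis using u(1) by blast
    qed
    have t_mult: "\<exists>r\<in>carrier R. t y = r \<odot>\<^bsub>M\<^esub> m'"
      if y: "y \<in> carrier M" "p \<odot>\<^bsub>M\<^esub> y = \<zero>\<^bsub>M\<^esub>" for y
    proof (cases "y c = \<zero>\<^bsub>cyc l\<^esub>")
      case True
      then have "t y = \<zero>\<^bsub>M\<^esub>" using linear_maps_zero[OF cyc_module M_module \<tau>(1)] by (simp add: t_def)
      then show ?thesis using m'm by (intro bexI[of _ \<zero>]) auto
    next
      case False
      then show ?thesis using t_unit[OF y] Units_closed by blast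
    qed
    \<comment> \<open>The map \<open>1 - b a\<close> vanishes on \<open>V\<close>, so a correction
      that factors through it keeps the prescribed values.\<close>
    define d where "d y = y \<oplus>\<^bsub>M\<^esub> (\<ominus>\<^bsub>M\<^esub> b (a y))" for y
    have ba_lin: "(\<lambda>y. b (a y)) \<in> linear_maps R M M" by (rule linear_maps_compose[OF a(1) b])
    have d_lin: "d \<in> linear_maps R M M"
      using linear_maps_plus[OF M_module M_module linear_maps_id linear_maps_minus_fun[OF M_module M_module ba_lin]]
      by (simp add: d_def[abs_def])
    define a' where "a' y = a y \<oplus>\<^bsub>M\<^esub> t (d y)" for y
    have a'_lin: "a' \<in> linear_maps R M M"
      using linear_maps_plus[OF M_module M_module a(1) linear_maps_compose[OF d_lin t_lin]]
      by (simp add: a'_def[abs_def])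
    have a'_V: "a' v = a0 v" if v: "v \<in> V" for v
    proof -
      have vm: "v \<in> carrier M" "a0 v \<in> carrier M" using v V linear_maps_closed[OF a0] by auto
      have "d v = \<zero>\<^bsub>M\<^esub>" using ba[OF v] a(2)[OF v] vm by (simp add: d_def M.M.r_neg)
      then show ?thesis using zero[OF t_lin] a(2)[OF v] vm by (simp add: a'_def)
    qed
    have ad: "a y \<in> carrier M" "t (d y) \<in> carrier M" "d y \<in> carrier M" if "y \<in> carrier M" for y
      using that linear_maps_closed[OF a(1)] linear_maps_closed[OF t_lin] linear_maps_closed[OF d_lin] by auto
    have dp: "p \<odot>\<^bsub>M\<^esub> d y = \<zero>\<^bsub>M\<^esub>" if "y \<in> carrier M" "p \<odot>\<^bsub>M\<^esub> y = \<zero>\<^bsub>M\<^esub>" for y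
      using linear_maps_smult[OF d_lin p_closed that(1)] that(2) zero[OF d_lin] by simp
    \<comment> \<open>On a socle vector \<open>y\<close> the correction is \<open>r m'\<close>,
      invisible outside layer \<open>l\<close>. In layer \<open>l\<close>, vanishing of
      \<open>a' y\<close> means \<open>f y = - r m'\<close>: a unit \<open>r\<close> would put
      \<open>m'\<close> into the image of \<open>f\<close>, and a nonunit \<open>r\<close> kills
      \<open>m'\<close>. So no new vector enters.\<close>
    have "defect a' \<subseteq> defect a"
    proof clarify
      fix l' y assume y: "(l', y) \<in> defect a'"
      then have y': "l' \<in> len ` I" "y \<in> socle_at l'" "layer_proj l' (a' y) = \<zero>\<^bsub>M\<^esub>" by (auto simp: defect_def)
      have ym: "y \<in> carrier M" "p \<odot>\<^bsub>M\<^esub> y = \<zero>\<^bsub>M\<^esub>" using y'(2) by (auto simp: socle_at_def)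
      obtain r where r: "r \<in> carrier R" "t (d y) = r \<odot>\<^bsub>M\<^esub> m'" using t_mult[OF ad(3)[OF ym(1)] dp[OF ym]] by auto
      have \<rho>a: "layer_proj l' (a y) \<in> carrier M" using linear_maps_closed[OF \<rho> ad(1)[OF ym(1)]] .
      have eq: "layer_proj l' (a y) \<oplus>\<^bsub>M\<^esub> r \<odot>\<^bsub>M\<^esub> layer_proj l' m' = \<zero>\<^bsub>M\<^esub>"
        using y'(3) linear_maps_add[OF \<rho> ad(1,2)[OF ym(1)]] linear_maps_smult[OF \<rho> r(1) m'm(1)] by (simp add: a'_def r(2))
      have "layer_proj l' (a y) = \<zero>\<^bsub>M\<^esub>"
      proof (cases "l' = l")
        case False
        then show ?thesis using eq \<rho>_other[OF m'(1) False] r(1) \<rho>a by simp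
      next
        case True
        then have eq': "f y \<oplus>\<^bsub>M\<^esub> r \<odot>\<^bsub>M\<^esub> m' = \<zero>\<^bsub>M\<^esub>" using eq \<rho>_at[OF m'(1)] by (simp add: f_def)
        have fy: "f y \<in> carrier M" using \<rho>a True by (simp add: f_def)
        from unit_or_multiple[OF r(1)] show ?thesis
        proof
          assume ru: "r \<in> Units R"
          have "r \<odot>\<^bsub>M\<^esub> m' = \<ominus>\<^bsub>M\<^esub> f y" using eq' fy r(1) m'm by (metis M.M.minus_equality M.M.add.m_comm M.smult_closed)
          then have "inv r \<odot>\<^bsub>M\<^esub> (r \<odot>\<^bsub>M\<^esub> m') = (\<ominus> (inv r)) \<odot>\<^bsub>M\<^esub> f y"
            using ru fy by (simp add: M.smult_l_minus M.smult_r_minus)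
          also have "\<dots> = f ((\<ominus> (inv r)) \<odot>\<^bsub>M\<^esub> y)" using linear_maps_smult[OF f_lin _ ym(1)] ru by simp
          also have "inv r \<odot>\<^bsub>M\<^esub> (r \<odot>\<^bsub>M\<^esub> m') = m'" using ru r(1) m'm by (simp flip: M.smult_assoc1)
          finally have "m' = f ((\<ominus> (inv r)) \<odot>\<^bsub>M\<^esub> y)" .
          moreover have "(\<ominus> (inv r)) \<odot>\<^bsub>M\<^esub> y \<in> socle_at l"
          proof -
            have s: "\<ominus> (inv r) \<in> carrier R" using ru by simp
            have "p \<odot>\<^bsub>M\<^esub> ((\<ominus> (inv r)) \<odot>\<^bsub>M\<^esub> y) = (\<ominus> (inv r)) \<odot>\<^bsub>M\<^esub> (p \<odot>\<^bsub>M\<^esub> y)"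
              using s ym(1) m_comm[OF p_closed s] by (simp flip: M.smult_assoc1)
            then show ?thesis using s y'(2) ym True by (simp add: socle_at_def M_comp)
          qed
          ultimately show ?thesis using m'(2) by blast
        next
          assume "\<exists>s\<in>carrier R. r = p \<otimes> s"
          then obtain s where "s \<in> carrier R" "r = s \<otimes> p" using m_comm[OF p_closed] by auto
          then have "r \<odot>\<^bsub>M\<^esub> m' = \<zero>\<^bsub>M\<^esub>" using m'm by (simp add: M.smult_assoc1)
          then show ?thesis using eq' fy True by (simp add: f_def)
        qed
      qed
      then show "(l', y) \<in> defect a" using y' by (simp add: defect_def)
    qed
    moreover have "(l, k) \<in> defect a" using c k akl by (auto simp: defect_def)
    \<comment> \<open>By stability \<open>b (a k)\<close> has no component in layer
      \<open>l\<close>, so \<open>d k\<close> and \<open>k\<close> have the same nonzero component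
      at \<open>c\<close>, and the correction at \<open>k\<close> is a unit multiple of
      \<open>m'\<close>.\<close>
    moreover have "(l, k) \<notin> defect a'"
    proof
      assume "(l, k) \<in> defect a'"
      then have *: "layer_proj l (a' k) = \<zero>\<^bsub>M\<^esub>" by (simp add: defect_def)
      have "b (a k) \<in> socle_from (Suc l)" by (rule socle_from_stable[OF b ak])
      then have bak: "b (a k) c = \<zero>\<^bsub>cyc l\<^esub>" "b (a k) \<in> carrier M" using c by (auto simp: socle_from_def)
      have "d k c = k c" using bak c M_comp(1)[OF c(1) km(1)] by (simp add: d_def M_comp M_minus)
      then obtain u where u: "u \<in> Units R" "t (d k) = u \<odot>\<^bsub>M\<^esub> m'"
        using t_unit[OF ad(3)[OF km(1)] dp[OF km]] c kc by auto
      have "layer_proj l (a' k) = u \<odot>\<^bsub>M\<^esub> m'"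
        using linear_maps_add[OF \<rho> ad(1,2)[OF km(1)]] linear_maps_smult[OF \<rho> _ m'm(1)] Units_closed[OF u(1)]
          \<rho>_at[OF m'(1)] akl m'm by (simp add: a'_def u(2))
      then have um: "u \<odot>\<^bsub>M\<^esub> m' = \<zero>\<^bsub>M\<^esub>" using * by simp
      have "inv u \<odot>\<^bsub>M\<^esub> (u \<odot>\<^bsub>M\<^esub> m') = \<zero>\<^bsub>M\<^esub>" unfolding um using u(1) by simp
      then show False using u(1) m'm m'_nz Units_closed[OF u(1)] by (simp flip: M.smult_assoc1)
    qed
    ultimately have "card (defect a') < card (defect a)" by (intro psubset_card_mono fin) blast
    then show False using min[OF a'_lin a'_V] by simp
  qed
  then have bij: "bij_betw a (carrier M) (carrier M)"
    using linear_maps_closed[OF a(1)] finite_M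
    by (simp add: bij_betw_def endo_inj_surj image_subset_iff)
  have "restrict a (carrier M) \<in> carrier (module_Aut R M)"
    using bij a(1) by (auto simp: module_Aut_def Bij_def linear_maps_def)
  moreover have "restrict a (carrier M) v = a0 v" if "v \<in> V" for v using that a(2) V by auto
  ultimately show thesis by (rule that)
qed

end

section \<open>The endomorphism submodule generated by a pair of points of an orbit\<close>

text \<open>The group is eliminated here: a nonempty \<open>E\<close> is a class of vectors
  generating the same \<open>End M\<close>-submodule. For an orbit, \<open>E_closed\<close> is the
  conjugacy result above.\<close>

locale orbit_class = cyclic_product R p I len for R (structure) and p and I :: "'i set" and len +
  fixes E :: "('i \<Rightarrow> 'a set) set"
  assumes E_sub: "E \<subseteq> carrier M"
    and E_trans: "\<lbrakk>x \<in> E; y \<in> E\<rbrakk> \<Longrightarrow> \<exists>a\<in>linear_maps R M M. a x = y"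
    and E_closed: "\<lbrakk>x \<in> E; a \<in> linear_maps R M M; b \<in> linear_maps R M M; b (a x) = x\<rbrakk> \<Longrightarrow> a x \<in> E"
begin

interpretation N: Module.module R "cyc l" for l by (rule cyc_module)
interpretation M: Module.module R M by (rule M_module)

abbreviation homs :: "nat \<Rightarrow> (('i \<Rightarrow> 'a set) \<Rightarrow> 'a set) set" where
  "homs l \<equiv> linear_maps R M (cyc l)"

text \<open>The orbit \<open>E\<close> generates the \<open>End M\<close>-submodule of \<open>M\<close> whose components in \<open>R/p\<^sup>l\<close> are \<open>values_at l\<close>.\<close>

definition values_at :: "nat \<Rightarrow> 'a set set" where
  "values_at l = {f x | f x. f \<in> homs l \<and> x \<in> E}"

lemma E_carrier: "x \<in> E \<Longrightarrow> x \<in> carrier M"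
  using E_sub by auto

lemma values_atI: "f \<in> homs l \<Longrightarrow> x \<in> E \<Longrightarrow> f x \<in> values_at l"
  by (auto simp: values_at_def)

lemma comp_in_values_at: "c \<in> I \<Longrightarrow> x \<in> E \<Longrightarrow> x c \<in> values_at (len c)"
  using values_atI[OF proj_linear] .

text \<open>Endomorphisms act transitively on \<open>E\<close>, so one point produces all the
  values. Hence values can be added by adding maps at a common point.\<close>

lemma values_atE:
  assumes "n \<in> values_at l" "x \<in> E"
  obtains f where "f \<in> homs l" "f x = n"
proof -
  obtain f y where f: "f \<in> homs l" "y \<in> E" "n = f y" using assms(1) by (auto simp: values_at_def)
  obtain a where a: "a \<in> linear_maps R M M" "a x = y" using E_trans[OF assms(2) f(2)] by auto
  show thesis using that[OF linear_maps_compose[OF a(1) f(1)]] a f by simp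
qed

lemma values_at_map:
  assumes "f \<in> linear_maps R (cyc l) (cyc m)" "n \<in> values_at l"
  shows "f n \<in> values_at m"
proof -
  obtain h x where h: "h \<in> homs l" "x \<in> E" "n = h x" using assms(2) by (auto simp: values_at_def)
  show ?thesis using values_atI[OF linear_maps_compose[OF h(1) assms(1)] h(2)] h(3) by simp
qed

lemma values_at_submodule:
  assumes "E \<noteq> {}" shows "submodule (values_at l) R (cyc l)"
proof -
  obtain x where x: "x \<in> E" using assms by auto
  note hx = values_atI[OF _ x]
  show ?thesis
  proof (rule N.submoduleI)
    show "values_at l \<subseteq> carrier (cyc l)" using linear_maps_closed E_carrier by (fastforce simp: values_at_def)
    show "\<zero>\<^bsub>cyc l\<^esub> \<in> values_at l" using hx[OF linear_maps_zero_fun[OF M_module cyc_module]] .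
    fix m assume "m \<in> values_at l"
    then obtain f where f: "f \<in> homs l" "f x = m" using values_atE x by blast
    show "\<ominus>\<^bsub>cyc l\<^esub> m \<in> values_at l"
      using hx[OF linear_maps_minus_fun[OF M_module cyc_module f(1)]] f(2) by simp
    show "r \<odot>\<^bsub>cyc l\<^esub> m \<in> values_at l" if "r \<in> carrier R" for r
      using hx[OF linear_maps_smult_fun[OF M_module cyc_module f(1) that]] f(2) by simp
    fix n assume "n \<in> values_at l"
    then obtain h where h: "h \<in> homs l" "h x = n" using values_atE x by blast
    show "m \<oplus>\<^bsub>cyc l\<^esub> n \<in> values_at l"
      using hx[OF linear_maps_plus[OF M_module cyc_module f(1) h(1)]] f(2) h(2) by simp
  qed
qed

text \<open>In a chain, an element of \<open>K\<close> outside \<open>H\<close> forces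
  \<open>H\<close> into \<open>p K\<close>: it is not a multiple of \<open>m\<close>, so
  \<open>m\<close> is a multiple of \<open>p\<close> times it.\<close>

lemma submodule_strict_divisible:
  assumes H: "submodule H R (cyc l)" and K: "submodule K R (cyc l)"
    and n: "n \<in> K" "n \<notin> H" and m: "m \<in> H"
  obtains k where "k \<in> K" "m = p \<odot>\<^bsub>cyc l\<^esub> k"
proof -
  have nm: "n \<in> carrier (cyc l)" "m \<in> carrier (cyc l)"
    using N.submoduleE(1)[OF H] N.submoduleE(1)[OF K] n m by auto
  have "\<not> (\<exists>r\<in>carrier R. n = r \<odot>\<^bsub>cyc l\<^esub> m)" using N.submoduleE(4)[OF H _ m] n(2) by auto
  then obtain r where r: "r \<in> carrier R" "m = (p \<otimes> r) \<odot>\<^bsub>cyc l\<^esub> n" using cyc_comparable[OF nm] by auto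
  show thesis using that[of "r \<odot>\<^bsub>cyc l\<^esub> n"] N.submoduleE(4)[OF K r(1) n(1)] r nm by (simp add: N.smult_assoc1)
qed

text \<open>A generator is an element with the largest set of multiples; by comparability nothing in
  \<open>H\<close> can escape it.\<close>

lemma submodule_cyclic:
  assumes H: "submodule H R (cyc l)"
  obtains m where "m \<in> H" "\<And>n. n \<in> H \<Longrightarrow> \<exists>r\<in>carrier R. n = r \<odot>\<^bsub>cyc l\<^esub> m"
proof -
  have HN: "H \<subseteq> carrier (cyc l)" by (rule N.submoduleE(1)[OF H])
  then have fin: "finite H" using finite_cyc finite_subset by blast
  define C where "C m = card ((\<lambda>r. r \<odot>\<^bsub>cyc l\<^esub> m) ` carrier R)" for m
  have "Max (C ` H) \<in> C ` H" using fin N.submodule_zero[OF H] by (intro Max_in) auto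
  then obtain m where m: "m \<in> H" "C m = Max (C ` H)" by force
  have max: "C n \<le> C m" if "n \<in> H" for n unfolding m(2) using fin that by simp
  show thesis
  proof (rule that[OF m(1)])
    fix n assume n: "n \<in> H"
    have nm: "n \<in> carrier (cyc l)" "m \<in> carrier (cyc l)" using n m HN by auto
    have gfin: "finite ((\<lambda>r. r \<odot>\<^bsub>cyc l\<^esub> n) ` carrier R)"
      by (rule finite_subset[OF _ finite_cyc[of l]]) (use nm in auto)
    from cyc_comparable[OF nm] show "\<exists>r\<in>carrier R. n = r \<odot>\<^bsub>cyc l\<^esub> m"
    proof
      assume "\<exists>r\<in>carrier R. m = (p \<otimes> r) \<odot>\<^bsub>cyc l\<^esub> n"
      then obtain r where r: "r \<in> carrier R" "m = (p \<otimes> r) \<odot>\<^bsub>cyc l\<^esub> n" by auto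
      have "(\<lambda>s. s \<odot>\<^bsub>cyc l\<^esub> m) ` carrier R \<subseteq> (\<lambda>s. s \<odot>\<^bsub>cyc l\<^esub> n) ` carrier R"
      proof clarify
        fix s assume s: "s \<in> carrier R"
        have "s \<odot>\<^bsub>cyc l\<^esub> m = (s \<otimes> (p \<otimes> r)) \<odot>\<^bsub>cyc l\<^esub> n" using s r nm by (simp add: N.smult_assoc1)
        moreover have "s \<otimes> (p \<otimes> r) \<in> carrier R" using s r(1) by simp
        ultimately show "s \<odot>\<^bsub>cyc l\<^esub> m \<in> (\<lambda>s. s \<odot>\<^bsub>cyc l\<^esub> n) ` carrier R" by (rule image_eqI)
      qed
      then have eq: "(\<lambda>s. s \<odot>\<^bsub>cyc l\<^esub> m) ` carrier R = (\<lambda>s. s \<odot>\<^bsub>cyc l\<^esub> n) ` carrier R"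
        using max[OF n] gfin unfolding C_def by (intro card_seteq)
      have "n \<in> (\<lambda>s. s \<odot>\<^bsub>cyc l\<^esub> n) ` carrier R"
        using nm by (intro image_eqI[of _ _ "\<one>"]) simp_all
      then show ?thesis unfolding eq[symmetric] by blast
    qed
  qed
qed

text \<open>The values \<open>(f x, f y)\<close> form the graph of a multiplication by a unit, up to a submodule \<open>S\<close>:
  both projections of the set of these pairs are the whole of \<open>values_at l\<close>, which is cyclic.\<close>

lemma pair_values:
  assumes x: "x \<in> E" and y: "y \<in> E"
  shows "\<exists>u S. u \<in> Units R \<and> submodule S R (cyc l) \<and> S \<subseteq> values_at l \<and>
    (\<forall>s\<in>values_at l. \<forall>t\<in>values_at l. (\<exists>f\<in>homs l. f x = s \<and> f y = t) \<longleftrightarrow> t \<ominus>\<^bsub>cyc l\<^esub> u \<odot>\<^bsub>cyc l\<^esub> s \<in> S)"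
proof -
  have values_at: "submodule (values_at l) R (cyc l)" using values_at_submodule x by auto
  have hN: "values_at l \<subseteq> carrier (cyc l)" by (rule N.submoduleE(1)[OF values_at])
  note lin_plus = linear_maps_plus[OF M_module cyc_module] and lin_minus = linear_maps_minus_fun[OF M_module cyc_module]
    and lin_smult = linear_maps_smult_fun[OF M_module cyc_module]
  \<comment> \<open>Two maps with the same value at \<open>x\<close> differ at \<open>y\<close> by
    an element of \<open>S\<close>; this is the ambiguity of the graph.\<close>
  define S where "S = {f y | f. f \<in> homs l \<and> f x = \<zero>\<^bsub>cyc l\<^esub>}"
  have SI: "f y \<in> S" if "f \<in> homs l" "f x = \<zero>\<^bsub>cyc l\<^esub>" for f using that by (auto simp: S_def)
  have S: "submodule S R (cyc l)"
  proof (rule N.submoduleI)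
    show "S \<subseteq> carrier (cyc l)" using linear_maps_closed[OF _ E_carrier[OF y]] by (auto simp: S_def)
    show "\<zero>\<^bsub>cyc l\<^esub> \<in> S" using SI[OF linear_maps_zero_fun[OF M_module cyc_module]] by simp
    fix m assume "m \<in> S"
    then obtain f where f: "f \<in> homs l" "f x = \<zero>\<^bsub>cyc l\<^esub>" "f y = m" by (auto simp: S_def)
    show "\<ominus>\<^bsub>cyc l\<^esub> m \<in> S" using SI[OF lin_minus[OF f(1)]] f by simp
    show "r \<odot>\<^bsub>cyc l\<^esub> m \<in> S" if "r \<in> carrier R" for r using SI[OF lin_smult[OF f(1) that]] f that by simp
    fix n assume "n \<in> S"
    then obtain h where h: "h \<in> homs l" "h x = \<zero>\<^bsub>cyc l\<^esub>" "h y = n" by (auto simp: S_def)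
    show "m \<oplus>\<^bsub>cyc l\<^esub> n \<in> S" using SI[OF lin_plus[OF f(1) h(1)]] f h by simp
  qed
  note S_add = N.submoduleE(5)[OF S] and S_smult = N.submoduleE(4)[OF S]
  have Sh: "S \<subseteq> values_at l" using values_atI[OF _ y] by (auto simp: S_def)
  obtain m where m: "m \<in> values_at l" "\<And>n. n \<in> values_at l \<Longrightarrow> \<exists>r\<in>carrier R. n = r \<odot>\<^bsub>cyc l\<^esub> m"
    using submodule_cyclic[OF values_at] by metis
  have mN: "m \<in> carrier (cyc l)" using m hN by auto
  obtain f0 where f0: "f0 \<in> homs l" "f0 x = m" using values_atE[OF m(1) x] .
  define w where "w = f0 y"
  have w: "w \<in> values_at l" unfolding w_def by (rule values_atI[OF f0(1) y])
  then have wN: "w \<in> carrier (cyc l)" using hN by auto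
  obtain r0 where r0: "r0 \<in> carrier R" "w = r0 \<odot>\<^bsub>cyc l\<^esub> m" using m(2)[OF w] by auto
  have "\<exists>u\<in>Units R. w \<ominus>\<^bsub>cyc l\<^esub> u \<odot>\<^bsub>cyc l\<^esub> m \<in> S"
    using unit_or_multiple[OF r0(1)]
  proof
    assume u: "r0 \<in> Units R"
    have "w \<ominus>\<^bsub>cyc l\<^esub> r0 \<odot>\<^bsub>cyc l\<^esub> m \<in> S" using wN N.submodule_zero[OF S] by (simp add: r0(2)[symmetric] a_minus_def N.M.r_neg)
    then show ?thesis using u by blast
  next
    assume "\<exists>s\<in>carrier R. r0 = p \<otimes> s"
    then obtain s where s: "s \<in> carrier R" "r0 = p \<otimes> s" by auto
    \<comment> \<open>In this case \<open>m\<close> itself lies in \<open>S\<close>, so any unit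
      serves and 1 is taken: \<open>f1 - r1 f0\<close> kills \<open>x\<close> and sends
      \<open>y\<close> to \<open>(1 - p s r1) m\<close>, a unit multiple of
      \<open>m\<close>.\<close>
    obtain f1 where f1: "f1 \<in> homs l" "f1 y = m" using values_atE[OF m(1) y] .
    obtain r1 where r1: "r1 \<in> carrier R" "f1 x = r1 \<odot>\<^bsub>cyc l\<^esub> m" using m(2)[OF values_atI[OF f1(1) x]] by auto
    have "f1 y \<oplus>\<^bsub>cyc l\<^esub> (\<ominus>\<^bsub>cyc l\<^esub> (r1 \<odot>\<^bsub>cyc l\<^esub> f0 y)) \<in> S"
      by (rule SI[OF lin_plus[OF f1(1) lin_minus[OF lin_smult[OF f0(1) r1(1)]]]])
        (use f0 r1 mN in \<open>simp add: N.M.r_neg\<close>)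
    moreover have "f1 y \<oplus>\<^bsub>cyc l\<^esub> (\<ominus>\<^bsub>cyc l\<^esub> (r1 \<odot>\<^bsub>cyc l\<^esub> f0 y)) = (\<one> \<ominus> p \<otimes> (s \<otimes> r1)) \<odot>\<^bsub>cyc l\<^esub> m"
    proof -
      have "r1 \<odot>\<^bsub>cyc l\<^esub> w = (r1 \<otimes> r0) \<odot>\<^bsub>cyc l\<^esub> m" unfolding r0(2) using r0(1) r1(1) mN by (simp add: N.smult_assoc1)
      also have "r1 \<otimes> r0 = p \<otimes> (s \<otimes> r1)" unfolding s(2) using s r1 p_closed by algebra
      finally show ?thesis using f1 s r1 mN by (simp add: w_def[symmetric] a_minus_def N.smult_l_distr N.smult_l_minus)
    qed
    ultimately have "(\<one> \<ominus> p \<otimes> (s \<otimes> r1)) \<odot>\<^bsub>cyc l\<^esub> m \<in> S" by simp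
    moreover have v: "\<one> \<ominus> p \<otimes> (s \<otimes> r1) \<in> Units R" using one_minus_multiple_unit s r1 by simp
    ultimately have mS: "m \<in> S"
      using S_smult[OF Units_inv_closed[OF v]] N.unit_smult_cancel(1)[OF v mN] by metis
    have "w \<ominus>\<^bsub>cyc l\<^esub> \<one> \<odot>\<^bsub>cyc l\<^esub> m \<in> S"
      using S_smult[OF r0(1) mS] mS mN by (auto simp: r0(2) intro!: N.submodule_diff[OF S])
    then show ?thesis by blast
  qed
  then obtain u where u: "u \<in> Units R" "w \<ominus>\<^bsub>cyc l\<^esub> u \<odot>\<^bsub>cyc l\<^esub> m \<in> S" by auto
  have uR: "u \<in> carrier R" using u by (simp add: Units_closed)
  \<comment> \<open>Write \<open>s = a m\<close>. A map with value \<open>s\<close> at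
    \<open>x\<close> differs from \<open>a f0\<close> by one that kills \<open>x\<close>, so the
    possible \<open>t\<close> form the coset of \<open>a w\<close>, which is the coset of
    \<open>u s\<close> modulo \<open>S\<close>.\<close>
  have "(\<exists>f\<in>homs l. f x = s \<and> f y = t) \<longleftrightarrow> t \<ominus>\<^bsub>cyc l\<^esub> u \<odot>\<^bsub>cyc l\<^esub> s \<in> S" if s: "s \<in> values_at l" and t: "t \<in> values_at l" for s t
  proof -
    have stN: "s \<in> carrier (cyc l)" "t \<in> carrier (cyc l)" using s t hN by auto
    obtain a where a: "a \<in> carrier R" "s = a \<odot>\<^bsub>cyc l\<^esub> m" using m(2)[OF s] by auto
    have awS: "a \<odot>\<^bsub>cyc l\<^esub> w \<ominus>\<^bsub>cyc l\<^esub> u \<odot>\<^bsub>cyc l\<^esub> s \<in> S"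
      using S_smult[OF a(1) u(2)] a uR mN wN by (simp add: N.smult_diff N.smult_commute[OF uR a(1) mN])
    have awN: "a \<odot>\<^bsub>cyc l\<^esub> w \<in> carrier (cyc l)" "u \<odot>\<^bsub>cyc l\<^esub> s \<in> carrier (cyc l)" using a uR wN stN by auto
    have split: "(t \<ominus>\<^bsub>cyc l\<^esub> q) \<oplus>\<^bsub>cyc l\<^esub> (q \<ominus>\<^bsub>cyc l\<^esub> v) = t \<ominus>\<^bsub>cyc l\<^esub> v"
      if "q \<in> carrier (cyc l)" "v \<in> carrier (cyc l)" for q v
      using that stN by (simp add: a_minus_def N.M.a_assoc N.M.r_neg1)
    show ?thesis
    proof
      assume "\<exists>f\<in>homs l. f x = s \<and> f y = t"
      then obtain f where f: "f \<in> homs l" "f x = s" "f y = t" by auto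
      have "f y \<oplus>\<^bsub>cyc l\<^esub> (\<ominus>\<^bsub>cyc l\<^esub> (a \<odot>\<^bsub>cyc l\<^esub> f0 y)) \<in> S"
        by (rule SI[OF lin_plus[OF f(1) lin_minus[OF lin_smult[OF f0(1) a(1)]]]])
          (use f0 a f stN in \<open>simp add: N.M.r_neg\<close>)
      then have "t \<ominus>\<^bsub>cyc l\<^esub> a \<odot>\<^bsub>cyc l\<^esub> w \<in> S" using f by (simp add: a_minus_def w_def)
      then show "t \<ominus>\<^bsub>cyc l\<^esub> u \<odot>\<^bsub>cyc l\<^esub> s \<in> S" using S_add[OF _ awS] split[OF awN] by metis
    next
      assume "t \<ominus>\<^bsub>cyc l\<^esub> u \<odot>\<^bsub>cyc l\<^esub> s \<in> S"
      then have "(t \<ominus>\<^bsub>cyc l\<^esub> u \<odot>\<^bsub>cyc l\<^esub> s) \<ominus>\<^bsub>cyc l\<^esub> (a \<odot>\<^bsub>cyc l\<^esub> w \<ominus>\<^bsub>cyc l\<^esub> u \<odot>\<^bsub>cyc l\<^esub> s) \<in> S"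
        using awS by (rule N.submodule_diff[OF S])
      also have "(t \<ominus>\<^bsub>cyc l\<^esub> u \<odot>\<^bsub>cyc l\<^esub> s) \<ominus>\<^bsub>cyc l\<^esub> (a \<odot>\<^bsub>cyc l\<^esub> w \<ominus>\<^bsub>cyc l\<^esub> u \<odot>\<^bsub>cyc l\<^esub> s) = t \<ominus>\<^bsub>cyc l\<^esub> a \<odot>\<^bsub>cyc l\<^esub> w"
        by (rule N.diff_diff[OF stN(2) awN])
      finally obtain h where h: "h \<in> homs l" "h x = \<zero>\<^bsub>cyc l\<^esub>" "h y = t \<ominus>\<^bsub>cyc l\<^esub> a \<odot>\<^bsub>cyc l\<^esub> w"
        by (auto simp: S_def)
      show "\<exists>f\<in>homs l. f x = s \<and> f y = t"
      proof (intro bexI conjI)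
        show "(\<lambda>z. h z \<oplus>\<^bsub>cyc l\<^esub> a \<odot>\<^bsub>cyc l\<^esub> f0 z) \<in> homs l" by (rule lin_plus[OF h(1) lin_smult[OF f0(1) a(1)]])
        show "h x \<oplus>\<^bsub>cyc l\<^esub> a \<odot>\<^bsub>cyc l\<^esub> f0 x = s" using h f0 a stN by simp
        show "h y \<oplus>\<^bsub>cyc l\<^esub> a \<odot>\<^bsub>cyc l\<^esub> f0 y = t"
          using h awN stN by (simp add: w_def[symmetric] a_minus_def N.M.a_assoc N.M.l_neg)
      qed
    qed
  qed
  then show ?thesis using u S Sh by blast
qed

section \<open>The preorder on pairs and its description by congruences\<close>

text \<open>Inclusion of the \<open>End M\<close>-submodules of \<open>M \<times> M\<close> generated by the two pairs.\<close>

definition pair_le :: "('i \<Rightarrow> 'a set) \<times> ('i \<Rightarrow> 'a set) \<Rightarrow> ('i \<Rightarrow> 'a set) \<times> ('i \<Rightarrow> 'a set) \<Rightarrow> bool" where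
  "pair_le q q0 \<longleftrightarrow> (\<exists>a\<in>linear_maps R M M. a (fst q0) = fst q \<and> a (snd q0) = snd q)"

lemma pair_le_refl: "pair_le q q"
  unfolding pair_le_def by (rule bexI[OF _ linear_maps_id]) simp

lemma pair_le_trans:
  assumes "pair_le q1 q2" "pair_le q2 q3"
  shows "pair_le q1 q3"
proof -
  obtain a b where a: "a \<in> linear_maps R M M" "a (fst q2) = fst q1" "a (snd q2) = snd q1"
    and b: "b \<in> linear_maps R M M" "b (fst q3) = fst q2" "b (snd q3) = snd q2"
    using assms by (auto simp: pair_le_def)
  show ?thesis unfolding pair_le_def
    by (rule bexI[OF _ linear_maps_compose[OF b(1) a(1)]]) (simp add: a b)
qed

text \<open>The predicate \<open>Q\<close> carries a further demand on the chosen components: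
  hitting a second target in \<open>pair_le_iff\<close>, and \<open>True\<close> when only one
  target is prescribed.\<close>

lemma tuple_of_homs:
  assumes x: "x \<in> carrier M" and y: "y \<in> carrier M"
    and ex: "\<And>c. c \<in> I \<Longrightarrow> \<exists>f\<in>homs (len c). f x = y c \<and> Q c f"
  obtains f where "\<forall>c\<in>I. f c \<in> homs (len c) \<and> Q c (f c)"
    "(\<lambda>z. \<lambda>c\<in>I. f c z) \<in> linear_maps R M M" "(\<lambda>c\<in>I. f c x) = y"
proof -
  obtain f where f: "\<And>c. c \<in> I \<Longrightarrow> f c \<in> homs (len c) \<and> f c x = y c \<and> Q c (f c)"
    using ex by metis
  have lin: "(\<lambda>z. \<lambda>c\<in>I. f c z) \<in> linear_maps R M M"
    using f by (intro tuple_linear[OF M_module]) blast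
  moreover have "(\<lambda>c\<in>I. f c x) = y"
    using f y by (intro M_eqI linear_maps_closed[OF lin x]) simp_all
  ultimately show thesis using that f by blast
qed

text \<open>An endomorphism is a family of maps to the factors, so the condition splits over
  components. The data \<open>u\<close> and \<open>S\<close> depend on the length alone, which lets
  whole homogeneous blocks be treated at once.\<close>

lemma pair_le_iff:
  assumes "x0 \<in> E" "y0 \<in> E"
  obtains u S where "\<And>l. u l \<in> Units R" "\<And>l. submodule (S l) R (cyc l)" "\<And>l. S l \<subseteq> values_at l"
    "\<And>x y. x \<in> E \<Longrightarrow> y \<in> E \<Longrightarrow> pair_le (x, y) (x0, y0) \<longleftrightarrow>
      (\<forall>c\<in>I. y c \<ominus>\<^bsub>cyc (len c)\<^esub> u (len c) \<odot>\<^bsub>cyc (len c)\<^esub> x c \<in> S (len c))"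
proof -
  obtain u S where uS: "\<And>l. u l \<in> Units R" "\<And>l. submodule (S l) R (cyc l)" "\<And>l. S l \<subseteq> values_at l"
    "\<And>l s t. s \<in> values_at l \<Longrightarrow> t \<in> values_at l \<Longrightarrow>
      (\<exists>f\<in>homs l. f x0 = s \<and> f y0 = t) \<longleftrightarrow> t \<ominus>\<^bsub>cyc l\<^esub> u l \<odot>\<^bsub>cyc l\<^esub> s \<in> S l"
    using pair_values[OF assms] by metis
  have "pair_le (x, y) (x0, y0) \<longleftrightarrow>
      (\<forall>c\<in>I. y c \<ominus>\<^bsub>cyc (len c)\<^esub> u (len c) \<odot>\<^bsub>cyc (len c)\<^esub> x c \<in> S (len c))"
    if xy: "x \<in> E" "y \<in> E" for x y
  proof -
    have "pair_le (x, y) (x0, y0) \<longleftrightarrow> (\<forall>c\<in>I. \<exists>f\<in>homs (len c). f x0 = x c \<and> f y0 = y c)"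
    proof
      assume "pair_le (x, y) (x0, y0)"
      then obtain a where a: "a \<in> linear_maps R M M" "a x0 = x" "a y0 = y" by (auto simp: pair_le_def)
      show "\<forall>c\<in>I. \<exists>f\<in>homs (len c). f x0 = x c \<and> f y0 = y c"
      proof
        fix c assume "c \<in> I"
        then have "(\<lambda>z. a z c) \<in> homs (len c)" using linear_maps_compose[OF a(1) proj_linear] by blast
        then show "\<exists>f\<in>homs (len c). f x0 = x c \<and> f y0 = y c" using a by (intro bexI[of _ "\<lambda>z. a z c"]) simp_all
      qed
    next
      assume "\<forall>c\<in>I. \<exists>f\<in>homs (len c). f x0 = x c \<and> f y0 = y c"
      then have ex: "\<exists>f\<in>homs (len c). f x0 = x c \<and> f y0 = y c" if "c \<in> I" for c using that by blast
      obtain f where f: "\<forall>c\<in>I. f c \<in> homs (len c) \<and> f c y0 = y c"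
        "(\<lambda>z. \<lambda>c\<in>I. f c z) \<in> linear_maps R M M" "(\<lambda>c\<in>I. f c x0) = x"
        by (rule tuple_of_homs[OF E_carrier[OF assms(1)] E_carrier[OF xy(1)] ex]) (assumption | rule that)+
      have "(\<lambda>c\<in>I. f c y0) = y"
        using f(1) by (intro M_eqI linear_maps_closed[OF f(2)] E_carrier assms xy) simp
      then show "pair_le (x, y) (x0, y0)" unfolding pair_le_def using f by (intro bexI[OF _ f(2)]) simp
    qed
    also have "\<dots> \<longleftrightarrow> (\<forall>c\<in>I. y c \<ominus>\<^bsub>cyc (len c)\<^esub> u (len c) \<odot>\<^bsub>cyc (len c)\<^esub> x c \<in> S (len c))"
      using uS(4) comp_in_values_at xy by simp
    finally show ?thesis .
  qed
  then show thesis by (rule that[OF uS(1-3)])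
qed

section \<open>Membership in \<open>E\<close> tested block by block modulo \<open>p\<close>\<close>

text \<open>A form of Nakayama's lemma: it suffices to know each homogeneous block of \<open>y\<close> modulo \<open>p\<close>.
  If \<open>y\<close> failed to generate \<open>values_at l\<close>, then a point of \<open>E\<close> agreeing with a unit multiple of \<open>y\<close>
  modulo \<open>p\<close> in the block \<open>l\<close> shows that \<open>values_at l\<close> is the image of \<open>values_at l'\<close> for another
  such \<open>l'\<close>; this cannot happen when \<open>l\<close> is extremal.\<close>

lemma in_class_if_congruent_blocks:
  assumes y: "y \<in> carrier M"
    and block: "\<And>l. l \<in> len ` I \<Longrightarrow> \<exists>w\<in>E. \<exists>u\<in>Units R. \<forall>c\<in>I. len c = l \<longrightarrow>
      (\<exists>n\<in>values_at l. y c \<ominus>\<^bsub>cyc l\<^esub> u \<odot>\<^bsub>cyc l\<^esub> w c = p \<odot>\<^bsub>cyc l\<^esub> n)"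
    and x0: "x0 \<in> E"
  shows "y \<in> E"
proof -
  have vals: "submodule (values_at l) R (cyc l)" for l using values_at_submodule x0 by auto
  note v_carrier = subsetD[OF N.submoduleE(1)[OF vals]]
  note v_smult = N.submoduleE(4)[OF vals] and v_add = N.submoduleE(5)[OF vals]
  have yc: "y c \<in> carrier (cyc (len c))" if "c \<in> I" for c using M_comp(1)[OF that y] .
  have y_val: "y c \<in> values_at (len c)" if c: "c \<in> I" for c
  proof -
    obtain w u n where w: "w \<in> E" "u \<in> Units R" "n \<in> values_at (len c)"
      "y c \<ominus>\<^bsub>cyc (len c)\<^esub> u \<odot>\<^bsub>cyc (len c)\<^esub> w c = p \<odot>\<^bsub>cyc (len c)\<^esub> n"
      using block[of "len c"] c by blast
    have uw: "u \<odot>\<^bsub>cyc (len c)\<^esub> w c \<in> values_at (len c)"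
      using v_smult[OF Units_closed[OF w(2)] comp_in_values_at[OF c w(1)]] .
    have "y c = (y c \<ominus>\<^bsub>cyc (len c)\<^esub> u \<odot>\<^bsub>cyc (len c)\<^esub> w c) \<oplus>\<^bsub>cyc (len c)\<^esub> u \<odot>\<^bsub>cyc (len c)\<^esub> w c"
      using yc[OF c] v_carrier[OF uw] by (simp add: a_minus_def N.M.a_assoc N.M.l_neg)
    then show ?thesis using v_add[OF v_smult[OF p_closed w(3)] uw] w(4) by simp
  qed
  have ex: "\<exists>f\<in>homs (len c). f x0 = y c \<and> True" if c: "c \<in> I" for c
  proof -
    obtain f where f: "f \<in> homs (len c)" "f x0 = y c" by (rule values_atE[OF y_val[OF c] x0])
    show ?thesis by (rule bexI[OF _ f(1)]) (simp add: f(2))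
  qed
  obtain fa where a: "(\<lambda>z. \<lambda>c\<in>I. fa c z) \<in> linear_maps R M M" "(\<lambda>c\<in>I. fa c x0) = y"
    by (rule tuple_of_homs[OF E_carrier[OF x0] y ex]) (assumption | rule that)+
  \<comment> \<open>The map carrying \<open>x0\<close> to \<open>y\<close> is at hand. By
    \<open>E_closed\<close> a map back is all that is missing, and for it \<open>y\<close> must
    generate the components of \<open>x0\<close>.\<close>
  define gens where "gens l = {f y | f. f \<in> homs l}" for l
  have gensI: "f y \<in> gens l" if "f \<in> homs l" for f l using that by (auto simp: gens_def)
  have gens_sub: "gens l \<subseteq> values_at l" for l
    using values_atI[OF linear_maps_compose[OF a(1)] x0] a(2) by (auto simp: gens_def)
  have gens: "submodule (gens l) R (cyc l)" for l
  proof (rule N.submoduleI)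
    show "gens l \<subseteq> carrier (cyc l)" using gens_sub v_carrier by blast
    show "\<zero>\<^bsub>cyc l\<^esub> \<in> gens l" by (rule gensI[OF linear_maps_zero_fun[OF M_module cyc_module]])
    fix m assume "m \<in> gens l"
    then obtain f where f: "f \<in> homs l" "m = f y" by (auto simp: gens_def)
    show "\<ominus>\<^bsub>cyc l\<^esub> m \<in> gens l" unfolding f(2) by (rule gensI[OF linear_maps_minus_fun[OF M_module cyc_module f(1)]])
    show "r \<odot>\<^bsub>cyc l\<^esub> m \<in> gens l" if "r \<in> carrier R" for r
      unfolding f(2) by (rule gensI[OF linear_maps_smult_fun[OF M_module cyc_module f(1) that]])
    fix n assume "n \<in> gens l"
    then obtain h where h: "h \<in> homs l" "n = h y" by (auto simp: gens_def)
    show "m \<oplus>\<^bsub>cyc l\<^esub> n \<in> gens l"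
      unfolding f(2) h(2) by (rule gensI[OF linear_maps_plus[OF M_module cyc_module f(1) h(1)]])
  qed
  have gens_map: "f n \<in> gens m" if "f \<in> linear_maps R (cyc l) (cyc m)" "n \<in> gens l" for f n l m
    using that linear_maps_compose[OF _ that(1), of _ M] by (auto simp: gens_def)
  define bad where "bad = {l \<in> len ` I. gens l \<noteq> values_at l}"
  have "bad = {}"
  proof (rule ccontr)
    assume "bad \<noteq> {}"
    have fin_bad: "finite bad" by (simp add: bad_def)
    \<comment> \<open>Take \<open>l\<close> with the largest \<open>values_at l\<close> among the
      bad lengths, and smallest among those. A bad length whose values map onto
      \<open>values_at l\<close> then has equally many values and is at least
      \<open>l\<close>.\<close>
    define C where "C l = card (values_at l)" for l
    define K where "K = Max (C ` bad)"
    have CK: "C l \<le> K" if "l \<in> bad" for l using that fin_bad by (simp add: K_def)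
    have "\<exists>l. l \<in> bad \<and> C l = K"
    proof -
      have "K \<in> C ` bad" unfolding K_def using fin_bad \<open>bad \<noteq> {}\<close> by (intro Max_in) auto
      then show ?thesis by auto
    qed
    then obtain l where l: "l \<in> bad" "C l = K" and l_min: "\<And>l'. l' \<in> bad \<Longrightarrow> C l' = K \<Longrightarrow> l \<le> l'"
      using exists_least_iff[of "\<lambda>l. l \<in> bad \<and> C l = K"] by (metis not_le)
    have lI: "l \<in> len ` I" "gens l \<noteq> values_at l" using l by (auto simp: bad_def)
    obtain m where m: "m \<in> values_at l" "\<And>n. n \<in> values_at l \<Longrightarrow> \<exists>r\<in>carrier R. n = r \<odot>\<^bsub>cyc l\<^esub> m"
      using submodule_cyclic[OF vals] by metis
    have mN: "m \<in> carrier (cyc l)" using v_carrier m(1) by auto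
    have m_gens: "m \<notin> gens l"
    proof
      assume mg: "m \<in> gens l"
      have "n \<in> gens l" if n: "n \<in> values_at l" for n
        using m(2)[OF n] N.submoduleE(4)[OF gens _ mg] by auto
      then show False using lI gens_sub by blast
    qed
    \<comment> \<open>\<open>pv\<close> is the largest proper submodule of
      \<open>values_at l\<close>, so it contains \<open>gens l\<close> once that is proper.\<close>
    define pv where "pv = {p \<odot>\<^bsub>cyc l\<^esub> n | n. n \<in> values_at l}"
    have pvI: "p \<odot>\<^bsub>cyc l\<^esub> n \<in> pv" if "n \<in> values_at l" for n using that by (auto simp: pv_def)
    have pv: "submodule pv R (cyc l)"
    proof (rule N.submoduleI)
      show "pv \<subseteq> carrier (cyc l)" using v_carrier by (auto simp: pv_def)
      show "\<zero>\<^bsub>cyc l\<^esub> \<in> pv" using pvI[OF N.submodule_zero[OF vals]] by simp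
      fix n assume "n \<in> pv"
      then obtain n' where n': "n' \<in> values_at l" "n = p \<odot>\<^bsub>cyc l\<^esub> n'" by (auto simp: pv_def)
      show "\<ominus>\<^bsub>cyc l\<^esub> n \<in> pv"
        using pvI[OF N.submoduleE(3)[OF vals n'(1)]] n' v_carrier by (simp add: N.smult_r_minus)
      show "r \<odot>\<^bsub>cyc l\<^esub> n \<in> pv" if "r \<in> carrier R" for r
        using pvI[OF v_smult[OF that n'(1)]] n' v_carrier that by (simp add: N.smult_commute[of r p])
      fix k assume "k \<in> pv"
      then obtain k' where k': "k' \<in> values_at l" "k = p \<odot>\<^bsub>cyc l\<^esub> k'" by (auto simp: pv_def)
      show "n \<oplus>\<^bsub>cyc l\<^esub> k \<in> pv"
        using pvI[OF v_add[OF n'(1) k'(1)]] n' k' v_carrier by (simp add: N.smult_r_distr)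
    qed
    note pv_smult = N.submoduleE(4)[OF pv]
    have m_pv: "m \<notin> pv"
    proof
      assume "m \<in> pv"
      then obtain n where n: "n \<in> values_at l" "m = p \<odot>\<^bsub>cyc l\<^esub> n" by (auto simp: pv_def)
      obtain r where r: "r \<in> carrier R" "n = r \<odot>\<^bsub>cyc l\<^esub> m" using m(2)[OF n(1)] by auto
      have "(p \<otimes> r) \<odot>\<^bsub>cyc l\<^esub> m = m" 
        by (simp only: N.smult_assoc1[OF p_closed r(1) mN] r(2)[symmetric] n(2)[symmetric])
      then have z: "(\<one> \<ominus> p \<otimes> r) \<odot>\<^bsub>cyc l\<^esub> m = \<zero>\<^bsub>cyc l\<^esub>"
        using r(1) mN by (simp add: a_minus_def N.smult_l_distr N.smult_l_minus N.M.r_neg)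
      have v: "\<one> \<ominus> p \<otimes> r \<in> Units R" using one_minus_multiple_unit r by simp
      have "m = \<zero>\<^bsub>cyc l\<^esub>" using N.unit_smult_cancel(1)[OF v mN] z v by simp
      then show False using m_gens N.submodule_zero[OF gens] by simp
    qed
    have gens_pv: "n \<in> pv" if "n \<in> gens l" for n
      using submodule_strict_divisible[OF gens vals m(1) m_gens that] pvI by metis
    obtain w u where w: "w \<in> E" "u \<in> Units R"
      "\<And>c. c \<in> I \<Longrightarrow> len c = l \<Longrightarrow> \<exists>n\<in>values_at l. y c \<ominus>\<^bsub>cyc l\<^esub> u \<odot>\<^bsub>cyc l\<^esub> w c = p \<odot>\<^bsub>cyc l\<^esub> n"
      using block[OF lI(1)] by blast
    have w_pv: "w c \<in> pv" if c: "c \<in> I" "len c = l" for c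
    proof -
      obtain n where n: "n \<in> values_at l" "y c \<ominus>\<^bsub>cyc l\<^esub> u \<odot>\<^bsub>cyc l\<^esub> w c = p \<odot>\<^bsub>cyc l\<^esub> n" using w(3)[OF c] by auto
      have wc: "w c \<in> carrier (cyc l)" "y c \<in> carrier (cyc l)" using M_comp(1)[OF c(1) E_carrier[OF w(1)]] yc[OF c(1)] c by auto
      have "y c \<in> gens l" using proj_linear[OF c(1)] c(2) by (auto simp: gens_def)
      then have "y c \<ominus>\<^bsub>cyc l\<^esub> (y c \<ominus>\<^bsub>cyc l\<^esub> u \<odot>\<^bsub>cyc l\<^esub> w c) \<in> pv"
        using N.submodule_diff[OF pv gens_pv] pvI[OF n(1)] n(2) by simp
      also have "y c \<ominus>\<^bsub>cyc l\<^esub> (y c \<ominus>\<^bsub>cyc l\<^esub> u \<odot>\<^bsub>cyc l\<^esub> w c) = u \<odot>\<^bsub>cyc l\<^esub> w c"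
        using N.diff_swap[of "y c" l "\<zero>\<^bsub>cyc l\<^esub>" "u \<odot>\<^bsub>cyc l\<^esub> w c"] wc Units_closed[OF w(2)] by (simp add: a_minus_def)
      finally have "inv u \<odot>\<^bsub>cyc l\<^esub> (u \<odot>\<^bsub>cyc l\<^esub> w c) \<in> pv" using pv_smult w(2) by simp
      then show ?thesis using N.unit_smult_cancel(1)[OF w(2) wc(1)] by simp
    qed
    obtain f where f: "f \<in> homs l" "f w = m" using values_atE[OF m(1) w(1)] .
    \<comment> \<open>The value \<open>m\<close> lies outside \<open>pv\<close> and is a sum of
      contributions of the components of \<open>w\<close>; so one component contributes outside
      \<open>pv\<close>. It cannot belong to block \<open>l\<close>, whose components lie in
      \<open>pv\<close> by \<open>w_pv\<close>.\<close>
    have "f w = (\<Oplus>\<^bsub>cyc l\<^esub>c\<in>I. f (inj_at c (w c)))"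
    proof -
      have i: "(\<lambda>c. inj_at c (w c)) \<in> I \<rightarrow> carrier M"
        using linear_maps_closed[OF inj_at_linear] M_comp(1)[OF _ E_carrier[OF w(1)]] by auto
      show ?thesis
        using linear_maps_finsum[OF M_module cyc_module f(1) finite_I i] sum_of_components[OF E_carrier[OF w(1)]] by simp
    qed
    then have "\<exists>c\<in>I. f (inj_at c (w c)) \<notin> pv"
      using N.submodule_finsum[OF pv finite_I, of "\<lambda>c. f (inj_at c (w c))"] m_pv f(2) by auto
    then obtain c where c: "c \<in> I" "f (inj_at c (w c)) \<notin> pv" by auto
    define f' where "f' n = f (inj_at c n)" for n
    have f': "f' \<in> linear_maps R (cyc (len c)) (cyc l)"
      using linear_maps_compose[OF inj_at_linear f(1)] by (simp add: f'_def[abs_def])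
    have wc: "w c \<in> values_at (len c)" by (rule comp_in_values_at[OF c(1) w(1)])
    obtain r where r: "r \<in> carrier R" "f' (w c) = r \<odot>\<^bsub>cyc l\<^esub> m" using m(2)[OF values_at_map[OF f' wc]] by auto
    have ru: "r \<in> Units R"
    proof (rule ccontr)
      assume "r \<notin> Units R"
      then obtain s where s: "s \<in> carrier R" "r = p \<otimes> s" using unit_or_multiple[OF r(1)] by auto
      have "f' (w c) \<in> pv" using pvI[OF v_smult[OF s(1) m(1)]] r s mN by (simp add: N.smult_assoc1)
      then show False using c(2) by (simp add: f'_def)
    qed
    have f'm: "f' (inv r \<odot>\<^bsub>cyc (len c)\<^esub> w c) = m"
      using linear_maps_smult[OF f' _ v_carrier[OF wc], of "inv r"] ru r(2) N.unit_smult_cancel(1)[OF ru mN] by simp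
    have m0: "inv r \<odot>\<^bsub>cyc (len c)\<^esub> w c \<in> values_at (len c)" using v_smult[OF _ wc] ru by simp
    have "len c \<noteq> l"
    proof
      assume lc: "len c = l"
      then obtain n where n: "n \<in> values_at l" "w c = p \<odot>\<^bsub>cyc l\<^esub> n" using w_pv[OF c(1)] by (auto simp: pv_def)
      have "f' (w c) = p \<odot>\<^bsub>cyc l\<^esub> f' n" using linear_maps_smult[OF f' p_closed, of n] n lc v_carrier by simp
      also have "\<dots> \<in> pv" using pvI values_at_map[OF f'] n lc by simp
      finally show False using c(2) by (simp add: f'_def)
    qed
    have bad_c: "len c \<in> bad"
    proof (rule ccontr)
      assume "len c \<notin> bad"
      then have "gens (len c) = values_at (len c)" using c(1) by (auto simp: bad_def)
      then have "m \<in> gens l" using gens_map[OF f', of "inv r \<odot>\<^bsub>cyc (len c)\<^esub> w c"] m0 f'm by simp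
      then show False using m_gens by simp
    qed
    have fin_v: "finite (values_at l')" for l'
      using finite_subset[OF N.submoduleE(1)[OF vals] finite_cyc] .
    have surj: "f' ` values_at (len c) = values_at l"
    proof
      show "f' ` values_at (len c) \<subseteq> values_at l" using values_at_map[OF f'] by auto
      show "values_at l \<subseteq> f' ` values_at (len c)"
      proof
        fix n assume "n \<in> values_at l"
        then obtain s where s: "s \<in> carrier R" "n = s \<odot>\<^bsub>cyc l\<^esub> m" using m(2) by auto
        have "n = f' (s \<odot>\<^bsub>cyc (len c)\<^esub> (inv r \<odot>\<^bsub>cyc (len c)\<^esub> w c))"
          using linear_maps_smult[OF f' s(1) v_carrier[OF m0]] f'm s(2) by simp
        then show "n \<in> f' ` values_at (len c)" using v_smult[OF s(1) m0] by (rule image_eqI)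
      qed
    qed
    have "C l \<le> C (len c)" unfolding C_def surj[symmetric] by (rule card_image_le[OF fin_v])
    then have Cc: "C (len c) = K" using CK[OF bad_c] l(2) by simp
    then have less: "l < len c" using l_min[OF bad_c] \<open>len c \<noteq> l\<close> by simp
    have inj: "inj_on f' (values_at (len c))"
      by (rule eq_card_imp_inj_on[OF fin_v]) (use surj Cc l(2) in \<open>simp add: C_def\<close>)
    have zc: "\<zero>\<^bsub>cyc (len c)\<^esub> \<in> values_at (len c)" by (rule N.submodule_zero[OF vals])
    define n where "n = inv r \<odot>\<^bsub>cyc (len c)\<^esub> w c"
    have n: "n \<in> values_at (len c)" "f' n = m" using m0 f'm by (simp_all add: n_def)
    have nN: "n \<in> carrier (cyc (len c))" using v_carrier[OF n(1)] .
    have f'0: "f' \<zero>\<^bsub>cyc (len c)\<^esub> = \<zero>\<^bsub>cyc l\<^esub>" by (rule linear_maps_zero[OF cyc_module cyc_module f'])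
    have n0: "n \<noteq> \<zero>\<^bsub>cyc (len c)\<^esub>" using n(2) f'0 m_gens N.submodule_zero[OF gens] by auto
    obtain v j where vj: "v \<in> Units R" "j < len c" "n = (p [^] j \<otimes> v) \<odot>\<^bsub>cyc (len c)\<^esub> gen (len c)"
      using cyc_cases[OF nN] n0 by metis
    \<comment> \<open>\<open>s\<close> is a nonzero socle element among the values at
      \<open>len c\<close>. Being a multiple of \<open>p^(len c - 1)\<close>, it dies in R/p^l
      because \<open>l < len c\<close>, against injectivity of \<open>f'\<close>.\<close>
    define s where "s = p [^] (len c - 1 - j) \<odot>\<^bsub>cyc (len c)\<^esub> n"
    have sv: "s \<in> values_at (len c)" unfolding s_def by (rule v_smult[OF p_pow_closed n(1)])
    have vc: "v \<in> carrier R" using vj(1) by (rule Units_closed)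
    have s_eq: "s = (p [^] (len c - 1) \<otimes> v) \<odot>\<^bsub>cyc (len c)\<^esub> gen (len c)"
    proof -
      have "p [^] (len c - 1 - j) \<otimes> (p [^] j \<otimes> v) = p [^] (len c - 1) \<otimes> v"
        using p_pow_add[of "len c - 1 - j" j] vj(2) vc by (simp add: m_assoc)
      then show ?thesis unfolding s_def vj(3) using vc by (simp flip: N.smult_assoc1)
    qed
    have "s \<noteq> \<zero>\<^bsub>cyc (len c)\<^esub>"
    proof
      assume "s = \<zero>\<^bsub>cyc (len c)\<^esub>"
      then obtain q where "q \<in> carrier R" "p [^] (len c - 1) \<otimes> v = p [^] len c \<otimes> q"
        using s_eq smult_gen_eq_0_iff[of "p [^] (len c - 1) \<otimes> v" "len c"] vc by auto
      then show False using power_unit_eq_power_multiple[OF vj(1)] less by fastforce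
    qed
    moreover have "f' s = \<zero>\<^bsub>cyc l\<^esub>"
    proof -
      have s2: "s = p [^] (len c - 1) \<odot>\<^bsub>cyc (len c)\<^esub> (v \<odot>\<^bsub>cyc (len c)\<^esub> gen (len c))"
        unfolding s_eq using vc by (simp add: N.smult_assoc1)
      have vg: "v \<odot>\<^bsub>cyc (len c)\<^esub> gen (len c) \<in> carrier (cyc (len c))" using vc by simp
      have "f' s = p [^] (len c - 1) \<odot>\<^bsub>cyc l\<^esub> f' (v \<odot>\<^bsub>cyc (len c)\<^esub> gen (len c))"
        unfolding s2 by (rule linear_maps_smult[OF f' p_pow_closed vg])
      also have "\<dots> = \<zero>\<^bsub>cyc l\<^esub>"
        using less by (intro cyc_power_zero linear_maps_closed[OF f' vg]) simp
      finally show ?thesis .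
    qed
    ultimately show False using inj_onD[OF inj _ sv zc] f'0 by simp
  qed
  then have "gens (len c) = values_at (len c)" if "c \<in> I" for c using that by (auto simp: bad_def)
  then have "x0 c \<in> gens (len c)" if "c \<in> I" for c
    using comp_in_values_at[OF that x0] that by simp
  then have ex': "\<exists>f\<in>homs (len c). f y = x0 c \<and> True" if "c \<in> I" for c
    using that unfolding gens_def by force
  obtain fb where b: "(\<lambda>z. \<lambda>c\<in>I. fb c z) \<in> linear_maps R M M" "(\<lambda>c\<in>I. fb c y) = x0"
    by (rule tuple_of_homs[OF y E_carrier[OF x0] ex']) (assumption | rule that)+
  show ?thesis using E_closed[OF x0 a(1) b(1)] a(2) b(2) by simp
qed

section \<open>The bijection that exchanges the two congruence conditions\<close>

text \<open>The middle points \<open>y\<close> with \<open>y \<equiv> u x\<close> modulo \<open>S\<close> and \<open>z \<equiv> u' y\<close> modulo \<open>S'\<close> are mapped to those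
  for \<open>(u', S')\<close> and \<open>(u, S)\<close> blockwise: by \<open>y \<mapsto> u' x + u\<inverse> (z - u' y)\<close> where \<open>S \<noteq> S'\<close>, and by
  \<open>y \<mapsto> u' u\<inverse> y\<close> where \<open>S = S'\<close>. In the second case the first formula could leave \<open>E\<close>.\<close>

definition middle :: "(nat \<Rightarrow> 'a) \<Rightarrow> (nat \<Rightarrow> 'a set set) \<Rightarrow> (nat \<Rightarrow> 'a) \<Rightarrow> (nat \<Rightarrow> 'a set set) \<Rightarrow>
    ('i \<Rightarrow> 'a set) \<Rightarrow> ('i \<Rightarrow> 'a set) \<Rightarrow> ('i \<Rightarrow> 'a set) set" where
  "middle u S u' S' x z = {y\<in>E. \<forall>c\<in>I. y c \<ominus>\<^bsub>cyc (len c)\<^esub> u (len c) \<odot>\<^bsub>cyc (len c)\<^esub> x c \<in> S (len c) \<and>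
     z c \<ominus>\<^bsub>cyc (len c)\<^esub> u' (len c) \<odot>\<^bsub>cyc (len c)\<^esub> y c \<in> S' (len c)}"

definition exchange :: "(nat \<Rightarrow> 'a) \<Rightarrow> (nat \<Rightarrow> 'a set set) \<Rightarrow> (nat \<Rightarrow> 'a) \<Rightarrow> (nat \<Rightarrow> 'a set set) \<Rightarrow>
    ('i \<Rightarrow> 'a set) \<Rightarrow> ('i \<Rightarrow> 'a set) \<Rightarrow> ('i \<Rightarrow> 'a set) \<Rightarrow> 'i \<Rightarrow> 'a set" where
  "exchange u S u' S' x z y = (\<lambda>c\<in>I.
     if S (len c) = S' (len c)
     then u' (len c) \<odot>\<^bsub>cyc (len c)\<^esub> (inv (u (len c)) \<odot>\<^bsub>cyc (len c)\<^esub> y c)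
     else u' (len c) \<odot>\<^bsub>cyc (len c)\<^esub> x c \<oplus>\<^bsub>cyc (len c)\<^esub>
       inv (u (len c)) \<odot>\<^bsub>cyc (len c)\<^esub> (z c \<ominus>\<^bsub>cyc (len c)\<^esub> u' (len c) \<odot>\<^bsub>cyc (len c)\<^esub> y c))"

context
  fixes u u' :: "nat \<Rightarrow> 'a" and S S' :: "nat \<Rightarrow> 'a set set" and x z :: "'i \<Rightarrow> 'a set"
  assumes u: "\<And>l. u l \<in> Units R" and u': "\<And>l. u' l \<in> Units R"
    and S: "\<And>l. submodule (S l) R (cyc l)" "\<And>l. S l \<subseteq> values_at l"
    and S': "\<And>l. submodule (S' l) R (cyc l)" "\<And>l. S' l \<subseteq> values_at l"
    and x: "x \<in> E" and z: "z \<in> E"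
begin

text \<open>For the new component \<open>e\<close> one has \<open>u e = u' y\<close>, so the
  condition towards \<open>z\<close> is unchanged, and \<open>e - u' x\<close> is a unit multiple of
  \<open>y - u x\<close>.\<close>

lemma exchange_equal_block:
  assumes c: "c \<in> I" and y: "y \<in> carrier M" and eq: "S (len c) = S' (len c)"
    and y1: "y c \<ominus>\<^bsub>cyc (len c)\<^esub> u (len c) \<odot>\<^bsub>cyc (len c)\<^esub> x c \<in> S (len c)"
    and y2: "z c \<ominus>\<^bsub>cyc (len c)\<^esub> u' (len c) \<odot>\<^bsub>cyc (len c)\<^esub> y c \<in> S' (len c)"
  shows "exchange u S u' S' x z y c \<ominus>\<^bsub>cyc (len c)\<^esub> u' (len c) \<odot>\<^bsub>cyc (len c)\<^esub> x c \<in> S' (len c)"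
    and "z c \<ominus>\<^bsub>cyc (len c)\<^esub> u (len c) \<odot>\<^bsub>cyc (len c)\<^esub> exchange u S u' S' x z y c \<in> S (len c)"
    and "u (len c) \<odot>\<^bsub>cyc (len c)\<^esub> (inv (u' (len c)) \<odot>\<^bsub>cyc (len c)\<^esub> exchange u S u' S' x z y c) = y c"
proof -
  define l where "l = len c"
  define e where "e = exchange u S u' S' x z y c"
  have e: "e = u' l \<odot>\<^bsub>cyc l\<^esub> (inv (u l) \<odot>\<^bsub>cyc l\<^esub> y c)" using c eq by (simp add: e_def l_def exchange_def)
  have N: "x c \<in> carrier (cyc l)" "y c \<in> carrier (cyc l)"
    using M_comp(1)[OF c] E_carrier[OF x] y by (simp_all add: l_def)
  have ul: "u l \<in> carrier R" "u' l \<in> carrier R" "inv (u l) \<in> carrier R"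
    using u u' by (simp_all add: Units_closed)
  have ue: "u l \<odot>\<^bsub>cyc l\<^esub> e = u' l \<odot>\<^bsub>cyc l\<^esub> y c"
    unfolding e N.smult_commute[OF ul(1,2) N.smult_closed[OF ul(3) N(2)]] N.unit_smult_cancel(2)[OF u N(2)] ..
  have "e \<ominus>\<^bsub>cyc l\<^esub> u' l \<odot>\<^bsub>cyc l\<^esub> x c = u' l \<odot>\<^bsub>cyc l\<^esub> (inv (u l) \<odot>\<^bsub>cyc l\<^esub> (y c \<ominus>\<^bsub>cyc l\<^esub> u l \<odot>\<^bsub>cyc l\<^esub> x c))"
    using N ul N.unit_smult_cancel(1)[OF u N(1)] by (simp add: e N.smult_diff)
  then have 1: "e \<ominus>\<^bsub>cyc l\<^esub> u' l \<odot>\<^bsub>cyc l\<^esub> x c \<in> S' l"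
    using N.submoduleE(4)[OF S'(1) ul(2) N.submoduleE(4)[OF S'(1) ul(3)]] y1 eq by (simp add: l_def)
  have 2: "z c \<ominus>\<^bsub>cyc l\<^esub> u l \<odot>\<^bsub>cyc l\<^esub> e \<in> S l" using y2 eq by (simp add: ue) (simp add: l_def)
  have iu': "inv (u' l) \<odot>\<^bsub>cyc l\<^esub> e = inv (u l) \<odot>\<^bsub>cyc l\<^esub> y c"
    unfolding e by (rule N.unit_smult_cancel(1)[OF u' N.smult_closed[OF ul(3) N(2)]])
  have 3: "u l \<odot>\<^bsub>cyc l\<^esub> (inv (u' l) \<odot>\<^bsub>cyc l\<^esub> e) = y c"
    unfolding iu' by (rule N.unit_smult_cancel(2)[OF u N(2)])
  show "exchange u S u' S' x z y c \<ominus>\<^bsub>cyc (len c)\<^esub> u' (len c) \<odot>\<^bsub>cyc (len c)\<^esub> x c \<in> S' (len c)"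
    "z c \<ominus>\<^bsub>cyc (len c)\<^esub> u (len c) \<odot>\<^bsub>cyc (len c)\<^esub> exchange u S u' S' x z y c \<in> S (len c)"
    "u (len c) \<odot>\<^bsub>cyc (len c)\<^esub> (inv (u' (len c)) \<odot>\<^bsub>cyc (len c)\<^esub> exchange u S u' S' x z y c) = y c"
    using 1 2 3 by (simp_all add: e_def l_def)
qed

text \<open>The new component is chosen so that its two differences are unit multiples of the old
  ones in swapped order. The third identity places it near a unit multiple of \<open>z\<close>, for
  use when \<open>S\<close> is the smaller submodule; the fourth says that the swapped formula
  undoes the substitution.\<close>

lemma exchange_unequal_block:
  assumes c: "c \<in> I" and y: "y \<in> carrier M" and neq: "S (len c) \<noteq> S' (len c)"
  shows "exchange u S u' S' x z y c \<ominus>\<^bsub>cyc (len c)\<^esub> u' (len c) \<odot>\<^bsub>cyc (len c)\<^esub> x c =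
      inv (u (len c)) \<odot>\<^bsub>cyc (len c)\<^esub> (z c \<ominus>\<^bsub>cyc (len c)\<^esub> u' (len c) \<odot>\<^bsub>cyc (len c)\<^esub> y c)"
    and "z c \<ominus>\<^bsub>cyc (len c)\<^esub> u (len c) \<odot>\<^bsub>cyc (len c)\<^esub> exchange u S u' S' x z y c =
      u' (len c) \<odot>\<^bsub>cyc (len c)\<^esub> (y c \<ominus>\<^bsub>cyc (len c)\<^esub> u (len c) \<odot>\<^bsub>cyc (len c)\<^esub> x c)"
    and "exchange u S u' S' x z y c \<ominus>\<^bsub>cyc (len c)\<^esub> inv (u (len c)) \<odot>\<^bsub>cyc (len c)\<^esub> z c =
      \<ominus>\<^bsub>cyc (len c)\<^esub> (inv (u (len c)) \<odot>\<^bsub>cyc (len c)\<^esub> (u' (len c) \<odot>\<^bsub>cyc (len c)\<^esub>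
        (y c \<ominus>\<^bsub>cyc (len c)\<^esub> u (len c) \<odot>\<^bsub>cyc (len c)\<^esub> x c)))"
    and "u (len c) \<odot>\<^bsub>cyc (len c)\<^esub> x c \<oplus>\<^bsub>cyc (len c)\<^esub> inv (u' (len c)) \<odot>\<^bsub>cyc (len c)\<^esub>
      (z c \<ominus>\<^bsub>cyc (len c)\<^esub> u (len c) \<odot>\<^bsub>cyc (len c)\<^esub> exchange u S u' S' x z y c) = y c"
proof -
  define l where "l = len c"
  define e where "e = exchange u S u' S' x z y c"
  define d where "d = z c \<ominus>\<^bsub>cyc l\<^esub> u' l \<odot>\<^bsub>cyc l\<^esub> y c"
  have e: "e = u' l \<odot>\<^bsub>cyc l\<^esub> x c \<oplus>\<^bsub>cyc l\<^esub> inv (u l) \<odot>\<^bsub>cyc l\<^esub> d"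
    using c neq by (simp add: e_def l_def d_def exchange_def)
  have N: "x c \<in> carrier (cyc l)" "y c \<in> carrier (cyc l)" "z c \<in> carrier (cyc l)"
    using M_comp(1)[OF c] E_carrier[OF x] E_carrier[OF z] y by (simp_all add: l_def)
  have ul: "u l \<in> carrier R" "u' l \<in> carrier R" "inv (u l) \<in> carrier R"
    using u u' by (simp_all add: Units_closed)
  have uN: "u l \<odot>\<^bsub>cyc l\<^esub> x c \<in> carrier (cyc l)" "u' l \<odot>\<^bsub>cyc l\<^esub> x c \<in> carrier (cyc l)"
    "u' l \<odot>\<^bsub>cyc l\<^esub> y c \<in> carrier (cyc l)" "d \<in> carrier (cyc l)" "inv (u l) \<odot>\<^bsub>cyc l\<^esub> d \<in> carrier (cyc l)"
    using N ul by (simp_all add: d_def)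
  have 1: "e \<ominus>\<^bsub>cyc l\<^esub> u' l \<odot>\<^bsub>cyc l\<^esub> x c = inv (u l) \<odot>\<^bsub>cyc l\<^esub> d"
    unfolding e by (rule N.add_diff_cancel[OF uN(2,5)])
  have ue: "u l \<odot>\<^bsub>cyc l\<^esub> e = u' l \<odot>\<^bsub>cyc l\<^esub> (u l \<odot>\<^bsub>cyc l\<^esub> x c) \<oplus>\<^bsub>cyc l\<^esub> d"
    unfolding e N.smult_r_distr[OF ul(1) uN(2,5)] N.unit_smult_cancel(2)[OF u uN(4)] N.smult_commute[OF ul(1,2) N(1)] ..
  have 2: "z c \<ominus>\<^bsub>cyc l\<^esub> u l \<odot>\<^bsub>cyc l\<^esub> e = u' l \<odot>\<^bsub>cyc l\<^esub> (y c \<ominus>\<^bsub>cyc l\<^esub> u l \<odot>\<^bsub>cyc l\<^esub> x c)"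
    unfolding ue d_def N.diff_swap[OF N(3) N.smult_closed[OF ul(2) uN(1)] uN(3)] N.smult_diff[OF ul(2) N(2) uN(1)] ..
  have ueN: "e \<in> carrier (cyc l)" "u l \<odot>\<^bsub>cyc l\<^esub> e \<in> carrier (cyc l)" using uN ul by (simp_all add: e)
  have "e \<ominus>\<^bsub>cyc l\<^esub> inv (u l) \<odot>\<^bsub>cyc l\<^esub> z c = \<ominus>\<^bsub>cyc l\<^esub> (inv (u l) \<odot>\<^bsub>cyc l\<^esub> (z c \<ominus>\<^bsub>cyc l\<^esub> u l \<odot>\<^bsub>cyc l\<^esub> e))"
  proof -
    have "inv (u l) \<odot>\<^bsub>cyc l\<^esub> (z c \<ominus>\<^bsub>cyc l\<^esub> u l \<odot>\<^bsub>cyc l\<^esub> e) = inv (u l) \<odot>\<^bsub>cyc l\<^esub> z c \<ominus>\<^bsub>cyc l\<^esub> e"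
      using N.smult_diff[OF ul(3) N(3) ueN(2)] N.unit_smult_cancel(1)[OF u ueN(1)] by simp
    then show ?thesis using N(3) ul(3) ueN by (simp add: a_minus_def N.M.minus_add N.M.a_comm)
  qed
  then have 3: "e \<ominus>\<^bsub>cyc l\<^esub> inv (u l) \<odot>\<^bsub>cyc l\<^esub> z c =
      \<ominus>\<^bsub>cyc l\<^esub> (inv (u l) \<odot>\<^bsub>cyc l\<^esub> (u' l \<odot>\<^bsub>cyc l\<^esub> (y c \<ominus>\<^bsub>cyc l\<^esub> u l \<odot>\<^bsub>cyc l\<^esub> x c)))"
    unfolding 2 .
  have 4: "u l \<odot>\<^bsub>cyc l\<^esub> x c \<oplus>\<^bsub>cyc l\<^esub> inv (u' l) \<odot>\<^bsub>cyc l\<^esub> (z c \<ominus>\<^bsub>cyc l\<^esub> u l \<odot>\<^bsub>cyc l\<^esub> e) = y c"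
    unfolding 2 N.unit_smult_cancel(1)[OF u' N.M.minus_closed[OF N(2) uN(1)]]
    using N(2) uN(1) by (subst N.M.a_comm) (simp_all add: a_minus_def N.M.a_assoc N.M.l_neg)
  show "exchange u S u' S' x z y c \<ominus>\<^bsub>cyc (len c)\<^esub> u' (len c) \<odot>\<^bsub>cyc (len c)\<^esub> x c =
      inv (u (len c)) \<odot>\<^bsub>cyc (len c)\<^esub> (z c \<ominus>\<^bsub>cyc (len c)\<^esub> u' (len c) \<odot>\<^bsub>cyc (len c)\<^esub> y c)"
    using 1 unfolding e_def d_def l_def .
  show "z c \<ominus>\<^bsub>cyc (len c)\<^esub> u (len c) \<odot>\<^bsub>cyc (len c)\<^esub> exchange u S u' S' x z y c =
      u' (len c) \<odot>\<^bsub>cyc (len c)\<^esub> (y c \<ominus>\<^bsub>cyc (len c)\<^esub> u (len c) \<odot>\<^bsub>cyc (len c)\<^esub> x c)"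
    using 2 unfolding e_def l_def .
  show "exchange u S u' S' x z y c \<ominus>\<^bsub>cyc (len c)\<^esub> inv (u (len c)) \<odot>\<^bsub>cyc (len c)\<^esub> z c =
      \<ominus>\<^bsub>cyc (len c)\<^esub> (inv (u (len c)) \<odot>\<^bsub>cyc (len c)\<^esub> (u' (len c) \<odot>\<^bsub>cyc (len c)\<^esub>
        (y c \<ominus>\<^bsub>cyc (len c)\<^esub> u (len c) \<odot>\<^bsub>cyc (len c)\<^esub> x c)))"
    using 3 unfolding e_def l_def .
  show "u (len c) \<odot>\<^bsub>cyc (len c)\<^esub> x c \<oplus>\<^bsub>cyc (len c)\<^esub> inv (u' (len c)) \<odot>\<^bsub>cyc (len c)\<^esub>
      (z c \<ominus>\<^bsub>cyc (len c)\<^esub> u (len c) \<odot>\<^bsub>cyc (len c)\<^esub> exchange u S u' S' x z y c) = y c"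
    using 4 unfolding e_def l_def .
qed

text \<open>The congruences come from the block identities; what needs an argument is that the new
  vector stays in \<open>E\<close>. Different blocks may be compared with different points among
  \<open>x\<close>, \<open>y\<close> and \<open>z\<close>.\<close>

lemma exchange_middle:
  assumes y: "y \<in> middle u S u' S' x z"
  shows "exchange u S u' S' x z y \<in> middle u' S' u S x z"
    and "exchange u' S' u S x z (exchange u S u' S' x z y) = y"
proof -
  let ?e = "exchange u S u' S' x z y"
  have yE: "y \<in> E" using y by (simp add: middle_def)
  have y1: "y c \<ominus>\<^bsub>cyc (len c)\<^esub> u (len c) \<odot>\<^bsub>cyc (len c)\<^esub> x c \<in> S (len c)"
    and y2: "z c \<ominus>\<^bsub>cyc (len c)\<^esub> u' (len c) \<odot>\<^bsub>cyc (len c)\<^esub> y c \<in> S' (len c)" if "c \<in> I" for c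
    using y that by (auto simp: middle_def)
  have uR: "u l \<in> carrier R" "u' l \<in> carrier R" "inv (u l) \<in> carrier R" "inv (u' l) \<in> carrier R" for l
    using u u' by (simp_all add: Units_closed)
  note yM = E_carrier[OF yE] and xM = E_carrier[OF x] and zM = E_carrier[OF z]
  note comps = M_comp(1)[OF _ yM] M_comp(1)[OF _ xM] M_comp(1)[OF _ zM]
  have vals: "submodule (values_at l) R (cyc l)" for l using values_at_submodule x by auto
  have eM: "?e \<in> carrier M" using comps uR by (auto simp: M_carrier exchange_def)
  have e1: "?e c \<ominus>\<^bsub>cyc (len c)\<^esub> u' (len c) \<odot>\<^bsub>cyc (len c)\<^esub> x c \<in> S' (len c)"
    and e2: "z c \<ominus>\<^bsub>cyc (len c)\<^esub> u (len c) \<odot>\<^bsub>cyc (len c)\<^esub> ?e c \<in> S (len c)" if c: "c \<in> I" for c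
  proof -
    show "?e c \<ominus>\<^bsub>cyc (len c)\<^esub> u' (len c) \<odot>\<^bsub>cyc (len c)\<^esub> x c \<in> S' (len c)"
      using exchange_equal_block(1)[OF c yM _ y1[OF c] y2[OF c]] exchange_unequal_block(1)[OF c yM]
        N.submoduleE(4)[OF S'(1) uR(3) y2[OF c]]
      by (cases "S (len c) = S' (len c)") simp_all
    show "z c \<ominus>\<^bsub>cyc (len c)\<^esub> u (len c) \<odot>\<^bsub>cyc (len c)\<^esub> ?e c \<in> S (len c)"
      using exchange_equal_block(2)[OF c yM _ y1[OF c] y2[OF c]] exchange_unequal_block(2)[OF c yM]
        N.submoduleE(4)[OF S(1) uR(2) y1[OF c]]
      by (cases "S (len c) = S' (len c)") simp_all
  qed
  have eE: "?e \<in> E"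
  proof (rule in_class_if_congruent_blocks[OF eM _ x])
    fix l assume "l \<in> len ` I"
    show "\<exists>w\<in>E. \<exists>v\<in>Units R. \<forall>c\<in>I. len c = l \<longrightarrow>
      (\<exists>n\<in>values_at l. ?e c \<ominus>\<^bsub>cyc l\<^esub> v \<odot>\<^bsub>cyc l\<^esub> w c = p \<odot>\<^bsub>cyc l\<^esub> n)"
    proof (cases "S l = S' l")
      case True
      have "\<exists>n\<in>values_at l. ?e c \<ominus>\<^bsub>cyc l\<^esub> (u' l \<otimes> inv (u l)) \<odot>\<^bsub>cyc l\<^esub> y c = p \<odot>\<^bsub>cyc l\<^esub> n"
        if c: "c \<in> I" "len c = l" for c
      proof (rule bexI[OF _ N.submodule_zero[OF vals]])
        have "?e c = (u' l \<otimes> inv (u l)) \<odot>\<^bsub>cyc l\<^esub> y c"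
          using c True comps(1)[OF c(1)] uR by (simp add: exchange_def N.smult_assoc1)
        then show "?e c \<ominus>\<^bsub>cyc l\<^esub> (u' l \<otimes> inv (u l)) \<odot>\<^bsub>cyc l\<^esub> y c = p \<odot>\<^bsub>cyc l\<^esub> \<zero>\<^bsub>cyc l\<^esub>"
          using c comps(1)[OF c(1)] uR by (simp add: a_minus_def N.M.r_neg)
      qed
      moreover have "u' l \<otimes> inv (u l) \<in> Units R" using u u' by simp
      ultimately show ?thesis using yE by blast
    next
      case False
      show ?thesis
      \<comment> \<open>By the chain property the smaller of the two submodules lies in
        \<open>p\<close> times the larger. If it is \<open>S'\<close>, the block is compared with
        \<open>u' x\<close>, the difference being in \<open>S'\<close>; otherwise with the inverse
        of \<open>u\<close> times \<open>z\<close>, the difference being in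
        \<open>S\<close>.\<close>
      proof (cases "S' l \<subseteq> S l")
        case True
        then obtain n where n: "n \<in> S l" "n \<notin> S' l" using False by auto
        have "\<exists>n\<in>values_at l. ?e c \<ominus>\<^bsub>cyc l\<^esub> u' l \<odot>\<^bsub>cyc l\<^esub> x c = p \<odot>\<^bsub>cyc l\<^esub> n"
          if c: "c \<in> I" "len c = l" for c
        proof -
          obtain k where "k \<in> S l" "?e c \<ominus>\<^bsub>cyc l\<^esub> u' l \<odot>\<^bsub>cyc l\<^esub> x c = p \<odot>\<^bsub>cyc l\<^esub> k"
            using submodule_strict_divisible[OF S'(1) S(1) n] e1[OF c(1)] c(2) by blast
          then show ?thesis using S(2) by blast
        qed
        then show ?thesis using x u' by blast
      next
        case False
        then obtain n where n: "n \<in> S' l" "n \<notin> S l" by auto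
        have neq: "S l \<noteq> S' l" using n by auto
        have "\<exists>n\<in>values_at l. ?e c \<ominus>\<^bsub>cyc l\<^esub> inv (u l) \<odot>\<^bsub>cyc l\<^esub> z c = p \<odot>\<^bsub>cyc l\<^esub> n"
          if c: "c \<in> I" "len c = l" for c
        proof -
          have "?e c \<ominus>\<^bsub>cyc l\<^esub> inv (u l) \<odot>\<^bsub>cyc l\<^esub> z c \<in> S l"
            using exchange_unequal_block(3)[OF c(1) yM] neq c(2) y1[OF c(1)]
              N.submoduleE(3)[OF S(1) N.submoduleE(4)[OF S(1) uR(3) N.submoduleE(4)[OF S(1) uR(2)]]] by simp
          then obtain k where "k \<in> S' l" "?e c \<ominus>\<^bsub>cyc l\<^esub> inv (u l) \<odot>\<^bsub>cyc l\<^esub> z c = p \<odot>\<^bsub>cyc l\<^esub> k"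
            using submodule_strict_divisible[OF S(1) S'(1) n] by blast
          then show ?thesis using S'(2) by blast
        qed
        moreover have "inv (u l) \<in> Units R" using u by simp
        ultimately show ?thesis using z by blast
      qed
    qed
  qed
  show "?e \<in> middle u' S' u S x z" using eE e1 e2 by (simp add: middle_def)
  show "exchange u' S' u S x z ?e = y"
  proof (rule extensionalityI[of _ I])
    show "y \<in> extensional I" using yM by (simp add: M_carrier)
    fix c assume c: "c \<in> I"
    show "exchange u' S' u S x z ?e c = y c"
    proof (cases "S (len c) = S' (len c)")
      case True
      then show ?thesis
        using c exchange_equal_block(3)[OF c yM True y1[OF c] y2[OF c]] by (simp add: exchange_def[of u' S'])
    next
      case False
      then show ?thesis
        using c exchange_unequal_block(4)[OF c yM False] by (auto simp: exchange_def[of u' S'])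
    qed
  qed (simp add: exchange_def)
qed

end

section \<open>Symmetry of the number of middle points\<close>

lemma finite_E: "finite E"
  using E_sub finite_M finite_subset by blast

lemma card_middle_commute:
  assumes "\<And>l. u l \<in> Units R" "\<And>l. u' l \<in> Units R"
    and "\<And>l. submodule (S l) R (cyc l)" "\<And>l. S l \<subseteq> values_at l"
    and "\<And>l. submodule (S' l) R (cyc l)" "\<And>l. S' l \<subseteq> values_at l"
    and "x \<in> E" "z \<in> E"
  shows "card (middle u S u' S' x z) = card (middle u' S' u S x z)"
proof (rule bij_betw_same_card)
  show "bij_betw (exchange u S u' S' x z) (middle u S u' S' x z) (middle u' S' u S x z)"
    by (rule bij_betwI[where g = "exchange u' S' u S x z"])
      (simp_all add: exchange_middle assms)
qed

lemma card_between_commute: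
  assumes "a \<in> E \<times> E" "b \<in> E \<times> E" "x \<in> E" "z \<in> E"
  shows "card {y\<in>E. pair_le (x, y) a \<and> pair_le (y, z) b} = card {y\<in>E. pair_le (x, y) b \<and> pair_le (y, z) a}"
proof -
  have ab: "fst a \<in> E" "snd a \<in> E" "fst b \<in> E" "snd b \<in> E" using assms by auto
  obtain u S where uS: "\<And>l. u l \<in> Units R" "\<And>l. submodule (S l) R (cyc l)" "\<And>l. S l \<subseteq> values_at l"
    "\<And>x y. x \<in> E \<Longrightarrow> y \<in> E \<Longrightarrow> pair_le (x, y) (fst a, snd a) \<longleftrightarrow>
      (\<forall>c\<in>I. y c \<ominus>\<^bsub>cyc (len c)\<^esub> u (len c) \<odot>\<^bsub>cyc (len c)\<^esub> x c \<in> S (len c))"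
    by (rule pair_le_iff[OF ab(1,2)]) (rule that)
  obtain u' S' where uS': "\<And>l. u' l \<in> Units R" "\<And>l. submodule (S' l) R (cyc l)" "\<And>l. S' l \<subseteq> values_at l"
    "\<And>x y. x \<in> E \<Longrightarrow> y \<in> E \<Longrightarrow> pair_le (x, y) (fst b, snd b) \<longleftrightarrow>
      (\<forall>c\<in>I. y c \<ominus>\<^bsub>cyc (len c)\<^esub> u' (len c) \<odot>\<^bsub>cyc (len c)\<^esub> x c \<in> S' (len c))"
    by (rule pair_le_iff[OF ab(3,4)]) (rule that)
  have "{y\<in>E. pair_le (x, y) a \<and> pair_le (y, z) b} = middle u S u' S' x z"
    using uS(4) uS'(4) assms(3,4) by (auto simp: middle_def)
  moreover have "{y\<in>E. pair_le (x, y) b \<and> pair_le (y, z) a} = middle u' S' u S x z"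
    using uS(4) uS'(4) assms(3,4) by (auto simp: middle_def)
  ultimately show ?thesis
    using card_middle_commute[OF uS(1) uS'(1) uS(2,3) uS'(2,3) assms(3,4)] by simp
qed

end

section \<open>Multiplicity freeness\<close>

lemma (in cyclic_product) orbit_class_orbit:
  assumes E: "E \<in> orbits (module_Aut R M) (carrier M) (\<lambda>g. g)"
  shows "orbit_class R p I len E" and "E \<subseteq> carrier M"
    and "\<And>g x. g \<in> carrier (module_Aut R M) \<Longrightarrow> x \<in> E \<Longrightarrow> g x \<in> E"
proof -
  let ?G = "module_Aut R M"
  interpret group_action ?G "carrier M" "\<lambda>g. g" by (rule group_action_module_Aut[OF M_module])
  interpret h: group_hom ?G "BijGroup (carrier M)" "\<lambda>g. g" by (rule group_hom)
  obtain x0 where x0: "x0 \<in> carrier M" "E = orbit ?G (\<lambda>g. g) x0" using E by (auto simp: orbits_def)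
  have E_iff: "y \<in> E \<longleftrightarrow> (\<exists>g\<in>carrier ?G. y = g x0)" for y using x0(2) by (auto simp: orbit_def)
  show sub: "E \<subseteq> carrier M" using E_iff element_image[OF _ x0(1) refl] by auto
  show closed: "g y \<in> E" if g: "g \<in> carrier ?G" "y \<in> E" for g y
  proof -
    obtain h where h: "h \<in> carrier ?G" "y = h x0" using g E_iff by auto
    have "g y = (g \<otimes>\<^bsub>?G\<^esub> h) x0" using composition_rule[OF x0(1) g(1) h(1)] h(2) by simp
    then show ?thesis using h.G.m_closed[OF g(1) h(1)] E_iff by blast
  qed
  have lin: "g \<in> linear_maps R M M" if "g \<in> carrier ?G" for g using that by (simp add: module_Aut_def)
  show "orbit_class R p I len E"
  proof
    fix x y assume "x \<in> E" "y \<in> E"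
    then obtain g h where g: "g \<in> carrier ?G" "x = g x0" and h: "h \<in> carrier ?G" "y = h x0" using E_iff by auto
    have xM: "x \<in> carrier M" using \<open>x \<in> E\<close> sub by auto
    have ig: "inv\<^bsub>?G\<^esub> g \<in> carrier ?G" by (rule h.G.inv_closed[OF g(1)])
    have "(inv\<^bsub>?G\<^esub> g) x = x0" using orbit_sym_aux[OF g(1) x0(1)] g(2) by simp
    then have "(h \<otimes>\<^bsub>?G\<^esub> inv\<^bsub>?G\<^esub> g) x = y" using composition_rule[OF xM h(1) ig] h(2) by simp
    then show "\<exists>a\<in>linear_maps R M M. a x = y" using lin[OF h.G.m_closed[OF h(1) ig]] by blast
  next
    fix x a b assume x: "x \<in> E" and ab: "a \<in> linear_maps R M M" "b \<in> linear_maps R M M" "b (a x) = x"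
    have "{x} \<subseteq> carrier M" using x sub by auto
    then obtain g where "g \<in> carrier ?G" "\<And>v. v \<in> {x} \<Longrightarrow> g v = a v"
      using conjugate_if_mutually_generated[OF ab(1,2), of "{x}"] ab(3) by blast
    then show "a x \<in> E" using closed[of g x] x by simp
  qed (rule sub)
qed

text \<open>Conjugacy is applied to the two-point set of \<open>x'\<close> and \<open>y'\<close>:
  the maps \<open>a\<close> and \<open>b\<close> undo each other there, so one automorphism carries
  the primed pair to the other.\<close>

lemma (in orbit_class) invariant_kernel_pair_le:
  assumes K: "\<And>g x y. \<lbrakk>g \<in> carrier (module_Aut R M); x \<in> E; y \<in> E\<rbrakk> \<Longrightarrow> K (g x) (g y) = K x y"
    and E: "x \<in> E" "y \<in> E" "x' \<in> E" "y' \<in> E" and le: "pair_le (x, y) (x', y')" "pair_le (x', y') (x, y)"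
  shows "K x y = K x' y'"
proof -
  obtain a b where a: "a \<in> linear_maps R M M" "a x' = x" "a y' = y"
    and b: "b \<in> linear_maps R M M" "b x = x'" "b y = y'"
    using le by (auto simp: pair_le_def)
  have V: "{x', y'} \<subseteq> carrier M" using E E_carrier by auto
  have ba: "b (a v) = v" if "v \<in> {x', y'}" for v using that a b by auto
  obtain g where g: "g \<in> carrier (module_Aut R M)" "\<And>v. v \<in> {x', y'} \<Longrightarrow> g v = a v"
    using conjugate_if_mutually_generated[OF a(1) b(1) V ba] by blast
  then show ?thesis using K[OF g(1) E(3,4)] a by simp
qed

lemma (in cyclic_product) multiplicity_free_orbit:
  assumes E: "E \<in> orbits (module_Aut R M) (carrier M) (\<lambda>g. g)"
  shows "multiplicity_free TYPE('w) (module_Aut R M) (perm_module E) (perm_action (module_Aut R M) (\<lambda>g. g) E)"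
proof -
  let ?G = "module_Aut R M"
  have act: "group_action ?G (carrier M) (\<lambda>g. g)" by (rule group_action_module_Aut[OF M_module])
  interpret orbit_class R p I len E by (rule orbit_class_orbit(1)[OF E])
  have closed: "g x \<in> E" if "g \<in> carrier ?G" "x \<in> E" for g x
    using orbit_class_orbit(3)[OF E that] .
  have rep: "representation ?G (perm_module E) (perm_action ?G (\<lambda>g. g) E)"
    by (rule representation_perm_action[OF act E_sub]) (rule closed)
  have dec: "\<exists>D. irreducible_decomposition ?G (perm_module E) (perm_action ?G (\<lambda>g. g) E) D"
    by (rule perm_irreducible_decomposition[OF act E_sub finite_E]) (rule closed)
  have comm: "A (B v) = B (A v)"
    if "A \<in> intertwiners ?G (perm_module E) (perm_action ?G (\<lambda>g. g) E)"
      "B \<in> intertwiners ?G (perm_module E) (perm_action ?G (\<lambda>g. g) E)" "v \<in> carrier (perm_module E)" for A B v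
  proof (rule perm_intertwiners_commute[OF act E_sub finite_E _ _ that])
    show "g x \<in> E" if "g \<in> carrier ?G" "x \<in> E" for g x using closed[OF that] .
  next
    fix K L :: "('i \<Rightarrow> 'a set) \<Rightarrow> ('i \<Rightarrow> 'a set) \<Rightarrow> complex" and x z
    assume K: "\<And>g x y. \<lbrakk>g \<in> carrier ?G; x \<in> E; y \<in> E\<rbrakk> \<Longrightarrow> K (g x) (g y) = K x y"
      and L: "\<And>g x y. \<lbrakk>g \<in> carrier ?G; x \<in> E; y \<in> E\<rbrakk> \<Longrightarrow> L (g x) (g y) = L x y"
      and xz: "x \<in> E" "z \<in> E"
    show "(\<Sum>y\<in>E. K x y * L y z) = (\<Sum>y\<in>E. L x y * K y z)"
    proof (rule kernels_commute[of E pair_le])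
      show "pair_le a c" if "pair_le a b" "pair_le b c" for a b c using pair_le_trans[OF that] .
      show "card {y\<in>E. pair_le (x, y) a \<and> pair_le (y, z) b} = card {y\<in>E. pair_le (x, y) b \<and> pair_le (y, z) a}"
        if "a \<in> E \<times> E" "b \<in> E \<times> E" "x \<in> E" "z \<in> E" for a b x z
        using card_between_commute[OF that] .
      show "K x y = K x' y'" if "x \<in> E" "y \<in> E" "x' \<in> E" "y' \<in> E" "pair_le (x, y) (x', y')" "pair_le (x', y') (x, y)"
        for x y x' y' using invariant_kernel_pair_le[of K, OF K that] .
      show "L x y = L x' y'" if "x \<in> E" "y \<in> E" "x' \<in> E" "y' \<in> E" "pair_le (x, y) (x', y')" "pair_le (x', y') (x, y)"
        for x y x' y' using invariant_kernel_pair_le[of L, OF L that] .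
    qed (simp_all add: finite_E pair_le_refl xz)
  qed
  show ?thesis
    unfolding multiplicity_free_def
  proof (intro conjI rep dec allI impI)
    fix D and W :: "(complex, 'w) module" and \<sigma>
    assume D: "irreducible_decomposition ?G (perm_module E) (perm_action ?G (\<lambda>g. g) E) D"
      and W: "irreducible_rep ?G W \<sigma>"
    show "rep_multiplicity ?G (perm_module E) (perm_action ?G (\<lambda>g. g) E) D W \<sigma> \<le> 1"
      by (rule multiplicity_le_one_if_intertwiners_commute[OF rep _ D W]) (rule comm)
  qed
qed

theorem theorem1:
  fixes R :: "('a, 'm) ring_scheme" and p :: 'a
    and k :: nat and lam rho :: "nat \<Rightarrow> nat"
    and E :: "(nat \<times> nat \<Rightarrow> 'a set) set"
  assumes "discrete_valuation_ring R" and "uniformizer R p"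
    and "finite (carrier (R Quot (PIdl\<^bsub>R\<^esub> p)))"
    and "card (carrier (R Quot (PIdl\<^bsub>R\<^esub> p))) \<ge> 3"
    and "is_partition k lam rho"
    and "E \<in> orbits (module_Aut R (partition_module R p k lam rho))
                    (carrier (partition_module R p k lam rho)) (\<lambda>g. g)"
  shows "multiplicity_free TYPE('w) (module_Aut R (partition_module R p k lam rho))
           (perm_module E)
           (perm_action (module_Aut R (partition_module R p k lam rho)) (\<lambda>g. g) E)"
proof -
  interpret local_uniformizer R p by (rule local_uniformizerI) (fact assms)+
  \<comment> \<open>The length of the factor at \<open>(i, j)\<close> depends only on
    \<open>i\<close>; the copies of one quotient form a homogeneous block.\<close>
  interpret cyclic_product R p "SIGMA i:{1..k}. {1..rho i}" "\<lambda>c. lam (fst c)"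
    by unfold_locales simp
  have eq: "partition_module R p k lam rho = M"
    by (simp add: partition_module_def case_prod_unfold)
  show ?thesis
    unfolding eq by (rule multiplicity_free_orbit) (use assms(6) in \<open>unfold eq\<close>)
qed

end
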